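(* Let $f\in\mathcal{E}$ and $q\in\mathbb{C}$ with $\Re(q)>0$. Then, for $\Re(z)>0$, a differsum of $f$ is given by $$\nabla_z^{-q}f(z)=\frac{1}{\Gamma(q)}\sum_z f(s)\,(z+1-s)_{q-1}\,\nabla_s .$$ That is, the right-hand side is holomorphic in $q$ for $\Re(q)>0$ and in $z$ for $\Re(z)>0$; for each integer $n\ge1$, at $q=n$ it equals the $n$-fold iterate $\sum_z\cdots\sum_z f$ of the indefinite sum; and $\nabla_z^{-q_1}\nabla_z^{-q_2}f=\nabla_z^{-(q_1+q_2)}f$ for all $q_1,q_2$ with $\Re(q_1),\Re(q_2)>0$.
   Context: The space $\mathcal{E}$ consists of all functions $f$ holomorphic on $\{z\in\mathbb{C}:\Re(z)>0\}$ such that for every $y\in\mathbb{R}$ the limit of $f(z)$ as $\Re(z)\to0^+$ along $\Im(z)=y$ exists and is finite, and such that there exist real $\alpha,\rho,C$ with $0\le\alpha<\pi/2$, $\rho\ge0$, $C>0$ and $|f(z)|<Ce^{\alpha|\Im(z)|+\rho|\Re(z)|}$ for $\Re(z)>0$. Indefinite sum: for a function $\psi$ holomorphic on a vertical strip $0<\Re(s)<b$ (or on $\Re(s)>0$) and exponentially bounded on vertical lines with exponent less than $\pi/2$, put, for $w$ in the strip, $$\sum_w\psi=\sum_w\psi(s)\,\nabla_s=\frac{1}{\Gamma(w)}\int_0^\infty e^{-t}t^{w-1}\int_0^t\frac{e^x}{2\pi i}\int_{\sigma-i\infty}^{\sigma+i\infty}\Gamma(\xi)\psi(\xi)x^{-\xi}\,d\xi\,dx\,dt,$$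 with any $\sigma$ in $(0,b)$ (resp. $\sigma>0$); the symbol $\nabla_s$ only records that $s$ is the summation variable. In the expression $\sum_z f(s)(z+1-s)_{q-1}\nabla_s$, $z$ is held fixed, the formula is applied to $\psi(s)=f(s)(z+1-s)_{q-1}$, which is holomorphic in $0<\Re(s)<\Re(z)+\Re(q)$, and the result is evaluated at $w=z$. Here $(z+1-s)_{q-1}=\frac{\Gamma(z-s+q)}{\Gamma(z+1-s)}$ and $\Gamma$ is Euler's Gamma function. Differsum: for $\phi$ holomorphic on an open set $\Omega$, a differsum $\nabla_z^s\phi$ is holomorphic in $s$ on an open set $\Omega'$ and in $z\in\Omega$ and satisfies: (1) for $n\in\mathbb{N}$, $\nabla_z^n\phi$ is the $n$-fold iterate of the backward difference $\nabla_z\phi=\phi(z)-\phi(z-1)$, and $\nabla_z^{-n}\phi$ is the $n$-fold iterate of the indefinite sum $\sum_z$ (each where the exponent lies in $\Omega'$); (2) $\nabla_z^{s_0}\nabla_z^{s_1}\phi=\nabla_z^{s_0+s_1}\phi$ whenever $s_0,s_1,s_0+s_1\in\Omega'$. Here $\Omega'=\{s:\Re(s)<0\}$ and $\Omega=\{z:\Re(z)>0\}$. *)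

theory Defs
  imports "HOL-Complex_Analysis.Complex_Analysis"
begin

definition exp_class :: "(complex \<Rightarrow> complex) set" where
  "exp_class = {f. f holomorphic_on {z. Re z > 0} \<and>
     (\<forall>y. \<exists>L. ((\<lambda>x. f (Complex x y)) \<longlongrightarrow> L) (at_right 0)) \<and>
     (\<exists>\<alpha> \<rho> C. 0 \<le> \<alpha> \<and> \<alpha> < pi / 2 \<and> \<rho> \<ge> 0 \<and> C > 0 \<and>
        (\<forall>z. Re z > 0 \<longrightarrow> norm (f z) < C * exp (\<alpha> * \<bar>Im z\<bar> + \<rho> * \<bar>Re z\<bar>)))}"

text \<open>The strip \<open>0 < Re s < b\<close>; for \<open>b = \<infinity>\<close> it is the right half-plane.\<close>

definition vstrip :: "ereal \<Rightarrow> complex set" where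
  "vstrip b = {s. 0 < Re s \<and> ereal (Re s) < b}"

definition sum_admissible :: "ereal \<Rightarrow> (complex \<Rightarrow> complex) \<Rightarrow> bool" where
  "sum_admissible b \<psi> \<longleftrightarrow> \<psi> holomorphic_on vstrip b \<and>
     (\<forall>\<sigma>. 0 < \<sigma> \<and> ereal \<sigma> < b \<longrightarrow>
        (\<exists>\<alpha> C. \<alpha> < pi / 2 \<and> (\<forall>y. norm (\<psi> (Complex \<sigma> y)) \<le> C * exp (\<alpha> * \<bar>y\<bar>))))"

text \<open>The three nested integrals defining the indefinite sum, for a fixed abscissa \<open>\<sigma>\<close>.
  On the vertical line \<open>\<xi> = \<sigma> + \<i> y\<close> one has \<open>d\<xi> = \<i> dy\<close>.\<close>

definition line_integrand :: "real \<Rightarrow> (complex \<Rightarrow> complex) \<Rightarrow> real \<Rightarrow> real \<Rightarrow> complex" where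
  "line_integrand \<sigma> \<psi> x y =
     (let \<xi> = Complex \<sigma> y in Gamma \<xi> * \<psi> \<xi> * of_real x powr (- \<xi>) * \<i>)"

definition mid_integrand :: "real \<Rightarrow> (complex \<Rightarrow> complex) \<Rightarrow> real \<Rightarrow> complex" where
  "mid_integrand \<sigma> \<psi> x =
     of_real (exp x) / (2 * of_real pi * \<i>) * (LINT y|lborel. line_integrand \<sigma> \<psi> x y)"

definition outer_integrand :: "real \<Rightarrow> (complex \<Rightarrow> complex) \<Rightarrow> complex \<Rightarrow> real \<Rightarrow> complex" where
  "outer_integrand \<sigma> \<psi> w t =
     of_real (exp (- t)) * of_real t powr (w - 1) * (LINT x:{0<..<t}|lborel. mid_integrand \<sigma> \<psi> x)"

text \<open>\<open>v\<close> is the value of the indefinite sum at \<open>w\<close>: for \<^emph>\<open>every\<close> admissible abscissa \<open>\<sigma>\<close>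
  all the integrals converge absolutely and the formula yields \<open>v\<close>.\<close>

definition has_indef_sum :: "ereal \<Rightarrow> (complex \<Rightarrow> complex) \<Rightarrow> complex \<Rightarrow> complex \<Rightarrow> bool" where
  "has_indef_sum b \<psi> w v \<longleftrightarrow> sum_admissible b \<psi> \<and> w \<in> vstrip b \<and>
     (\<forall>\<sigma>. 0 < \<sigma> \<and> ereal \<sigma> < b \<longrightarrow>
        (\<forall>x>0. integrable lborel (line_integrand \<sigma> \<psi> x)) \<and>
        (\<forall>t>0. set_integrable lborel {0<..<t} (mid_integrand \<sigma> \<psi>)) \<and>
        set_integrable lborel {0<..} (outer_integrand \<sigma> \<psi> w) \<and>
        v = 1 / Gamma w * (LINT t:{0<..}|lborel. outer_integrand \<sigma> \<psi> w t))"

definition indef_summable :: "ereal \<Rightarrow> (complex \<Rightarrow> complex) \<Rightarrow> complex \<Rightarrow> bool" where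
  "indef_summable b \<psi> w \<longleftrightarrow> (\<exists>v. has_indef_sum b \<psi> w v)"

definition indef_sum :: "ereal \<Rightarrow> (complex \<Rightarrow> complex) \<Rightarrow> complex \<Rightarrow> complex" where
  "indef_sum b \<psi> w = (THE v. has_indef_sum b \<psi> w v)"

text \<open>At the poles of the denominator \<open>Gamma a = 0\<close> in the library, so that the quotient is \<open>0\<close>,
  which is the value of the entire function \<open>1 / Gamma\<close> there.\<close>

definition rising :: "complex \<Rightarrow> complex \<Rightarrow> complex" where
  "rising a c = Gamma (a + c) / Gamma a"

definition frac_kernel :: "complex \<Rightarrow> (complex \<Rightarrow> complex) \<Rightarrow> complex \<Rightarrow> complex \<Rightarrow> complex" where
  "frac_kernel q f z s = f s * rising (z + 1 - s) (q - 1)"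

definition frac_sum :: "complex \<Rightarrow> (complex \<Rightarrow> complex) \<Rightarrow> complex \<Rightarrow> complex" where
  "frac_sum q f z = 1 / Gamma q * indef_sum (ereal (Re z + Re q)) (frac_kernel q f z) z"

definition frac_summable :: "complex \<Rightarrow> (complex \<Rightarrow> complex) \<Rightarrow> complex \<Rightarrow> bool" where
  "frac_summable q f z \<longleftrightarrow> indef_summable (ereal (Re z + Re q)) (frac_kernel q f z) z"

definition backward_diff :: "(complex \<Rightarrow> complex) \<Rightarrow> complex \<Rightarrow> complex" where
  "backward_diff \<phi> z = \<phi> z - \<phi> (z - 1)"

text \<open>\<open>D s\<close> plays the role of the operator \<open>\<nabla>\<^sup>s\<close>; the domain of \<open>\<phi>\<close> is \<open>vstrip b\<close> and the
  exponents range over \<open>S\<close>. Iterated differences are only compared where all the values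
  of \<open>\<phi>\<close> that enter are taken inside the domain.\<close>

definition is_differsum ::
  "ereal \<Rightarrow> complex set \<Rightarrow> (complex \<Rightarrow> (complex \<Rightarrow> complex) \<Rightarrow> complex \<Rightarrow> complex)
     \<Rightarrow> (complex \<Rightarrow> complex) \<Rightarrow> bool" where
  "is_differsum b S D \<phi> \<longleftrightarrow>
     open S \<and> \<phi> holomorphic_on vstrip b \<and>
     (\<forall>z\<in>vstrip b. (\<lambda>s. D s \<phi> z) holomorphic_on S) \<and>
     (\<forall>s\<in>S. D s \<phi> holomorphic_on vstrip b) \<and>
     (\<forall>n::nat. of_nat n \<in> S \<longrightarrow>
        (\<forall>z. (\<forall>k\<le>n. z - of_nat k \<in> vstrip b) \<longrightarrow> D (of_nat n) \<phi> z = (backward_diff ^^ n) \<phi> z)) \<and>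
     (\<forall>n::nat. - of_nat n \<in> S \<longrightarrow>
        (\<forall>k<n. \<forall>z\<in>vstrip b. indef_summable b ((indef_sum b ^^ k) \<phi>) z) \<and>
        (\<forall>z\<in>vstrip b. D (- of_nat n) \<phi> z = (indef_sum b ^^ n) \<phi> z)) \<and>
     (\<forall>s0\<in>S. \<forall>s1\<in>S. s0 + s1 \<in> S \<longrightarrow>
        (\<forall>z\<in>vstrip b. D s0 (D s1 \<phi>) z = D (s0 + s1) \<phi> z))"

end

theory Submission
  imports Defs "HOL-Probability.Characteristic_Functions"
begin

text \<open>
  Write \<open>\<Phi> = \<Gamma> f\<close> and let \<open>F\<close> be its inverse Mellin transform. As \<open>\<Phi>\<close> decays exponentially on vertical
  lines, \<open>F\<close> extends to a sector and is \<open>O(x powr - \<sigma>)\<close> there for every \<open>\<sigma> > 0\<close>; conversely the Mellin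
  transform of such an \<open>F\<close> has that decay. In terms of \<open>F\<close> the indefinite sum is convolution
  with \<open>exp (- t)\<close>, so the operator of order \<open>q\<close> has to be convolution with
  \<open>t powr (q - 1) * exp (- t) / \<Gamma> q\<close>; the semigroup law is then the Beta integral, and it carries over
  to \<open>f\<close> by Mellin inversion.

  It remains to see that the stated formula is this convolution. If \<open>H\<close> is the inverse Mellin
  transform of \<open>\<Phi> \<xi> * \<Gamma> (z - \<xi> + q) / \<Gamma> (z + 1 - \<xi>)\<close>, the substitution \<open>t = x (1 + r)\<close> turns both sides
  into integrals over \<open>r > 0\<close>, against \<open>(1 + r) powr (z - 1)\<close>, of
  \<open>\<integral> x powr z * exp (- x r) * H x dx\<close> and of
  \<open>r powr (q - 1) * \<integral> x powr (z + q - 1) * exp (- x r) * F x dx\<close>. By Fubini both equal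
  \<open>1 / (2 \<pi> \<i>) * \<integral> \<Phi> \<xi> * \<Gamma> (z + q - \<xi>) * r powr (\<xi> - z - 1) d\<xi>\<close>.

  All functions of \<open>x > 0\<close> are written in the variable \<open>w = ln x\<close>: sectors become horizontal strips,
  and scalings become translations.
\<close>

section \<open>Parameter integrals and Fourier inversion\<close>

text \<open>The condition \<alpha> < pi / 2 provides room for decay: \<open>Gamma\<close> decays on
  vertical lines at every rate below pi / 2, so \<open>Gamma \<xi> * f \<xi>\<close> keeps every
  rate below \<beta> = pi / 2 - \<alpha>. The bound \<beta> <= pi / 2 accompanies the convolutions
  because their kernel exp (- t) decays only in sectors of half-angle below pi / 2. The intermediate
  results assume decay of \<open>Gamma \<xi> * f \<xi>\<close> in place of membership in
  \<open>exp_class\<close>: fractional sums inherit this property with the same \<beta>, so they can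
  be iterated. F and H are not on an equal footing. F satisfies power bounds with every positive
  exponent, H only with exponents below Re z + Re q, where Gamma (z - \<xi> + q) meets its first
  pole. Integrals of H therefore use one exponent below 1 (for x near 0) and one between Re z and Re
  z + min 1 (Re q) (for large x). The denominator Gamma (z + 1 - \<xi>) of the kernel is what makes
  both sides agree: it cancels the Gamma factor produced by the convolution of order 1 that is built
  into the indefinite sum.\<close>

lemma holomorphic_on_lebesgue_integral:
  fixes \<phi> :: "complex \<Rightarrow> 'a \<Rightarrow> complex"
  assumes S: "open S"
    and meas: "\<And>s. s \<in> S \<Longrightarrow> \<phi> s \<in> borel_measurable M"
    and hol: "\<And>x. x \<in> space M \<Longrightarrow> (\<lambda>s. \<phi> s x) holomorphic_on S"
    and dom: "\<And>s0. s0 \<in> S \<Longrightarrow> \<exists>e>0. \<exists>g. integrable M g \<and>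
      (\<forall>s\<in>S. dist s0 s < e \<longrightarrow> (\<forall>x\<in>space M. norm (\<phi> s x) \<le> g x))"
  shows "(\<lambda>s. LINT x|M. \<phi> s x) holomorphic_on S"
  unfolding holomorphic_on_open[OF S]
proof
  fix s0 assume s0: "s0 \<in> S"
  obtain e g where e: "e > 0" and g: "integrable M g"
    and bound: "\<And>s x. s \<in> S \<Longrightarrow> dist s0 s < e \<Longrightarrow> x \<in> space M \<Longrightarrow> norm (\<phi> s x) \<le> g x"
    using dom[OF s0] by metis
  obtain r0 where r0: "r0 > 0" "cball s0 r0 \<subseteq> S"
    using open_contains_cball S s0 by blast
  define r where "r = min r0 (e / 2)"
  have r: "r > 0" "r < e" "cball s0 r \<subseteq> S"
    using r0 e by (auto simp: r_def)
  have in_S: "s \<in> S" "dist s0 s < e" if "dist s0 s \<le> r" for s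
    using that r by auto
  have int: "integrable M (\<phi> s)" if "dist s0 s \<le> r" for s
    by (rule Bochner_Integration.integrable_bound[OF g])
       (use in_S[OF that] meas bound in \<open>auto intro!: AE_I2 order_trans[OF bound] abs_ge_self\<close>)
  \<comment> \<open>The hypothesis dominates only the values of \<open>\<phi>\<close>. Cauchy's
    inequality on circles of radius \<open>r/2\<close> about points of the half ball, which stay
    inside \<open>cball s0 r\<close>, dominates the derivatives, hence all difference quotients, by
    \<open>2 * g x / r\<close>.\<close>
  have lip: "norm (\<phi> s x - \<phi> s0 x) \<le> (2 * g x / r) * norm (s - s0)"
    if x: "x \<in> space M" and s: "s \<in> ball s0 (r/2)" for s x
  proof (rule field_differentiable_bound[where S = "ball s0 (r/2)" and f' = "deriv (\<lambda>s. \<phi> s x)"])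
    fix \<zeta> assume z: "\<zeta> \<in> ball s0 (r/2)"
    have sub: "cball \<zeta> (r/2) \<subseteq> S"
    proof
      fix w assume "w \<in> cball \<zeta> (r/2)"
      then have "dist s0 w \<le> r" using z dist_triangle[of s0 w \<zeta>] by auto
      then show "w \<in> S" by (rule in_S)
    qed
    have zS: "\<zeta> \<in> S" using sub r by auto
    show "((\<lambda>s. \<phi> s x) has_field_derivative deriv (\<lambda>s. \<phi> s x) \<zeta>) (at \<zeta> within ball s0 (r/2))"
      using holomorphic_derivI[OF hol[OF x] S zS] by (rule has_field_derivative_at_within)
    have "norm ((deriv ^^ 1) (\<lambda>s. \<phi> s x) \<zeta>) \<le> fact 1 * g x / (r/2) ^ 1"
    proof (rule Cauchy_inequality)
      show "(\<lambda>s. \<phi> s x) holomorphic_on ball \<zeta> (r/2)"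
        by (rule holomorphic_on_subset[OF hol[OF x]]) (use sub ball_subset_cball in blast)
      show "continuous_on (cball \<zeta> (r/2)) (\<lambda>s. \<phi> s x)"
        by (rule holomorphic_on_imp_continuous_on[OF holomorphic_on_subset[OF hol[OF x] sub]])
      fix w assume "norm (\<zeta> - w) = r/2"
      then have "dist s0 w \<le> r"
        using z dist_triangle[of s0 w \<zeta>] by (auto simp: dist_norm)
      then show "norm (\<phi> w x) \<le> g x" using in_S bound x by blast
    qed (use r in auto)
    then show "norm (deriv (\<lambda>s. \<phi> s x) \<zeta>) \<le> 2 * g x / r" by (simp add: mult.commute)
  qed (use s r in auto)
  define D where "D = (\<lambda>x. deriv (\<lambda>s. \<phi> s x) s0)"
  have "((\<lambda>s. ((LINT x|M. \<phi> s x) - (LINT x|M. \<phi> s0 x)) / (s - s0)) \<longlongrightarrow> (LINT x|M. D x))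
      (at s0 within ball s0 (r/2))"
    unfolding tendsto_at_iff_sequentially o_def
  proof (intro allI impI)
    fix X :: "nat \<Rightarrow> complex"
    assume X: "\<forall>i. X i \<in> ball s0 (r/2) - {s0}" and lim: "X \<longlonglongrightarrow> s0"
    have Xr: "dist s0 (X i) \<le> r" for i
    proof -
      have "dist s0 (X i) < r/2" using X by auto
      then show ?thesis using r by linarith
    qed
    define Q where "Q = (\<lambda>i x. (\<phi> (X i) x - \<phi> s0 x) / (X i - s0))"
    have lim_Q: "(\<lambda>i. Q i x) \<longlonglongrightarrow> D x" if x: "x \<in> space M" for x
    proof -
      have "((\<lambda>s. \<phi> s x) has_field_derivative D x) (at s0)"
        unfolding D_def by (rule holomorphic_derivI[OF hol[OF x] S s0])
      then have "((\<lambda>s. (\<phi> s x - \<phi> s0 x) / (s - s0)) \<longlongrightarrow> D x) (at s0)"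
        by (simp add: has_field_derivative_iff)
      then show ?thesis
        unfolding tendsto_at_iff_sequentially o_def Q_def using X lim by auto
    qed
    have Q_meas: "Q i \<in> borel_measurable M" for i
      unfolding Q_def using meas[OF in_S(1)[OF Xr]] meas[OF s0] by measurable
    have D_meas: "D \<in> borel_measurable M"
      by (rule borel_measurable_LIMSEQ_metric[OF Q_meas lim_Q])
    have "(\<lambda>i. LINT x|M. Q i x) \<longlonglongrightarrow> (LINT x|M. D x)"
    proof (rule integral_dominated_convergence[where w = "\<lambda>x. 2 * g x / r"])
      show "integrable M (\<lambda>x. 2 * g x / r)" using g by simp
      show "AE x in M. norm (Q i x) \<le> 2 * g x / r" for i
      proof (rule AE_I2)
        fix x assume x: "x \<in> space M"
        have "X i \<noteq> s0" "X i \<in> ball s0 (r/2)" using X by auto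
        then show "norm (Q i x) \<le> 2 * g x / r"
          using lip[OF x, of "X i"] unfolding Q_def norm_divide
          by (subst pos_divide_le_eq) auto
      qed
    qed (use D_meas Q_meas lim_Q in auto)
    moreover have "(LINT x|M. Q i x) = ((LINT x|M. \<phi> (X i) x) - (LINT x|M. \<phi> s0 x)) / (X i - s0)" for i
      unfolding Q_def using int[OF Xr, of i] int[of s0] r by simp
    ultimately show "(\<lambda>i. ((LINT x|M. \<phi> (X i) x) - (LINT x|M. \<phi> s0 x)) / (X i - s0))
        \<longlonglongrightarrow> (LINT x|M. D x)"
      by simp
  qed
  then show "\<exists>f'. ((\<lambda>s. LINT x|M. \<phi> s x) has_field_derivative f') (at s0)"
    using r by (auto simp: has_field_derivative_iff at_within_open[of s0 "ball s0 (r/2)"])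
qed

text \<open>The common majorant: in the variable ln x, power decay at both ends of the half line
  becomes two-sided exponential decay.\<close>

lemma integrable_exp_minus_abs:
  assumes "\<kappa> > 0"
  shows "integrable lborel (\<lambda>u::real. exp (- \<kappa> * \<bar>u\<bar>))"
proof -
  define h :: "real \<Rightarrow> real" where "h = (\<lambda>u. indicator {0..} u * exp (- \<kappa> * u))"
  have h_meas[measurable]: "h \<in> borel_measurable lborel" by (simp add: h_def)
  have "set_integrable lebesgue {0..} (\<lambda>u. exp (- \<kappa> * u))"
    by (rule nonnegative_absolutely_integrable_1)
       (use integrable_on_exp_minus_to_infinity[OF assms] in auto)
  then have "integrable lebesgue h"
    by (simp add: set_integrable_def h_def)
  then have h: "integrable lborel h"
    by (subst (asm) integrable_completion) auto
  have "integrable lborel (\<lambda>u. h (0 + (-1) * u))"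
    by (rule lborel_integrable_real_affine[OF h]) simp
  then have sum: "integrable lborel (\<lambda>u. h u + h (- u))"
    using h by simp
  show ?thesis
    by (rule Bochner_Integration.integrable_bound[OF sum])
       (auto intro!: AE_I2 simp: h_def indicator_def)
qed

text \<open>The integral over the line through \<open>s\<close> is holomorphic in \<open>s\<close> and invariant under real
  translations of \<open>s\<close>, hence constant; no contours are needed.\<close>

lemma horizontal_integral:
  fixes \<Psi> :: "complex \<Rightarrow> complex"
  assumes hol: "\<Psi> holomorphic_on {w. c < Im w \<and> Im w < d}"
    and dec: "\<And>c' d'. c < c' \<Longrightarrow> c' \<le> d' \<Longrightarrow> d' < d \<Longrightarrow>
      \<exists>C \<kappa>. \<kappa> > 0 \<and> (\<forall>w. c' \<le> Im w \<and> Im w \<le> d' \<longrightarrow> norm (\<Psi> w) \<le> C * exp (- \<kappa> * \<bar>Re w\<bar>))"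
  shows horizontal_integrable: "\<And>\<theta>. c < \<theta> \<Longrightarrow> \<theta> < d \<Longrightarrow> integrable lborel (\<lambda>u. \<Psi> (Complex u \<theta>))"
    and horizontal_integral_shift: "\<And>\<theta> \<theta>'. c < \<theta> \<Longrightarrow> \<theta> < d \<Longrightarrow> c < \<theta>' \<Longrightarrow> \<theta>' < d \<Longrightarrow>
      (LINT u|lborel. \<Psi> (Complex u \<theta>)) = (LINT u|lborel. \<Psi> (Complex u \<theta>'))"
proof -
  define S where "S = {w. c < Im w \<and> Im w < d}"
  have S_open: "open S"
    unfolding S_def by (intro open_Collect_conj open_halfspace_Im_gt open_halfspace_Im_lt)
  have S_eq: "S = {w. Im w > c} \<inter> {w. Im w < d}" by (auto simp: S_def)
  have S_convex: "convex S"
    unfolding S_eq by (intro convex_Int convex_halfspace_Im_gt convex_halfspace_Im_lt)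
  have cont: "continuous_on S \<Psi>"
    using hol holomorphic_on_imp_continuous_on by (auto simp: S_def)
  have meas: "(\<lambda>u. \<Psi> (s + of_real u)) \<in> borel_measurable lborel" if "s \<in> S" for s
  proof -
    have "continuous_on UNIV (\<lambda>u::real. \<Psi> (s + of_real u))"
      by (rule continuous_on_compose2[OF cont]) (use that in \<open>auto intro!: continuous_intros simp: S_def\<close>)
    then show ?thesis by (simp add: borel_measurable_continuous_onI)
  qed
  have dom: "\<exists>e>0. \<exists>g. integrable lborel g \<and>
      (\<forall>s\<in>S. dist s0 s < e \<longrightarrow> (\<forall>u\<in>space lborel. norm (\<Psi> (s + of_real u)) \<le> g u))"
    if s0: "s0 \<in> S" for s0
  proof -
    \<comment> \<open>The bound 1 lets a displacement of the real part be absorbed into the constant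
      of \<open>g\<close>; the half distance keeps the closed band around \<open>Im s0\<close>
      inside the strip.\<close>
    define e where "e = min 1 (min (Im s0 - c) (d - Im s0) / 2)"
    have e: "e > 0" "e \<le> 1" "c < Im s0 - e" "Im s0 + e < d"
      using s0 by (auto simp: e_def S_def min_def field_simps)
    obtain C \<kappa> where \<kappa>: "\<kappa> > 0"
      and C: "\<And>w. Im s0 - e \<le> Im w \<Longrightarrow> Im w \<le> Im s0 + e \<Longrightarrow> norm (\<Psi> w) \<le> C * exp (- \<kappa> * \<bar>Re w\<bar>)"
      using dec[of "Im s0 - e" "Im s0 + e"] e by auto
    have "0 \<le> C * exp (- \<kappa> * \<bar>Re s0\<bar>)" using order_trans[OF norm_ge_zero C[of s0]] e by auto
    then have C0: "C \<ge> 0" by (simp add: zero_le_mult_iff)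
    define g where "g = (\<lambda>u::real. C * exp (\<kappa> * (\<bar>Re s0\<bar> + 1)) * exp (- \<kappa> * \<bar>u\<bar>))"
    have g_int: "integrable lborel g"
      unfolding g_def by (rule integrable_mult_right) (rule integrable_exp_minus_abs[OF \<kappa>])
    have g: "norm (\<Psi> (s + of_real u)) \<le> g u" if "dist s0 s < e" for s u
    proof -
      have d: "\<bar>Im s - Im s0\<bar> < e" "\<bar>Re s - Re s0\<bar> < e"
        using that abs_Im_le_cmod[of "s - s0"] abs_Re_le_cmod[of "s - s0"]
        by (auto simp: dist_norm norm_minus_commute)
      have "norm (\<Psi> (s + of_real u)) \<le> C * exp (- \<kappa> * \<bar>Re (s + of_real u)\<bar>)"
        using d by (intro C) (auto simp: abs_less_iff)
      also have "\<dots> \<le> C * exp (\<kappa> * (\<bar>Re s0\<bar> + 1) - \<kappa> * \<bar>u\<bar>)"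
      proof -
        have "\<bar>u\<bar> \<le> \<bar>Re (s + of_real u)\<bar> + (\<bar>Re s0\<bar> + 1)" using d e by auto
        then have "\<kappa> * \<bar>u\<bar> \<le> \<kappa> * (\<bar>Re (s + of_real u)\<bar> + (\<bar>Re s0\<bar> + 1))"
          using \<kappa> by (intro mult_left_mono) auto
        then show ?thesis
          by (intro mult_left_mono[OF _ C0]) (simp add: algebra_simps)
      qed
      also have "\<dots> = g u" by (simp add: g_def exp_diff exp_minus field_simps)
      finally show ?thesis .
    qed
    show ?thesis using e g g_int by blast
  qed
  define J where "J = (\<lambda>s. LINT u|lborel. \<Psi> (s + of_real u))"
  have J_hol: "J holomorphic_on S"
    unfolding J_def
  proof (rule holomorphic_on_lebesgue_integral[OF S_open meas _ dom])
    fix u :: real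
    have "(\<Psi> \<circ> (\<lambda>s. s + of_real u)) holomorphic_on S"
      by (rule holomorphic_on_compose_gen[where t = S])
         (use hol in \<open>auto intro!: holomorphic_intros simp: S_def\<close>)
    then show "(\<lambda>s. \<Psi> (s + of_real u)) holomorphic_on S" by (simp add: o_def)
  qed
  have J_shift: "J (s + of_real \<tau>) = J s" for s \<tau>
    unfolding J_def
    by (subst lborel_integral_real_affine[where c = 1 and t = "\<tau>" and f = "\<lambda>u. \<Psi> (s + of_real u)"])
       (auto simp: add_ac)
  have "(J has_field_derivative 0) (at s)" if s: "s \<in> S" for s
  proof -
    obtain D where D: "(J has_field_derivative D) (at s)"
      using J_hol S_open s holomorphic_on_open by blast
    then have "((\<lambda>h. (J (s + h) - J s) / h) \<longlongrightarrow> D) (at 0)"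
      by (rule DERIV_D)
    then have "\<forall>X. (\<forall>i. X i \<in> UNIV - {0}) \<longrightarrow> X \<longlonglongrightarrow> 0 \<longrightarrow> (\<lambda>i. (J (s + X i) - J s) / X i) \<longlonglongrightarrow> D"
      unfolding tendsto_at_iff_sequentially o_def .
    note * = this
    \<comment> \<open>Along these real increments every difference quotient of \<open>J\<close> is 0
      by \<open>J_shift\<close>, and one such sequence already identifies the complex
      derivative.\<close>
    define X :: "nat \<Rightarrow> complex" where "X = (\<lambda>i. of_real (1 / real (Suc i)))"
    have X_lim: "X \<longlonglongrightarrow> 0"
      using tendsto_of_real[OF LIMSEQ_Suc[OF lim_1_over_n], where 'a = complex] by (simp add: X_def)
    have X_nz: "\<forall>i. X i \<in> UNIV - {0}"
    proof
      fix i show "X i \<in> UNIV - {0}" unfolding X_def Diff_iff singleton_iff of_real_eq_0_iff by simp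
    qed
    have "(\<lambda>i. (J (s + X i) - J s) / X i) \<longlonglongrightarrow> D"
      by (rule *[rule_format, OF _ X_lim]) (use X_nz in blast)
    then have "(\<lambda>i::nat. 0::complex) \<longlonglongrightarrow> D" unfolding X_def J_shift by simp
    then have "D = 0" by (simp add: LIMSEQ_const_iff)
    with D show ?thesis by simp
  qed
  then obtain k where k: "\<And>s. s \<in> S \<Longrightarrow> J s = k"
    using has_field_derivative_zero_constant[OF S_convex, of J] has_field_derivative_at_within by metis
  have line: "Complex u \<theta> = Complex 0 \<theta> + of_real u" for u \<theta> by (simp add: complex_eq_iff)
  show "integrable lborel (\<lambda>u. \<Psi> (Complex u \<theta>))" if "c < \<theta>" "\<theta> < d" for \<theta>
  proof -
    have s: "Complex 0 \<theta> \<in> S" using that by (simp add: S_def)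
    from dom[OF s] obtain e g where "e > 0" and g: "integrable lborel g"
      and b: "\<forall>s\<in>S. dist (Complex 0 \<theta>) s < e \<longrightarrow> (\<forall>u\<in>space lborel. norm (\<Psi> (s + of_real u)) \<le> g u)" by blast
    then have b': "norm (\<Psi> (Complex u \<theta>)) \<le> g u" for u by (subst line) (use s in auto)
    show ?thesis
      by (rule Bochner_Integration.integrable_bound[OF g])
         (use meas[OF s] order_trans[OF b' abs_ge_self] in \<open>auto simp: line[symmetric]\<close>)
  qed
  show "(LINT u|lborel. \<Psi> (Complex u \<theta>)) = (LINT u|lborel. \<Psi> (Complex u \<theta>'))"
    if "c < \<theta>" "\<theta> < d" "c < \<theta>'" "\<theta>' < d" for \<theta> \<theta>'
    using k[of "Complex 0 \<theta>"] k[of "Complex 0 \<theta>'"] that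
    by (simp add: J_def line[symmetric] S_def)
qed

lemma integrable_pair_product_bound:
  fixes f :: "real \<Rightarrow> real \<Rightarrow> complex"
  assumes f: "case_prod f \<in> borel_measurable (lborel \<Otimes>\<^sub>M lborel)"
    and g: "integrable lborel g" and h: "integrable lborel h"
    and bound: "\<And>x y. norm (f x y) \<le> g x * h y"
  shows "integrable (lborel \<Otimes>\<^sub>M lborel) (case_prod f)"
proof -
  have [measurable]: "g \<in> borel_measurable borel" "h \<in> borel_measurable borel"
    using g h by auto
  have "integrable (lborel \<Otimes>\<^sub>M lborel) (\<lambda>(x, y). g x * h y :: real)"
  proof (rule lborel_pair.Fubini_integrable)
    show "integrable lborel (\<lambda>x. LINT y|lborel. norm (case (x, y) of (x, y) \<Rightarrow> g x * h y))"
      using g by (simp add: abs_mult)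
  qed (use h in auto)
  then show ?thesis
    by (rule Bochner_Integration.integrable_bound[OF _ f])
       (auto intro!: AE_I2 order_trans[OF bound] abs_ge_self)
qed

section \<open>Fourier inversion by Gaussian regularisation\<close>

text \<open>Up to normalisation this is the characteristic function of the standard normal
  distribution.\<close>

lemma fourier_gaussian:
  "(LINT v|lborel. iexp (t * v) * of_real (exp (- v\<^sup>2 / 2))) = of_real (sqrt (2 * pi) * exp (- t\<^sup>2 / 2))"
proof -
  have "char std_normal_distribution t = (LINT v|lborel. std_normal_density v *\<^sub>R iexp (t * v))"
    unfolding char_def by (subst integral_density) auto
  also have "\<dots> = (LINT v|lborel. of_real (1 / sqrt (2 * pi)) * (iexp (t * v) * of_real (exp (- v\<^sup>2 / 2))))"
    by (rule Bochner_Integration.integral_cong) (auto simp: std_normal_density_def scaleR_conv_of_real)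
  also have "\<dots> = of_real (1 / sqrt (2 * pi)) * (LINT v|lborel. iexp (t * v) * of_real (exp (- v\<^sup>2 / 2)))"
    by simp
  finally show ?thesis
    unfolding char_std_normal_distribution by (simp add: field_simps)
qed

lemma integrable_gaussian: "integrable lborel (\<lambda>v::real. exp (- v\<^sup>2 / 2))"
proof -
  have "integrable lborel (\<lambda>v. sqrt (2 * pi) * (std_normal_density v * v ^ (2 * 0)))"
    by (intro integrable_mult_right integrable.intros[OF std_normal_moment_even])
  then show ?thesis by (simp add: std_normal_density_def)
qed

text \<open>The iterated integral is not absolutely convergent as a double integral. The factor exp
  (- (y / n)^2 / 2) makes it so, and after the exchange a Gaussian average of \<open>h\<close>
  around \<open>x\<close> of width 1 / n appears. Dominated convergence then applies on both sides:
  with the norm of the transform as majorant on one, with \<open>B\<close> times a Gaussian on the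
  other.\<close>

lemma fourier_inversion:
  fixes h :: "real \<Rightarrow> complex"
  assumes cont: "continuous_on UNIV h" and bnd: "\<And>u. norm (h u) \<le> B"
    and int: "integrable lborel h"
    and hat: "integrable lborel (\<lambda>y. LINT u|lborel. iexp (y * u) * h u)"
  shows "(LINT y|lborel. iexp (- (y * x)) * (LINT u|lborel. iexp (y * u) * h u)) = 2 * pi * h x"
proof (rule LIMSEQ_unique)
  define H where "H = (\<lambda>y. LINT u|lborel. iexp (y * u) * h u)"
  define n :: "nat \<Rightarrow> real" where "n = (\<lambda>k. real (Suc k))"
  have n: "n k > 0" for k by (simp add: n_def)
  have n_lim: "(\<lambda>k. 1 / n k) \<longlonglongrightarrow> 0"
    unfolding n_def by (rule LIMSEQ_Suc[OF lim_1_over_n])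
  have h_meas[measurable]: "h \<in> borel_measurable borel"
    using cont by (rule borel_measurable_continuous_onI)
  have H_meas[measurable]: "H \<in> borel_measurable borel"
    using hat by (auto simp: H_def)
  define A where "A = (\<lambda>k. LINT y|lborel. iexp (- (y * x)) * H y * of_real (exp (- (y / n k)\<^sup>2 / 2)))"
  show "A \<longlonglongrightarrow> (LINT y|lborel. iexp (- (y * x)) * H y)"
    unfolding A_def
  proof (rule integral_dominated_convergence[where w = "\<lambda>y. norm (H y)"])
    show "integrable lborel (\<lambda>y. norm (H y))" using hat by (simp add: H_def)
    show "AE y in lborel. (\<lambda>k. iexp (- (y * x)) * H y * of_real (exp (- (y / n k)\<^sup>2 / 2))) \<longlonglongrightarrow>
        iexp (- (y * x)) * H y"
    proof (rule AE_I2)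
      fix y
      have "(\<lambda>k. of_real (exp (- (y * (1 / n k))\<^sup>2 / 2)) :: complex) \<longlonglongrightarrow> of_real (exp (- (y * 0)\<^sup>2 / 2))"
        by (intro tendsto_intros n_lim) auto
      from tendsto_mult[OF tendsto_const[of "iexp (- (y * x)) * H y"] this]
      show "(\<lambda>k. iexp (- (y * x)) * H y * of_real (exp (- (y / n k)\<^sup>2 / 2))) \<longlonglongrightarrow>
          iexp (- (y * x)) * H y"
        by simp
    qed
  qed (auto simp: norm_mult intro!: AE_I2 mult_left_le)
  have inner: "(LINT y|lborel. iexp (- (y * x)) * iexp (y * u) * of_real (exp (- (y / n k)\<^sup>2 / 2))) =
      of_real (n k * sqrt (2 * pi) * exp (- (n k * (u - x))\<^sup>2 / 2))" for k u
  proof -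
    have "(LINT y|lborel. iexp (- (y * x)) * iexp (y * u) * of_real (exp (- (y / n k)\<^sup>2 / 2))) =
        \<bar>n k\<bar> *\<^sub>R (LINT v|lborel. iexp (- ((0 + n k * v) * x)) * iexp ((0 + n k * v) * u) *
          of_real (exp (- ((0 + n k * v) / n k)\<^sup>2 / 2)))"
      by (rule lborel_integral_real_affine) (use n[of k] in simp)
    also have "\<dots> = \<bar>n k\<bar> *\<^sub>R (LINT v|lborel. iexp ((n k * (u - x)) * v) * of_real (exp (- v\<^sup>2 / 2)))"
    proof (intro arg_cong2[where f = scaleR] refl Bochner_Integration.integral_cong)
      fix v
      show "iexp (- ((0 + n k * v) * x)) * iexp ((0 + n k * v) * u) *
          of_real (exp (- ((0 + n k * v) / n k)\<^sup>2 / 2)) =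
          iexp ((n k * (u - x)) * v) * of_real (exp (- v\<^sup>2 / 2))"
        using n[of k] by (simp add: exp_add[symmetric] algebra_simps)
    qed
    finally show ?thesis
      using n[of k] by (simp only: fourier_gaussian) (simp add: scaleR_conv_of_real)
  qed
  have A_eq: "A k = of_real (sqrt (2 * pi)) * (LINT v|lborel. h (x + v / n k) * of_real (exp (- v\<^sup>2 / 2)))" for k
  proof -
    define f where "f = (\<lambda>y u. iexp (- (y * x)) * iexp (y * u) * h u * of_real (exp (- (y / n k)\<^sup>2 / 2)))"
    have gint: "integrable lborel (\<lambda>y. exp (- (y / n k)\<^sup>2 / 2))"
      using lborel_integrable_real_affine[OF integrable_gaussian, of "1 / n k" 0] n[of k] by simp
    have f_int: "integrable (lborel \<Otimes>\<^sub>M lborel) (case_prod f)"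
      by (rule integrable_pair_product_bound[OF _ gint integrable_norm[OF int]])
         (auto simp: f_def norm_mult)
    have "A k = (LINT y|lborel. LINT u|lborel. f y u)"
      unfolding A_def H_def f_def
      by (intro Bochner_Integration.integral_cong refl) (simp flip: integral_mult_right_zero integral_mult_left_zero add: mult_ac)
    also have "\<dots> = (LINT u|lborel. LINT y|lborel. f y u)"
      by (rule lborel_pair.Fubini_integral[OF f_int, symmetric])
    also have "\<dots> = (LINT u|lborel. h u * (LINT y|lborel. iexp (- (y * x)) * iexp (y * u) * of_real (exp (- (y / n k)\<^sup>2 / 2))))"
      unfolding f_def
      by (intro Bochner_Integration.integral_cong refl) (simp flip: integral_mult_right_zero add: mult_ac)
    also have "\<dots> = (LINT u|lborel. h u * of_real (n k * sqrt (2 * pi) * exp (- (n k * (u - x))\<^sup>2 / 2)))"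
      unfolding inner ..
    \<comment> \<open>The substitution u = x + v / n turns the kernel of width 1 / n into a fixed
      Gaussian; the Jacobian cancels the factor \<open>n k\<close>.\<close>
    also have "\<dots> = \<bar>1 / n k\<bar> *\<^sub>R (LINT v|lborel. h (x + 1 / n k * v) *
        of_real (n k * sqrt (2 * pi) * exp (- (n k * (x + 1 / n k * v - x))\<^sup>2 / 2)))"
      by (rule lborel_integral_real_affine) (use n[of k] in simp)
    also have "\<dots> = (LINT v|lborel. of_real (sqrt (2 * pi)) * (h (x + v / n k) * of_real (exp (- v\<^sup>2 / 2))))"
      using n[of k] by (simp flip: integral_scaleR_right add: scaleR_conv_of_real mult_ac)
    finally show ?thesis by simp
  qed
  have "(\<lambda>k. LINT v|lborel. h (x + v / n k) * of_real (exp (- v\<^sup>2 / 2))) \<longlonglongrightarrow>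
      (LINT v|lborel. h x * of_real (exp (- v\<^sup>2 / 2)))"
  proof (rule integral_dominated_convergence[where w = "\<lambda>v. B * exp (- v\<^sup>2 / 2)"])
    show "integrable lborel (\<lambda>v. B * exp (- v\<^sup>2 / 2))"
      by (rule integrable_mult_right) (rule integrable_gaussian)
    show "AE v in lborel. (\<lambda>k. h (x + v / n k) * of_real (exp (- v\<^sup>2 / 2))) \<longlonglongrightarrow> h x * of_real (exp (- v\<^sup>2 / 2))"
    proof (rule AE_I2)
      fix v
      have "(\<lambda>k. x + v * (1 / n k)) \<longlonglongrightarrow> x + v * 0"
        by (intro tendsto_intros n_lim)
      then have "(\<lambda>k. h (x + v / n k)) \<longlonglongrightarrow> h x"
        using cont by (intro isCont_tendsto_compose[of x h]) (auto simp: continuous_on_eq_continuous_at)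
      then show "(\<lambda>k. h (x + v / n k) * of_real (exp (- v\<^sup>2 / 2))) \<longlonglongrightarrow> h x * of_real (exp (- v\<^sup>2 / 2))"
        by (intro tendsto_intros)
    qed
  qed (auto simp: norm_mult bnd intro!: AE_I2 mult_right_mono)
  then have "A \<longlonglongrightarrow> of_real (sqrt (2 * pi)) * (LINT v|lborel. h x * of_real (exp (- v\<^sup>2 / 2)))"
    unfolding A_eq[abs_def] by (intro tendsto_intros)
  also have "(LINT v|lborel. h x * of_real (exp (- v\<^sup>2 / 2))) = h x * of_real (sqrt (2 * pi))"
    using fourier_gaussian[of 0] by simp
  also have "of_real (sqrt (2 * pi)) * (h x * of_real (sqrt (2 * pi))) = 2 * pi * h x"
    by (simp add: field_simps power2_eq_square flip: of_real_mult)
  finally show "A \<longlonglongrightarrow> 2 * pi * h x" .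
qed

section \<open>The Mellin transform\<close>

text \<open>The change of variables theorem speaks of absolute integrability for the completed
  measure; Borel measurability of \<open>\<phi>\<close> allows the passage from
  \<open>lborel\<close> and back. Its equivalence is for "integrable with value \<open>b\<close>",
  and varying \<open>b\<close> yields both claims.\<close>

lemma exp_substitution:
  fixes \<phi> :: "real \<Rightarrow> complex"
  assumes [measurable]: "\<phi> \<in> borel_measurable borel"
  shows exp_substitution_integrable_iff:
      "integrable lborel (\<lambda>t. indicator {0<..} t *\<^sub>R \<phi> t) \<longleftrightarrow> integrable lborel (\<lambda>u. exp u *\<^sub>R \<phi> (exp u))"
    and exp_substitution_integral:
      "integrable lborel (\<lambda>u. exp u *\<^sub>R \<phi> (exp u)) \<Longrightarrow>
       (LINT t|lborel. indicator {0<..} t *\<^sub>R \<phi> t) = (LINT u|lborel. exp u *\<^sub>R \<phi> (exp u))"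
proof -
  have range: "range (exp :: real \<Rightarrow> real) = {0<..}"
    by (auto simp: image_iff intro: exI[of _ "ln _"] exp_ln[symmetric])
  have *: "(\<lambda>u. \<bar>exp u\<bar> *\<^sub>R \<phi> (exp u)) absolutely_integrable_on UNIV \<and>
      integral UNIV (\<lambda>u. \<bar>exp u\<bar> *\<^sub>R \<phi> (exp u)) = b \<longleftrightarrow>
      \<phi> absolutely_integrable_on {0<..} \<and> integral {0<..} \<phi> = b" for b
    unfolding range[symmetric]
    by (rule has_absolute_integral_change_of_variables_real)
       (auto intro!: DERIV_exp simp: inj_on_def)
  have 1: "(\<lambda>u. \<bar>exp u\<bar> *\<^sub>R \<phi> (exp u)) absolutely_integrable_on UNIV \<longleftrightarrow>
      integrable lborel (\<lambda>u. exp u *\<^sub>R \<phi> (exp u))"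
    by (simp add: set_integrable_def integrable_completion)
  have 2: "\<phi> absolutely_integrable_on {0<..} \<longleftrightarrow> integrable lborel (\<lambda>t. indicator {0<..} t *\<^sub>R \<phi> t)"
    by (simp add: set_integrable_def integrable_completion)
  show iff: "integrable lborel (\<lambda>t. indicator {0<..} t *\<^sub>R \<phi> t) \<longleftrightarrow> integrable lborel (\<lambda>u. exp u *\<^sub>R \<phi> (exp u))"
    using * 1 2 by metis
  assume int: "integrable lborel (\<lambda>u. exp u *\<^sub>R \<phi> (exp u))"
  then have "integral {0<..} \<phi> = integral UNIV (\<lambda>u. \<bar>exp u\<bar> *\<^sub>R \<phi> (exp u))"
    using * 1 by metis
  moreover have "integral {0<..} \<phi> = (LINT t|lborel. indicator {0<..} t *\<^sub>R \<phi> t)"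
    using set_lebesgue_integral_eq_integral(2)[of "{0<..}" \<phi>] int iff 2
    by (simp add: set_lebesgue_integral_def integral_completion)
  moreover have "integral UNIV (\<lambda>u. \<bar>exp u\<bar> *\<^sub>R \<phi> (exp u)) = (LINT u|lborel. exp u *\<^sub>R \<phi> (exp u))"
    using set_lebesgue_integral_eq_integral(2)[of "UNIV" "\<lambda>u. \<bar>exp u\<bar> *\<^sub>R \<phi> (exp u)"] int 1
    by (simp add: set_lebesgue_integral_def integral_completion)
  ultimately show "(LINT t|lborel. indicator {0<..} t *\<^sub>R \<phi> t) = (LINT u|lborel. exp u *\<^sub>R \<phi> (exp u))"
    by simp
qed

text \<open>Bounds are asked for only on closed substrips and at rates strictly below \<beta>, so
  constants may blow up at the edges. This makes the class stable, with unchanged \<beta>, under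
  factors of arbitrarily small exponential growth such as Gamma quotients.\<close>

definition mellin_class :: "ereal \<Rightarrow> real \<Rightarrow> (complex \<Rightarrow> complex) \<Rightarrow> bool" where
  "mellin_class b \<beta> \<Phi> \<longleftrightarrow> \<Phi> holomorphic_on vstrip b \<and>
     (\<forall>\<sigma>1 \<sigma>2 \<beta>'. 0 < \<sigma>1 \<longrightarrow> \<sigma>1 \<le> \<sigma>2 \<longrightarrow> ereal \<sigma>2 < b \<longrightarrow> 0 \<le> \<beta>' \<longrightarrow> \<beta>' < \<beta> \<longrightarrow>
        (\<exists>C. \<forall>\<xi>. \<sigma>1 \<le> Re \<xi> \<and> Re \<xi> \<le> \<sigma>2 \<longrightarrow> norm (\<Phi> \<xi>) \<le> C * exp (- \<beta>' * \<bar>Im \<xi>\<bar>)))"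

text \<open>The strip is the image of the sector \<open>\<bar>arg x\<bar> < \<beta>\<close> under \<open>ln\<close>.\<close>

definition sector_class :: "ereal \<Rightarrow> real \<Rightarrow> (complex \<Rightarrow> complex) \<Rightarrow> bool" where
  "sector_class b \<beta> F \<longleftrightarrow> F holomorphic_on {w. \<bar>Im w\<bar> < \<beta>} \<and>
     (\<forall>\<sigma> \<beta>'. 0 < \<sigma> \<longrightarrow> ereal \<sigma> < b \<longrightarrow> 0 \<le> \<beta>' \<longrightarrow> \<beta>' < \<beta> \<longrightarrow>
        (\<exists>C. \<forall>w. \<bar>Im w\<bar> \<le> \<beta>' \<longrightarrow> norm (F w) \<le> C * exp (- \<sigma> * Re w)))"

text \<open>For \<xi> = \<sigma> + i y one has d\<xi> = i dy, which cancels the i of 1 / (2 pi i),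
  and \<open>w\<close> stands for ln x. Correspondingly \<open>mellin\<close> is the integral of x
  powr (z - 1) * F (ln x) over x > 0, taken at x = exp u.\<close>

definition inv_mellin :: "real \<Rightarrow> (complex \<Rightarrow> complex) \<Rightarrow> complex \<Rightarrow> complex" where
  "inv_mellin \<sigma> \<Phi> w = (LINT y|lborel. \<Phi> (Complex \<sigma> y) * exp (- Complex \<sigma> y * w)) / (2 * pi)"

definition mellin :: "(complex \<Rightarrow> complex) \<Rightarrow> complex \<Rightarrow> complex" where
  "mellin F z = (LINT u|lborel. exp (z * of_real u) * F (of_real u))"

lemma vstrip_open: "open (vstrip b)"
proof (cases b)
  case (real r)
  have "vstrip b = {s. Re s > 0} \<inter> {s. Re s < r}" by (auto simp: vstrip_def real)
  then show ?thesis by (simp add: open_Int open_halfspace_Re_gt open_halfspace_Re_lt)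
next
  case PInf
  have "vstrip b = {s. Re s > 0}" by (auto simp: vstrip_def PInf)
  then show ?thesis by (simp add: open_halfspace_Re_gt)
qed (simp add: vstrip_def)

lemma open_horizontal_strip: "open {w. \<bar>Im w\<bar> < \<beta>}"
proof -
  have "{w. \<bar>Im w\<bar> < \<beta>} = {w. Im w > - \<beta>} \<inter> {w. Im w < \<beta>}" by auto
  then show ?thesis by (simp add: open_Int open_halfspace_Im_gt open_halfspace_Im_lt)
qed

lemma bound_constant_nonneg:
  fixes C :: real
  assumes "norm z \<le> C * exp x"
  shows "C \<ge> 0"
proof -
  have "0 \<le> C * exp x" using order_trans[OF norm_ge_zero assms] .
  then show ?thesis by (simp add: zero_le_mult_iff)
qed

lemma mellin_classD:
  assumes "mellin_class b \<beta> \<Phi>" "0 < \<sigma>1" "\<sigma>1 \<le> \<sigma>2" "ereal \<sigma>2 < b" "0 \<le> \<beta>'" "\<beta>' < \<beta>"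
  obtains C where "C \<ge> 0"
    "\<And>\<xi>. \<sigma>1 \<le> Re \<xi> \<Longrightarrow> Re \<xi> \<le> \<sigma>2 \<Longrightarrow> norm (\<Phi> \<xi>) \<le> C * exp (- \<beta>' * \<bar>Im \<xi>\<bar>)"
proof -
  obtain C where C: "\<And>\<xi>. \<sigma>1 \<le> Re \<xi> \<Longrightarrow> Re \<xi> \<le> \<sigma>2 \<Longrightarrow> norm (\<Phi> \<xi>) \<le> C * exp (- \<beta>' * \<bar>Im \<xi>\<bar>)"
    using assms unfolding mellin_class_def by metis
  moreover have "C \<ge> 0" using bound_constant_nonneg[OF C[of "of_real \<sigma>1"]] assms(3) by simp
  ultimately show ?thesis using that by blast
qed

lemma sector_classD:
  assumes "sector_class b \<beta> F" "0 < \<sigma>" "ereal \<sigma> < b" "0 \<le> \<beta>'" "\<beta>' < \<beta>"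
  obtains C where "C \<ge> 0" "\<And>w. \<bar>Im w\<bar> \<le> \<beta>' \<Longrightarrow> norm (F w) \<le> C * exp (- \<sigma> * Re w)"
proof -
  obtain C where C: "\<And>w. \<bar>Im w\<bar> \<le> \<beta>' \<Longrightarrow> norm (F w) \<le> C * exp (- \<sigma> * Re w)"
    using assms unfolding sector_class_def by metis
  moreover have "C \<ge> 0" using bound_constant_nonneg[OF C[of 0]] assms(4) by simp
  ultimately show ?thesis using that by blast
qed

text \<open>Turning \<open>w\<close> off the real axis by at most \<open>\<beta>'\<close> costs at
  most that much of the decay rate \<open>\<beta>''\<close>.\<close>

lemma norm_mult_exp_le:
  assumes "norm (\<Phi> \<xi>) \<le> C * exp (- \<beta>'' * \<bar>Im \<xi>\<bar>)" "\<bar>Im w\<bar> \<le> \<beta>'"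
  shows "norm (\<Phi> \<xi> * exp (- \<xi> * w)) \<le> C * exp (- (\<beta>'' - \<beta>') * \<bar>Im \<xi>\<bar>) * exp (- Re \<xi> * Re w)"
proof -
  have C: "C \<ge> 0" using assms(1) by (rule bound_constant_nonneg)
  have "Im \<xi> * Im w \<le> \<beta>' * \<bar>Im \<xi>\<bar>"
  proof -
    have "Im \<xi> * Im w \<le> \<bar>Im \<xi>\<bar> * \<bar>Im w\<bar>" by (metis abs_ge_self abs_mult)
    also have "\<dots> \<le> \<bar>Im \<xi>\<bar> * \<beta>'" by (intro mult_left_mono assms) auto
    finally show ?thesis by (simp add: mult.commute)
  qed
  then have "exp (- (Re \<xi> * Re w) + Im \<xi> * Im w) \<le> exp (- (Re \<xi> * Re w) + \<beta>' * \<bar>Im \<xi>\<bar>)" by simp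
  then have "norm (\<Phi> \<xi>) * norm (exp (- \<xi> * w)) \<le>
      C * exp (- \<beta>'' * \<bar>Im \<xi>\<bar>) * exp (- (Re \<xi> * Re w) + \<beta>' * \<bar>Im \<xi>\<bar>)"
    using C assms(1) by (intro mult_mono) (auto simp: norm_exp_eq_Re)
  also have "\<dots> = C * exp (- (\<beta>'' - \<beta>') * \<bar>Im \<xi>\<bar>) * exp (- Re \<xi> * Re w)"
    by (simp add: exp_add[symmetric] algebra_simps)
  finally show ?thesis by (simp add: norm_mult)
qed

text \<open>Multiplication by i carries the line Im v = - \<sigma> to Re \<xi> = \<sigma>, so both
  claims are instances of \<open>horizontal_integral\<close>.\<close>

lemma inv_mellin_line:
  assumes \<Phi>: "mellin_class b \<beta> \<Phi>" and w: "\<bar>Im w\<bar> < \<beta>"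
    and \<sigma>: "0 < \<sigma>" "ereal \<sigma> < b"
  shows inv_mellin_integrable: "integrable lborel (\<lambda>y. \<Phi> (Complex \<sigma> y) * exp (- Complex \<sigma> y * w))"
    and inv_mellin_indep: "0 < \<sigma>' \<Longrightarrow> ereal \<sigma>' < b \<Longrightarrow> inv_mellin \<sigma> \<Phi> w = inv_mellin \<sigma>' \<Phi> w"
proof -
  define \<Psi> where "\<Psi> = (\<lambda>v. \<Phi> (\<i> * v) * exp (- (\<i> * v) * w))"
  have line: "\<Psi> (Complex y (- s)) = \<Phi> (Complex s y) * exp (- Complex s y * w)" for s y
  proof -
    have "\<i> * Complex y (- s) = Complex s y" by (simp add: complex_eq_iff)
    then show ?thesis by (simp add: \<Psi>_def)
  qed
  have hol: "\<Psi> holomorphic_on {v. - b' < Im v \<and> Im v < 0}" if "ereal b' < b" for b'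
  proof -
    have "(\<Phi> \<circ> (\<lambda>v. \<i> * v)) holomorphic_on {v. - b' < Im v \<and> Im v < 0}"
    proof (rule holomorphic_on_compose_gen[where t = "vstrip b"])
      have "ereal (- Im v) < b" if "- b' < Im v" for v
        using that \<open>ereal b' < b\<close> less_trans[of "ereal (- Im v)" "ereal b'" b] by simp
      then show "(\<lambda>v. \<i> * v) ` {v. - b' < Im v \<and> Im v < 0} \<subseteq> vstrip b"
        by (auto simp: vstrip_def)
    qed (use \<Phi> in \<open>auto simp: mellin_class_def intro!: holomorphic_intros\<close>)
    then show ?thesis unfolding \<Psi>_def o_def by (intro holomorphic_intros)
  qed
  have dec: "\<exists>C \<kappa>. \<kappa> > 0 \<and> (\<forall>v. c' \<le> Im v \<and> Im v \<le> d' \<longrightarrow> norm (\<Psi> v) \<le> C * exp (- \<kappa> * \<bar>Re v\<bar>))"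
    if b': "ereal b' < b" and c': "- b' < c'" "c' \<le> d'" "d' < 0" for b' c' d'
  proof -
    \<comment> \<open>Midway between |Im w| and \<beta>: \<open>\<Phi>\<close> still decays at this
      rate, and after the loss of |Im w| a positive rate remains.\<close>
    define \<beta>'' where "\<beta>'' = (\<bar>Im w\<bar> + \<beta>) / 2"
    have \<beta>'': "\<bar>Im w\<bar> < \<beta>''" "\<beta>'' < \<beta>" "0 \<le> \<beta>''" using w by (auto simp: \<beta>''_def)
    have "ereal (- c') < b" using c' b' less_trans[of "ereal (- c')" "ereal b'" b] by simp
    then obtain C where C0: "C \<ge> 0"
      and C: "\<And>\<xi>. - d' \<le> Re \<xi> \<Longrightarrow> Re \<xi> \<le> - c' \<Longrightarrow> norm (\<Phi> \<xi>) \<le> C * exp (- \<beta>'' * \<bar>Im \<xi>\<bar>)"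
      using mellin_classD[OF \<Phi>, of "- d'" "- c'" \<beta>''] c' \<beta>'' by auto
    have "norm (\<Psi> v) \<le> (C * exp (- c' * \<bar>Re w\<bar>)) * exp (- (\<beta>'' - \<bar>Im w\<bar>) * \<bar>Re v\<bar>)"
      if "c' \<le> Im v \<and> Im v \<le> d'" for v
    proof -
      have "norm (\<Psi> v) \<le> C * exp (- (\<beta>'' - \<bar>Im w\<bar>) * \<bar>Im (\<i> * v)\<bar>) * exp (- Re (\<i> * v) * Re w)"
        unfolding \<Psi>_def using that by (intro norm_mult_exp_le C) auto
      also have "- Re (\<i> * v) * Re w \<le> - c' * \<bar>Re w\<bar>"
      proof -
        have "- Re (\<i> * v) * Re w \<le> \<bar>Im v\<bar> * \<bar>Re w\<bar>" by (simp add: abs_mult[symmetric])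
        also have "\<dots> \<le> - c' * \<bar>Re w\<bar>" using that c' by (intro mult_right_mono) auto
        finally show ?thesis .
      qed
      finally show ?thesis using C0 by (simp add: mult_ac mult_left_mono)
    qed
    then show ?thesis using \<beta>'' by (intro exI[of _ "\<beta>'' - \<bar>Im w\<bar>"] exI) auto
  qed
  \<comment> \<open>\<open>b\<close> may be infinite, while the horizontal strip has real ends; any
    real number between the abscissa and \<open>b\<close> serves.\<close>
  obtain b' where b': "\<sigma> < b'" "ereal b' < b" using \<sigma> ereal_dense2[of "ereal \<sigma>" b] by auto
  show "integrable lborel (\<lambda>y. \<Phi> (Complex \<sigma> y) * exp (- Complex \<sigma> y * w))"
    using horizontal_integrable[OF hol[OF b'(2)] dec[OF b'(2)], of "- \<sigma>"] b' \<sigma>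
    by (simp only: line neg_less_iff_less neg_less_0_iff_less)
  assume \<sigma>': "0 < \<sigma>'" "ereal \<sigma>' < b"
  have "ereal (max \<sigma> \<sigma>') < b" using \<sigma> \<sigma>' by (simp add: max_def)
  then obtain b' where b': "max \<sigma> \<sigma>' < b'" "ereal b' < b"
    using ereal_dense2[of "ereal (max \<sigma> \<sigma>')" b] by auto
  show "inv_mellin \<sigma> \<Phi> w = inv_mellin \<sigma>' \<Phi> w"
    using horizontal_integral_shift[OF hol[OF b'(2)] dec[OF b'(2)], of "- \<sigma>" "- \<sigma>'"] b' \<sigma> \<sigma>'
    unfolding inv_mellin_def line by auto
qed

lemma vertical_line_in_vstrip: "0 < \<sigma> \<Longrightarrow> ereal \<sigma> < b \<Longrightarrow> Complex \<sigma> y \<in> vstrip b"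
  by (simp add: vstrip_def)

lemma mellin_class_line_measurable:
  assumes \<Phi>: "mellin_class b \<beta> \<Phi>" and \<sigma>: "0 < \<sigma>" "ereal \<sigma> < b"
  shows "(\<lambda>y. \<Phi> (Complex \<sigma> y)) \<in> borel_measurable borel"
proof (rule borel_measurable_continuous_onI)
  have "continuous_on (vstrip b) \<Phi>"
    using \<Phi> by (auto simp: mellin_class_def intro: holomorphic_on_imp_continuous_on)
  then show "continuous_on UNIV (\<lambda>y. \<Phi> (Complex \<sigma> y))"
    by (rule continuous_on_compose2)
       (use \<sigma> in \<open>auto simp: vertical_line_in_vstrip Complex_eq intro!: continuous_intros\<close>,
        simp add: vstrip_def)
qed

lemma Complex_measurable [measurable]: "Complex \<sigma> \<in> borel_measurable borel"
  unfolding Complex_eq by (intro borel_measurable_continuous_onI continuous_intros)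

text \<open>Convergence is absolute while |Im w| stays below the decay rate. The bound with exponent
  \<open>\<sigma>\<close> is evident on the line of abscissa \<open>\<sigma>\<close>, and shifting
  the line makes it available for all exponents.\<close>

lemma sector_class_inv_mellin:
  assumes \<Phi>: "mellin_class b \<beta> \<Phi>" and \<sigma>0: "0 < \<sigma>0" "ereal \<sigma>0 < b"
  shows "sector_class b \<beta> (inv_mellin \<sigma>0 \<Phi>)"
proof -
  have dom: "\<exists>C\<ge>0. \<exists>\<kappa>>0. \<forall>w y. \<bar>Im w\<bar> \<le> \<beta>' \<longrightarrow>
      norm (\<Phi> (Complex \<sigma> y) * exp (- Complex \<sigma> y * w)) \<le> C * exp (- \<kappa> * \<bar>y\<bar>) * exp (- \<sigma> * Re w)"
    if \<sigma>: "0 < \<sigma>" "ereal \<sigma> < b" and \<beta>': "0 \<le> \<beta>'" "\<beta>' < \<beta>" for \<sigma> \<beta>'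
  proof -
    define \<beta>'' where "\<beta>'' = (\<beta>' + \<beta>) / 2"
    have \<beta>'': "\<beta>' < \<beta>''" "\<beta>'' < \<beta>" "0 \<le> \<beta>''" using \<beta>' by (auto simp: \<beta>''_def)
    obtain C where C0: "C \<ge> 0"
      and C: "\<And>\<xi>. \<sigma> \<le> Re \<xi> \<Longrightarrow> Re \<xi> \<le> \<sigma> \<Longrightarrow> norm (\<Phi> \<xi>) \<le> C * exp (- \<beta>'' * \<bar>Im \<xi>\<bar>)"
      using mellin_classD[OF \<Phi>, of \<sigma> \<sigma> \<beta>''] \<sigma> \<beta>'' by auto
    have "norm (\<Phi> (Complex \<sigma> y) * exp (- Complex \<sigma> y * w)) \<le>
        C * exp (- (\<beta>'' - \<beta>') * \<bar>y\<bar>) * exp (- \<sigma> * Re w)" if "\<bar>Im w\<bar> \<le> \<beta>'" for w y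
      using norm_mult_exp_le[where \<Phi> = \<Phi> and \<xi> = "Complex \<sigma> y", OF C that] by simp
    then show ?thesis using C0 \<beta>'' by (intro exI[of _ C] conjI exI[of _ "\<beta>'' - \<beta>'"]) auto
  qed
  show ?thesis
    unfolding sector_class_def
  proof (intro conjI allI impI)
    have "(\<lambda>w. LINT y|lborel. \<Phi> (Complex \<sigma>0 y) * exp (- Complex \<sigma>0 y * w)) holomorphic_on {w. \<bar>Im w\<bar> < \<beta>}"
    proof (rule holomorphic_on_lebesgue_integral[OF open_horizontal_strip])
      show "(\<lambda>y. \<Phi> (Complex \<sigma>0 y) * exp (- Complex \<sigma>0 y * w)) \<in> borel_measurable lborel" for w
        using mellin_class_line_measurable[OF \<Phi> \<sigma>0] by measurable
      show "(\<lambda>w. \<Phi> (Complex \<sigma>0 y) * exp (- Complex \<sigma>0 y * w)) holomorphic_on {w. \<bar>Im w\<bar> < \<beta>}" for y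
        by (intro holomorphic_intros)
      fix w0 assume w0: "w0 \<in> {w. \<bar>Im w\<bar> < \<beta>}"
      define e where "e = (\<beta> - \<bar>Im w0\<bar>) / 2"
      have e: "e > 0" "\<bar>Im w0\<bar> + e < \<beta>" using w0 by (auto simp: e_def field_simps)
      obtain C \<kappa> where C: "C \<ge> 0" "\<kappa> > 0" and bd: "\<And>w y. \<bar>Im w\<bar> \<le> \<bar>Im w0\<bar> + e \<Longrightarrow>
          norm (\<Phi> (Complex \<sigma>0 y) * exp (- Complex \<sigma>0 y * w)) \<le> C * exp (- \<kappa> * \<bar>y\<bar>) * exp (- \<sigma>0 * Re w)"
        using dom[OF \<sigma>0, of "\<bar>Im w0\<bar> + e"] e by auto
      define g where "g = (\<lambda>y. C * exp (\<sigma>0 * (\<bar>Re w0\<bar> + e)) * exp (- \<kappa> * \<bar>y\<bar>))"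
      have "integrable lborel g"
        unfolding g_def by (rule integrable_mult_right) (rule integrable_exp_minus_abs[OF C(2)])
      moreover have "norm (\<Phi> (Complex \<sigma>0 y) * exp (- Complex \<sigma>0 y * w)) \<le> g y" if "dist w0 w < e" for w y
      proof -
        have d: "\<bar>Im w - Im w0\<bar> < e" "\<bar>Re w - Re w0\<bar> < e"
          using that abs_Im_le_cmod[of "w - w0"] abs_Re_le_cmod[of "w - w0"]
          by (auto simp: dist_norm norm_minus_commute)
        have "norm (\<Phi> (Complex \<sigma>0 y) * exp (- Complex \<sigma>0 y * w)) \<le> C * exp (- \<kappa> * \<bar>y\<bar>) * exp (- \<sigma>0 * Re w)"
          using d by (intro bd) auto
        also have "\<dots> \<le> C * exp (- \<kappa> * \<bar>y\<bar>) * exp (\<sigma>0 * (\<bar>Re w0\<bar> + e))"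
        proof -
          have "- \<sigma>0 * Re w \<le> \<sigma>0 * (\<bar>Re w0\<bar> + e)"
            using mult_left_mono[of "- Re w" "\<bar>Re w0\<bar> + e" \<sigma>0] d \<sigma>0 by auto
          then show ?thesis using C by (intro mult_left_mono) auto
        qed
        finally show ?thesis by (simp add: g_def mult_ac)
      qed
      ultimately show "\<exists>e>0. \<exists>g. integrable lborel g \<and> (\<forall>w\<in>{w. \<bar>Im w\<bar> < \<beta>}. dist w0 w < e \<longrightarrow>
          (\<forall>y\<in>space lborel. norm (\<Phi> (Complex \<sigma>0 y) * exp (- Complex \<sigma>0 y * w)) \<le> g y))"
        using e by blast
    qed
    then show "inv_mellin \<sigma>0 \<Phi> holomorphic_on {w. \<bar>Im w\<bar> < \<beta>}"
      unfolding inv_mellin_def[abs_def] by (intro holomorphic_intros) auto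
  next
    fix \<sigma> \<beta>' assume \<sigma>: "0 < \<sigma>" "ereal \<sigma> < b" and \<beta>': "0 \<le> \<beta>'" "\<beta>' < \<beta>"
    obtain C \<kappa> where C: "C \<ge> 0" "\<kappa> > 0" and bd: "\<And>w y. \<bar>Im w\<bar> \<le> \<beta>' \<Longrightarrow>
        norm (\<Phi> (Complex \<sigma> y) * exp (- Complex \<sigma> y * w)) \<le> C * exp (- \<kappa> * \<bar>y\<bar>) * exp (- \<sigma> * Re w)"
      using dom[OF \<sigma> \<beta>'] by blast
    define I where "I = (LINT y|lborel. exp (- \<kappa> * \<bar>y\<bar>))"
    have "norm (inv_mellin \<sigma>0 \<Phi> w) \<le> (C * I / (2 * pi)) * exp (- \<sigma> * Re w)" if w: "\<bar>Im w\<bar> \<le> \<beta>'" for w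
    proof -
      have "inv_mellin \<sigma>0 \<Phi> w = inv_mellin \<sigma> \<Phi> w"
        using w \<beta>' \<sigma> by (intro inv_mellin_indep[OF \<Phi> _ \<sigma>0]) auto
      moreover have "norm (LINT y|lborel. \<Phi> (Complex \<sigma> y) * exp (- Complex \<sigma> y * w)) \<le>
          (LINT y|lborel. C * exp (- \<kappa> * \<bar>y\<bar>) * exp (- \<sigma> * Re w))"
        by (rule Bochner_Integration.integral_norm_bound_integral)
           (use inv_mellin_integrable[OF \<Phi> _ \<sigma>, of w] w \<beta>' bd[OF w] integrable_exp_minus_abs[OF C(2)] in auto)
      ultimately show ?thesis
        by (simp add: inv_mellin_def norm_divide I_def divide_right_mono)
    qed
    then show "\<exists>C. \<forall>w. \<bar>Im w\<bar> \<le> \<beta>' \<longrightarrow> norm (inv_mellin \<sigma>0 \<Phi> w) \<le> C * exp (- \<sigma> * Re w)"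
      by blast
  qed
qed

text \<open>Two decay exponents of \<open>F\<close> are combined: \<open>a1 / 2\<close> where Re w <
  0 and \<open>a2 + a1 / 2\<close> where Re w >= 0. They lie below, respectively above, every Re z
  by at least \<open>a1 / 2\<close>, which becomes the two-sided rate.\<close>

lemma sector_class_exp_bound:
  assumes F: "sector_class \<infinity> \<beta> F" and a: "0 < a1" "a1 \<le> a2" and \<beta>': "0 \<le> \<beta>'" "\<beta>' < \<beta>"
  obtains C where "C \<ge> 0" "\<And>z w. a1 \<le> Re z \<Longrightarrow> Re z \<le> a2 \<Longrightarrow> \<bar>Im w\<bar> \<le> \<beta>' \<Longrightarrow>
    norm (exp (z * w) * F w) \<le> C * exp (- Im z * Im w) * exp (- (a1 / 2) * \<bar>Re w\<bar>)"
proof -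
  obtain C1 where C1: "C1 \<ge> 0" "\<And>w. \<bar>Im w\<bar> \<le> \<beta>' \<Longrightarrow> norm (F w) \<le> C1 * exp (- (a1 / 2) * Re w)"
    using sector_classD[OF F, of "a1/2" \<beta>'] a \<beta>' by auto
  obtain C2 where C2: "C2 \<ge> 0" "\<And>w. \<bar>Im w\<bar> \<le> \<beta>' \<Longrightarrow> norm (F w) \<le> C2 * exp (- (a2 + a1 / 2) * Re w)"
    using sector_classD[OF F, of "a2 + a1/2" \<beta>'] a \<beta>' by auto
  have "norm (exp (z * w) * F w) \<le> max C1 C2 * exp (- Im z * Im w) * exp (- (a1 / 2) * \<bar>Re w\<bar>)"
    if z: "a1 \<le> Re z" "Re z \<le> a2" and w: "\<bar>Im w\<bar> \<le> \<beta>'" for z w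
  proof -
    have "exp (Re z * Re w) * norm (F w) \<le> max C1 C2 * exp (- (a1 / 2) * \<bar>Re w\<bar>)"
    proof (cases "Re w \<ge> 0")
      case True
      have "Re z * Re w \<le> a2 * Re w" using True z by (intro mult_right_mono)
      then have "exp (Re z * Re w) * norm (F w) \<le> exp (a2 * Re w) * (max C1 C2 * exp (- (a2 + a1 / 2) * Re w))"
        using C2 w by (intro mult_mono order_trans[OF C2(2)[OF w]] mult_right_mono) auto
      also have "\<dots> = max C1 C2 * exp (- (a1 / 2) * \<bar>Re w\<bar>)"
        using True by (simp add: exp_add[symmetric] algebra_simps)
      finally show ?thesis .
    next
      case False
      have "Re z * Re w \<le> a1 * Re w" using False z by (intro mult_right_mono_neg) auto
      then have "exp (Re z * Re w) * norm (F w) \<le> exp (a1 * Re w) * (max C1 C2 * exp (- (a1 / 2) * Re w))"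
        using C1 w by (intro mult_mono order_trans[OF C1(2)[OF w]] mult_right_mono) auto
      also have "\<dots> = max C1 C2 * exp (- (a1 / 2) * \<bar>Re w\<bar>)"
        using False by (simp add: exp_add[symmetric] algebra_simps)
      finally show ?thesis .
    qed
    then have "exp (- Im z * Im w) * (exp (Re z * Re w) * norm (F w)) \<le>
        exp (- Im z * Im w) * (max C1 C2 * exp (- (a1 / 2) * \<bar>Re w\<bar>))"
      by (intro mult_left_mono) auto
    then show ?thesis
      by (simp add: norm_mult norm_exp_eq_Re exp_diff exp_minus field_simps)
  qed
  then show ?thesis using that[of "max C1 C2"] C1(1) by (auto simp: max_def)
qed

lemma sector_class_line_measurable:
  assumes F: "sector_class b \<beta> F" and \<beta>: "\<bar>\<theta>\<bar> < \<beta>"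
  shows "(\<lambda>u. F (Complex u \<theta>)) \<in> borel_measurable borel" "continuous_on UNIV (\<lambda>u. F (Complex u \<theta>))"
proof -
  have "continuous_on {w. \<bar>Im w\<bar> < \<beta>} F"
    using F by (auto simp: sector_class_def intro: holomorphic_on_imp_continuous_on)
  then show "continuous_on UNIV (\<lambda>u. F (Complex u \<theta>))"
    by (rule continuous_on_compose2) (use \<beta> in \<open>auto simp: Complex_eq intro!: continuous_intros\<close>)
  then show "(\<lambda>u. F (Complex u \<theta>)) \<in> borel_measurable borel"
    by (rule borel_measurable_continuous_onI)
qed

lemma mellin_integrable:
  assumes F: "sector_class \<infinity> \<beta> F" and \<beta>: "\<beta> > 0" and z: "Re z > 0"
  shows "integrable lborel (\<lambda>u. exp (z * of_real u) * F (of_real u))"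
proof -
  obtain C where C: "C \<ge> 0" and bd: "\<And>z' w. Re z \<le> Re z' \<Longrightarrow> Re z' \<le> Re z \<Longrightarrow> \<bar>Im w\<bar> \<le> 0 \<Longrightarrow>
    norm (exp (z' * w) * F w) \<le> C * exp (- Im z' * Im w) * exp (- (Re z / 2) * \<bar>Re w\<bar>)"
    using sector_class_exp_bound[OF F z order_refl order_refl \<beta>] by blast
  have m: "(\<lambda>u. F (of_real u)) \<in> borel_measurable borel"
    using sector_class_line_measurable(1)[OF F, of 0] \<beta> by (simp add: complex_of_real_def)
  have i: "integrable lborel (\<lambda>u. C * exp (- (Re z / 2) * \<bar>u\<bar>))"
    by (rule integrable_mult_right) (rule integrable_exp_minus_abs, use z in simp)
  show ?thesis
    by (rule Bochner_Integration.integrable_bound[OF i])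
       (use m C bd[of z "of_real _"] in \<open>auto intro!: AE_I2\<close>)
qed

text \<open>The decay comes from moving the line of integration to height \<beta>' or - \<beta>',
  according to the sign of Im z: there exp (z * w) contributes the factor exp (- \<beta>' |Im z|).
  Thus the half-angle of the sector becomes the decay rate.\<close>

lemma mellin_class_mellin:
  assumes F: "sector_class \<infinity> \<beta> F" and \<beta>: "\<beta> > 0"
  shows "mellin_class \<infinity> \<beta> (mellin F)"
  unfolding mellin_class_def
proof (intro conjI allI impI)
  have V: "vstrip \<infinity> = {z. Re z > 0}" by (auto simp: vstrip_def)
  have m: "(\<lambda>u. F (of_real u)) \<in> borel_measurable borel"
    using sector_class_line_measurable(1)[OF F, of 0] \<beta> by (simp add: complex_of_real_def)
  show "mellin F holomorphic_on vstrip \<infinity>"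
    unfolding mellin_def[abs_def]
  proof (rule holomorphic_on_lebesgue_integral[OF vstrip_open])
    show "(\<lambda>u. exp (z * of_real u) * F (of_real u)) \<in> borel_measurable lborel" for z
      using m by measurable
    show "(\<lambda>z. exp (z * of_real u) * F (of_real u)) holomorphic_on vstrip \<infinity>" for u
      by (intro holomorphic_intros)
    fix z0 assume "z0 \<in> vstrip \<infinity>"
    then have z0: "Re z0 > 0" by (simp add: V)
    obtain C where C: "C \<ge> 0" and bd: "\<And>z w. Re z0 / 2 \<le> Re z \<Longrightarrow> Re z \<le> 2 * Re z0 \<Longrightarrow> \<bar>Im w\<bar> \<le> 0 \<Longrightarrow>
      norm (exp (z * w) * F w) \<le> C * exp (- Im z * Im w) * exp (- (Re z0 / 2 / 2) * \<bar>Re w\<bar>)"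
      using sector_class_exp_bound[OF F _ _ order_refl \<beta>, of "Re z0 / 2" "2 * Re z0"] z0 by auto
    define g where "g = (\<lambda>u. C * exp (- (Re z0 / 2 / 2) * \<bar>u\<bar>))"
    have "integrable lborel g"
      unfolding g_def by (rule integrable_mult_right) (rule integrable_exp_minus_abs, use z0 in simp)
    moreover have "norm (exp (z * of_real u) * F (of_real u)) \<le> g u" if "dist z0 z < Re z0 / 2" for z u
    proof -
      have "\<bar>Re z - Re z0\<bar> < Re z0 / 2"
        using that abs_Re_le_cmod[of "z - z0"] by (auto simp: dist_norm norm_minus_commute)
      then have "Re z0 / 2 \<le> Re z" "Re z \<le> 2 * Re z0" by linarith+
      then show ?thesis using bd[of z "of_real u"] by (simp add: g_def)
    qed
    ultimately show "\<exists>e>0. \<exists>g. integrable lborel g \<and> (\<forall>z\<in>vstrip \<infinity>. dist z0 z < e \<longrightarrow>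
        (\<forall>u\<in>space lborel. norm (exp (z * of_real u) * F (of_real u)) \<le> g u))"
      using z0 by (intro exI[of _ "Re z0 / 2"]) auto
  qed
  fix \<sigma>1 \<sigma>2 \<beta>' :: real
  assume \<sigma>: "0 < \<sigma>1" "\<sigma>1 \<le> \<sigma>2" and \<beta>': "0 \<le> \<beta>'" "\<beta>' < \<beta>"
  obtain C where C: "C \<ge> 0" and bd: "\<And>z w. \<sigma>1 \<le> Re z \<Longrightarrow> Re z \<le> \<sigma>2 \<Longrightarrow> \<bar>Im w\<bar> \<le> \<beta>' \<Longrightarrow>
    norm (exp (z * w) * F w) \<le> C * exp (- Im z * Im w) * exp (- (\<sigma>1 / 2) * \<bar>Re w\<bar>)"
    using sector_class_exp_bound[OF F \<sigma> \<beta>'] by blast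
  define I where "I = (LINT u|lborel. exp (- (\<sigma>1 / 2) * \<bar>u\<bar>))"
  have "norm (mellin F z) \<le> C * I * exp (- \<beta>' * \<bar>Im z\<bar>)" if z: "\<sigma>1 \<le> Re z" "Re z \<le> \<sigma>2" for z
  proof -
    define \<Psi> where "\<Psi> = (\<lambda>w. exp (z * w) * F w)"
    define \<theta> where "\<theta> = (if Im z \<ge> 0 then \<beta>' else - \<beta>')"
    have \<theta>: "\<bar>\<theta>\<bar> \<le> \<beta>'" "Im z * \<theta> = \<beta>' * \<bar>Im z\<bar>" using \<beta>' by (auto simp: \<theta>_def)
    have hol: "\<Psi> holomorphic_on {w. - \<beta> < Im w \<and> Im w < \<beta>}"
    proof -
      have "F holomorphic_on {w. - \<beta> < Im w \<and> Im w < \<beta>}"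
        using F by (auto simp: sector_class_def abs_less_iff intro: holomorphic_on_subset)
      then show ?thesis unfolding \<Psi>_def by (intro holomorphic_intros)
    qed
    have dec: "\<exists>C \<kappa>. \<kappa> > 0 \<and> (\<forall>w. c' \<le> Im w \<and> Im w \<le> d' \<longrightarrow> norm (\<Psi> w) \<le> C * exp (- \<kappa> * \<bar>Re w\<bar>))"
      if cd: "- \<beta> < c'" "c' \<le> d'" "d' < \<beta>" for c' d'
    proof -
      define B where "B = max \<bar>c'\<bar> \<bar>d'\<bar>"
      have B: "0 \<le> B" "B < \<beta>" using cd by (auto simp: B_def)
      obtain C where C: "C \<ge> 0" and bd: "\<And>z w. \<sigma>1 \<le> Re z \<Longrightarrow> Re z \<le> \<sigma>2 \<Longrightarrow> \<bar>Im w\<bar> \<le> B \<Longrightarrow>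
        norm (exp (z * w) * F w) \<le> C * exp (- Im z * Im w) * exp (- (\<sigma>1 / 2) * \<bar>Re w\<bar>)"
        using sector_class_exp_bound[OF F \<sigma> B] by blast
      have "norm (\<Psi> w) \<le> (C * exp (\<bar>Im z\<bar> * B)) * exp (- (\<sigma>1 / 2) * \<bar>Re w\<bar>)" if "c' \<le> Im w \<and> Im w \<le> d'" for w
      proof -
        have w: "\<bar>Im w\<bar> \<le> B" using that by (auto simp: B_def)
        have "- Im z * Im w \<le> \<bar>Im z\<bar> * \<bar>Im w\<bar>" by (metis abs_ge_self abs_mult abs_minus_cancel)
        also have "\<dots> \<le> \<bar>Im z\<bar> * B" using w by (intro mult_left_mono) auto
        finally have "C * exp (- Im z * Im w) \<le> C * exp (\<bar>Im z\<bar> * B)" using C by (intro mult_left_mono) auto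
        then show ?thesis unfolding \<Psi>_def
          by (intro order_trans[OF bd[OF z w]] mult_right_mono) auto
      qed
      then show ?thesis using \<sigma> by (intro exI[of _ "\<sigma>1 / 2"] exI) auto
    qed
    have "mellin F z = (LINT u|lborel. \<Psi> (Complex u 0))"
      by (simp add: mellin_def \<Psi>_def complex_of_real_def)
    also have "\<dots> = (LINT u|lborel. \<Psi> (Complex u \<theta>))"
      by (rule horizontal_integral_shift[OF hol dec]) (use \<beta> \<beta>' \<theta> in auto)
    finally have "norm (mellin F z) = norm (LINT u|lborel. \<Psi> (Complex u \<theta>))" by simp
    also have "\<dots> \<le> (LINT u|lborel. C * exp (- \<beta>' * \<bar>Im z\<bar>) * exp (- (\<sigma>1 / 2) * \<bar>u\<bar>))"
    proof (rule Bochner_Integration.integral_norm_bound_integral)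
      show "integrable lborel (\<lambda>u. \<Psi> (Complex u \<theta>))"
        by (rule horizontal_integrable[OF hol dec]) (use \<beta> \<beta>' \<theta> in auto)
      show "integrable lborel (\<lambda>u. C * exp (- \<beta>' * \<bar>Im z\<bar>) * exp (- (\<sigma>1 / 2) * \<bar>u\<bar>))"
        by (rule integrable_mult_right) (rule integrable_exp_minus_abs, use \<sigma> in simp)
      show "norm (\<Psi> (Complex u \<theta>)) \<le> C * exp (- \<beta>' * \<bar>Im z\<bar>) * exp (- (\<sigma>1 / 2) * \<bar>u\<bar>)" for u
        using bd[OF z, of "Complex u \<theta>"] \<theta> by (simp add: \<Psi>_def)
    qed
    also have "\<dots> = C * I * exp (- \<beta>' * \<bar>Im z\<bar>)" by (simp add: I_def)
    finally show ?thesis .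
  qed
  then show "\<exists>C. \<forall>\<xi>. \<sigma>1 \<le> Re \<xi> \<and> Re \<xi> \<le> \<sigma>2 \<longrightarrow> norm (mellin F \<xi>) \<le> C * exp (- \<beta>' * \<bar>Im \<xi>\<bar>)"
    by blast
qed

text \<open>Fourier inversion for exp (\<sigma> u) * F u, whose transform is \<open>mellin F\<close>
  on the line Re \<xi> = \<sigma>. The bound of \<open>F\<close> with the same exponent
  \<open>\<sigma>\<close> makes this function bounded, and the decay of \<open>mellin F\<close>
  makes its transform integrable.\<close>

lemma inv_mellin_mellin:
  assumes F: "sector_class \<infinity> \<beta> F" and \<beta>: "\<beta> > 0" and \<sigma>: "\<sigma> > 0"
  shows "inv_mellin \<sigma> (mellin F) (of_real x) = F (of_real x)"
proof -
  define h where "h = (\<lambda>u. exp (of_real (\<sigma> * u)) * F (of_real u))"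
  have split: "exp (Complex \<sigma> y * of_real u) = iexp (y * u) * exp (of_real (\<sigma> * u))" for y u
    by (simp add: Complex_eq exp_add[symmetric] algebra_simps)
  have hat: "(LINT u|lborel. iexp (y * u) * h u) = mellin F (Complex \<sigma> y)" for y
    unfolding mellin_def h_def
    by (intro Bochner_Integration.integral_cong refl) (simp add: split mult.assoc)
  have cont: "continuous_on UNIV h"
    using sector_class_line_measurable(2)[OF F, of 0] \<beta>
    unfolding h_def by (auto simp: complex_of_real_def[symmetric] intro!: continuous_intros)
  obtain B where B: "\<And>w. \<bar>Im w\<bar> \<le> 0 \<Longrightarrow> norm (F w) \<le> B * exp (- \<sigma> * Re w)"
    using sector_classD[OF F \<sigma>, of 0] \<beta> by auto
  have bnd: "norm (h u) \<le> B" for u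
  proof -
    have "norm (h u) = exp (\<sigma> * u) * norm (F (of_real u))" by (simp add: h_def norm_mult)
    also have "\<dots> \<le> exp (\<sigma> * u) * (B * exp (- \<sigma> * u))" using B[of "of_real u"] by (intro mult_left_mono) auto
    also have "\<dots> = B" by (simp add: exp_minus)
    finally show ?thesis .
  qed
  have int: "integrable lborel h"
    using mellin_integrable[OF F \<beta>, of "of_real \<sigma>"] \<sigma> by (simp add: h_def)
  have M: "mellin_class \<infinity> \<beta> (mellin F)" by (rule mellin_class_mellin[OF F \<beta>])
  have hat_int: "integrable lborel (\<lambda>y. mellin F (Complex \<sigma> y))"
    using inv_mellin_integrable[OF M, of 0 \<sigma>] \<beta> \<sigma> by simp
  have "(LINT y|lborel. iexp (- (y * x)) * mellin F (Complex \<sigma> y)) = 2 * pi * h x"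
    using fourier_inversion[OF cont bnd int, of x] hat_int unfolding hat by simp
  moreover have "mellin F (Complex \<sigma> y) * exp (- Complex \<sigma> y * of_real x) =
      exp (- of_real (\<sigma> * x)) * (iexp (- (y * x)) * mellin F (Complex \<sigma> y))" for y
    using split[of y "- x"] by (simp add: mult_ac)
  ultimately have "inv_mellin \<sigma> (mellin F) (of_real x) = exp (- of_real (\<sigma> * x)) * h x"
    unfolding inv_mellin_def by (simp only: integral_mult_right_zero) simp
  also have "\<dots> = F (of_real x)"
    by (simp add: h_def exp_minus)
  finally show ?thesis .
qed

section \<open>Bounds for the Gamma function\<close>

text \<open>With x = exp u this bounds x powr \<sigma> * exp (- c x), which is maximal at x =
  \<sigma> / c. It is ln y <= y - 1 at y = c x / \<sigma>, with the resulting factor exp (-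
  \<sigma>) estimated by 1.\<close>

lemma exp_minus_exp_le:
  fixes \<sigma> c u :: real
  assumes "\<sigma> > 0" "c > 0"
  shows "exp (- c * exp u) \<le> exp (\<sigma> * ln (\<sigma> / c)) * exp (- \<sigma> * u)"
proof -
  have "ln (c * exp u / \<sigma>) \<le> c * exp u / \<sigma> - 1"
    using assms by (intro ln_le_minus_one) auto
  then have "\<sigma> * (ln c + u - ln \<sigma>) \<le> \<sigma> * (c * exp u / \<sigma> - 1)"
    using assms by (intro mult_left_mono) (auto simp: ln_div ln_mult)
  then have "- c * exp u \<le> \<sigma> * ln (\<sigma> / c) + - \<sigma> * u"
    using assms by (simp add: ln_div algebra_simps)
  then have "exp (- c * exp u) \<le> exp (\<sigma> * ln (\<sigma> / c) + - \<sigma> * u)" by simp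
  then show ?thesis by (simp only: exp_add)
qed

lemma cos_mono_abs:
  assumes "\<bar>\<theta>\<bar> \<le> \<beta>'" "\<beta>' < pi / 2"
  shows "cos \<beta>' \<le> cos \<theta>" "0 < cos \<beta>'"
proof -
  have "cos \<beta>' \<le> cos \<bar>\<theta>\<bar>" using assms by (intro cos_monotone_0_pi_le) auto
  then show "cos \<beta>' \<le> cos \<theta>" by (simp add: abs_if split: if_splits)
  show "0 < cos \<beta>'" using assms by (intro cos_gt_zero_pi) auto
qed

lemma norm_exp_minus_exp_le:
  assumes "\<bar>Im w\<bar> \<le> \<beta>'" "\<beta>' < pi / 2"
  shows "norm (exp (- exp w)) \<le> exp (- cos \<beta>' * exp (Re w))"
  using cos_mono_abs[OF assms] by (simp add: norm_exp_eq_Re Re_exp mult.commute)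

text \<open>Re (exp w) = exp (Re w) * cos (Im w), and the cosine has a positive lower bound on
  closed substrips up to the half-width pi / 2.\<close>

lemma sector_class_exp_minus_exp: "sector_class \<infinity> (pi / 2) (\<lambda>w. exp (- exp w))"
  unfolding sector_class_def
proof (intro conjI allI impI)
  show "(\<lambda>w. exp (- exp w)) holomorphic_on {w. \<bar>Im w\<bar> < pi / 2}" by (intro holomorphic_intros)
  fix \<sigma> \<beta>' :: real assume *: "0 < \<sigma>" "0 \<le> \<beta>'" "\<beta>' < pi / 2"
  then have c: "cos \<beta>' > 0" by (intro cos_gt_zero_pi) auto
  have "norm (exp (- exp w)) \<le> exp (\<sigma> * ln (\<sigma> / cos \<beta>')) * exp (- \<sigma> * Re w)" if "\<bar>Im w\<bar> \<le> \<beta>'" for w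
    using order_trans[OF norm_exp_minus_exp_le[OF that] exp_minus_exp_le[OF _ c, of \<sigma> "Re w"]] * by blast
  then show "\<exists>C. \<forall>w. \<bar>Im w\<bar> \<le> \<beta>' \<longrightarrow> norm (exp (- exp w)) \<le> C * exp (- \<sigma> * Re w)" by blast
qed

lemma Gamma_eq_mellin:
  assumes z: "Re z > 0"
  shows "mellin (\<lambda>w. exp (- exp w)) z = Gamma z"
proof -
  define \<phi> where "\<phi> = (\<lambda>t::real. exp ((z - 1) * of_real (ln t)) / of_real (exp t) :: complex)"
  have \<phi>_meas: "\<phi> \<in> borel_measurable borel" unfolding \<phi>_def by measurable
  have eq: "exp u *\<^sub>R \<phi> (exp u) = exp (z * of_real u) * exp (- exp (of_real u))" for u :: real
    by (simp add: \<phi>_def scaleR_conv_of_real exp_of_real[symmetric] exp_minus divide_inverse algebra_simps exp_diff)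
  have int: "integrable lborel (\<lambda>u. exp u *\<^sub>R \<phi> (exp u))"
    unfolding eq using mellin_integrable[OF sector_class_exp_minus_exp _ z] by simp
  have ai: "\<phi> absolutely_integrable_on {0<..}"
  proof -
    have "integrable lborel (\<lambda>t. indicator {0<..} t *\<^sub>R \<phi> t)"
      using int exp_substitution_integrable_iff[OF \<phi>_meas] by simp
    then show ?thesis using \<phi>_meas by (simp add: set_integrable_def integrable_completion)
  qed
  have "((\<lambda>t. of_real t powr (z - 1) / of_real (exp t)) has_integral Gamma z) {0<..}"
    by (rule Gamma_integral_complex'[OF z])
  then have "(\<phi> has_integral Gamma z) {0<..}"
    by (rule has_integral_eq[rotated]) (auto simp: \<phi>_def powr_def Ln_of_real)
  then have "Gamma z = integral {0<..} \<phi>" by (simp add: integral_unique)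
  also have "\<dots> = (LINT t|lborel. indicator {0<..} t *\<^sub>R \<phi> t)"
    using set_lebesgue_integral_eq_integral(2)[OF ai] \<phi>_meas
    by (simp add: set_lebesgue_integral_def integral_completion)
  also have "\<dots> = mellin (\<lambda>w. exp (- exp w)) z"
    unfolding exp_substitution_integral[OF \<phi>_meas int] eq mellin_def ..
  finally show ?thesis by simp
qed

lemma mellin_class_cong:
  assumes "mellin_class b \<beta> \<Phi>" "\<And>\<xi>. \<xi> \<in> vstrip b \<Longrightarrow> \<Phi> \<xi> = \<Phi>' \<xi>"
  shows "mellin_class b \<beta> \<Phi>'"
  unfolding mellin_class_def
proof (intro conjI allI impI)
  show "\<Phi>' holomorphic_on vstrip b"
    using assms by (auto simp: mellin_class_def cong: holomorphic_cong)
  fix \<sigma>1 \<sigma>2 \<beta>' assume s: "0 < \<sigma>1" "\<sigma>1 \<le> \<sigma>2" "ereal \<sigma>2 < b" "0 \<le> \<beta>'" "\<beta>' < \<beta>"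
  obtain C where C: "\<And>\<xi>. \<sigma>1 \<le> Re \<xi> \<Longrightarrow> Re \<xi> \<le> \<sigma>2 \<Longrightarrow> norm (\<Phi> \<xi>) \<le> C * exp (- \<beta>' * \<bar>Im \<xi>\<bar>)"
    using mellin_classD[OF assms(1) s] by blast
  have "\<xi> \<in> vstrip b" if "\<sigma>1 \<le> Re \<xi>" "Re \<xi> \<le> \<sigma>2" for \<xi>
    using that s le_less_trans[of "ereal (Re \<xi>)" "ereal \<sigma>2" b] by (auto simp: vstrip_def)
  then show "\<exists>C. \<forall>\<xi>. \<sigma>1 \<le> Re \<xi> \<and> Re \<xi> \<le> \<sigma>2 \<longrightarrow> norm (\<Phi>' \<xi>) \<le> C * exp (- \<beta>' * \<bar>Im \<xi>\<bar>)"
    using C assms(2) by metis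
qed

text \<open>The decay of \<open>Gamma\<close> on vertical lines is read off the sector in which exp
  (- x) decays, without Stirling's formula.\<close>

lemma mellin_class_Gamma: "mellin_class \<infinity> (pi / 2) Gamma"
  by (rule mellin_class_cong[OF mellin_class_mellin[OF sector_class_exp_minus_exp]])
     (auto simp: Gamma_eq_mellin vstrip_def)

section \<open>Growth of the reciprocal Gamma function and of Gamma quotients\<close>

lemma norm_sin_le_exp: "norm (sin (z::complex)) \<le> exp \<bar>Im z\<bar>"
proof -
  have "norm (sin z) = norm (exp (\<i> * z) - exp (- (\<i> * z))) / 2"
    by (simp add: sin_exp_eq norm_divide norm_mult)
  also have "\<dots> \<le> (norm (exp (\<i> * z)) + norm (exp (- (\<i> * z)))) / 2"
    by (intro divide_right_mono norm_triangle_ineq4) auto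
  also have "\<dots> = (exp (- Im z) + exp (Im z)) / 2" by (simp add: norm_exp_eq_Re)
  also have "\<dots> \<le> (exp \<bar>Im z\<bar> + exp \<bar>Im z\<bar>) / 2"
    by (intro divide_right_mono add_mono) auto
  finally show ?thesis by simp
qed

lemma Gamma_rGamma_right_half_plane: "Re \<xi> > 0 \<Longrightarrow> rGamma \<xi> * Gamma \<xi> = 1"
proof -
  assume "Re \<xi> > 0"
  then have "rGamma \<xi> \<noteq> 0" by (auto simp: rGamma_eq_zero_iff nonpos_Ints_def)
  then show ?thesis by (simp add: Gamma_def)
qed

text \<open>For |Im z| <= 1 compactness suffices. Otherwise the reflection formula writes
  \<open>rGamma\<close> as sine times \<open>Gamma\<close>: the sine grows at rate pi,
  \<open>Gamma\<close> decays at every rate below pi / 2, and pi / 2 + \<delta> remains. A shift to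
  the left by \<open>n\<close> first brings 1 - w into the right half-plane.\<close>

lemma rGamma_bound:
  assumes \<delta>: "\<delta> > 0"
  obtains C where "C \<ge> 0"
    "\<And>z. a1 \<le> Re z \<Longrightarrow> Re z \<le> a2 \<Longrightarrow> norm (rGamma z) \<le> C * exp ((pi / 2 + \<delta>) * \<bar>Im z\<bar>)"
proof -
  obtain n :: nat where n: "real n > a2" using reals_Archimedean2 by blast
  define \<delta>' where "\<delta>' = min \<delta> (pi / 2)"
  have \<delta>': "0 < \<delta>'" "\<delta>' \<le> \<delta>" "\<delta>' \<le> pi / 2" using \<delta> by (auto simp: \<delta>'_def)
  \<comment> \<open>The comparisons with 1 yield \<open>0 < c1\<close> and
    \<open>c1 \<le> c2\<close> also when \<open>a1 > a2\<close>.\<close>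
  define c1 where "c1 = min (1 - a2 + n) 1"
  define c2 where "c2 = max (1 - a1 + n) 1"
  obtain C1 where C1: "C1 \<ge> 0" and
    Gb: "\<And>\<xi>. c1 \<le> Re \<xi> \<Longrightarrow> Re \<xi> \<le> c2 \<Longrightarrow> norm (Gamma \<xi>) \<le> C1 * exp (- (pi / 2 - \<delta>') * \<bar>Im \<xi>\<bar>)"
  proof (rule mellin_classD[OF mellin_class_Gamma, of c1 c2 "pi / 2 - \<delta>'"])
    show "0 < c1" "c1 \<le> c2" using n by (auto simp: c1_def c2_def)
  qed (use \<delta>' in auto)
  have "bounded (rGamma ` cbox (Complex a1 (-1)) (Complex a2 1))"
    by (intro compact_imp_bounded compact_continuous_image holomorphic_on_imp_continuous_on
        holomorphic_intros compact_cbox)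
  then obtain C2 where C2: "\<And>z. z \<in> cbox (Complex a1 (-1)) (Complex a2 1) \<Longrightarrow> norm (rGamma z) \<le> C2"
    by (auto simp: bounded_iff)
  define C where "C = max 0 (max C1 C2)"
  have "norm (rGamma z) \<le> C * exp ((pi / 2 + \<delta>) * \<bar>Im z\<bar>)" if z: "a1 \<le> Re z" "Re z \<le> a2" for z
  proof (cases "\<bar>Im z\<bar> \<le> 1")
    case True
    then have "norm (rGamma z) \<le> C2" using z by (intro C2) (auto simp: in_cbox_complex_iff)
    also have "\<dots> \<le> C * 1" by (simp add: C_def)
    also have "\<dots> \<le> C * exp ((pi / 2 + \<delta>) * \<bar>Im z\<bar>)"
      using \<delta> by (intro mult_left_mono) (auto simp: C_def add_nonneg_nonneg)
    finally show ?thesis .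
  next
    case False
    define w where "w = z - of_nat n"
    \<comment> \<open>Each factor has an imaginary part of modulus above 1, so the shift to
      \<open>w\<close> can only enlarge the norm of \<open>rGamma\<close>.\<close>
    have "norm (pochhammer w n) \<ge> 1"
      unfolding pochhammer_prod prod_norm[symmetric]
    proof (rule prod_ge_1)
      fix i
      show "1 \<le> norm (w + of_nat i)"
        using False abs_Im_le_cmod[of "w + of_nat i"] by (simp add: w_def)
    qed
    then have "norm (rGamma z) \<le> norm (pochhammer w n) * norm (rGamma z)"
      using mult_right_mono[of 1 "norm (pochhammer w n)" "norm (rGamma z)"] by simp
    also have "\<dots> = norm (rGamma w)"
      using pochhammer_rGamma[of w n] by (simp add: w_def norm_mult)
    also have "\<dots> = norm (sin (of_real pi * w)) / pi * norm (Gamma (1 - w))"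
    proof -
      have "rGamma (1 - w) \<noteq> 0"
        using Gamma_rGamma_right_half_plane[of "1 - w"] n z by (auto simp: w_def)
      then have "rGamma w = sin (of_real pi * w) / of_real pi * Gamma (1 - w)"
        using rGamma_reflection_complex[of w] by (simp add: Gamma_def field_simps)
      then show ?thesis by (simp add: norm_mult norm_divide)
    qed
    also have "\<dots> \<le> exp (pi * \<bar>Im z\<bar>) * (C1 * exp (- (pi / 2 - \<delta>') * \<bar>Im z\<bar>))"
    proof (rule mult_mono)
      have "norm (sin (of_real pi * w)) / pi \<le> exp \<bar>Im (of_real pi * w)\<bar> / 1"
        using pi_ge_two by (intro frac_le norm_sin_le_exp) auto
      then show "norm (sin (of_real pi * w)) / pi \<le> exp (pi * \<bar>Im z\<bar>)" by (simp add: w_def abs_mult)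
      show "norm (Gamma (1 - w)) \<le> C1 * exp (- (pi / 2 - \<delta>') * \<bar>Im z\<bar>)"
        using Gb[of "1 - w"] z by (simp add: w_def c1_def c2_def)
    qed auto
    also have "\<dots> = C1 * exp ((pi / 2 + \<delta>') * \<bar>Im z\<bar>)"
      by (simp add: exp_add[symmetric] field_simps)
    also have "\<dots> \<le> C * exp ((pi / 2 + \<delta>) * \<bar>Im z\<bar>)"
      using C1 \<delta>' by (intro mult_mono) (auto simp: C_def intro!: mult_right_mono)
    finally show ?thesis .
  qed
  then show ?thesis using that[of C] by (auto simp: C_def)
qed

text \<open>The rate pi / 2 at which \<open>Gamma\<close> decays and the rate pi / 2 at which
  \<open>rGamma\<close> grows cancel up to 2 \<delta>' <= \<delta>. The fixed imaginary parts of
  \<open>z\<close> and \<open>q\<close> affect only the constant, through \<open>k1\<close> and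
  \<open>k2\<close>.\<close>

lemma Gamma_ratio_bound:
  assumes \<delta>: "\<delta> > 0" and \<sigma>: "\<sigma>1 \<le> \<sigma>2" "\<sigma>2 < Re z + Re q"
  obtains C where "C \<ge> 0" "\<And>\<xi>. \<sigma>1 \<le> Re \<xi> \<Longrightarrow> Re \<xi> \<le> \<sigma>2 \<Longrightarrow>
    norm (Gamma (z - \<xi> + q) * rGamma (z + 1 - \<xi>)) \<le> C * exp (\<delta> * \<bar>Im \<xi>\<bar>)"
proof -
  define \<delta>' where "\<delta>' = min (\<delta> / 2) (pi / 2)"
  have \<delta>': "0 < \<delta>'" "\<delta>' \<le> \<delta> / 2" "\<delta>' \<le> pi / 2" using \<delta> by (auto simp: \<delta>'_def)
  obtain C1 where C1: "C1 \<ge> 0" and Gb: "\<And>\<xi>. Re z + Re q - \<sigma>2 \<le> Re \<xi> \<Longrightarrow> Re \<xi> \<le> Re z + Re q - \<sigma>1 \<Longrightarrow>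
      norm (Gamma \<xi>) \<le> C1 * exp (- (pi / 2 - \<delta>') * \<bar>Im \<xi>\<bar>)"
    using mellin_classD[OF mellin_class_Gamma, of "Re z + Re q - \<sigma>2" "Re z + Re q - \<sigma>1" "pi / 2 - \<delta>'"] \<delta>' \<sigma>
    by auto
  obtain C2 where C2: "C2 \<ge> 0" and rb: "\<And>\<xi>. Re z + 1 - \<sigma>2 \<le> Re \<xi> \<Longrightarrow> Re \<xi> \<le> Re z + 1 - \<sigma>1 \<Longrightarrow>
      norm (rGamma \<xi>) \<le> C2 * exp ((pi / 2 + \<delta>') * \<bar>Im \<xi>\<bar>)"
    using rGamma_bound[OF \<delta>'(1)] by blast
  define k1 where "k1 = (pi / 2 - \<delta>') * \<bar>Im (z + q)\<bar>"
  define k2 where "k2 = (pi / 2 + \<delta>') * \<bar>Im z\<bar>"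
  have "norm (Gamma (z - \<xi> + q) * rGamma (z + 1 - \<xi>)) \<le> (C1 * C2 * exp (k1 + k2)) * exp (\<delta> * \<bar>Im \<xi>\<bar>)"
    if \<xi>: "\<sigma>1 \<le> Re \<xi>" "Re \<xi> \<le> \<sigma>2" for \<xi>
  proof -
    have "norm (Gamma (z - \<xi> + q)) \<le> C1 * exp (- (pi / 2 - \<delta>') * \<bar>Im (z - \<xi> + q)\<bar>)"
      by (rule Gb) (use \<xi> in auto)
    also have "\<dots> \<le> C1 * exp (k1 - (pi / 2 - \<delta>') * \<bar>Im \<xi>\<bar>)"
    proof -
      have "(pi / 2 - \<delta>') * \<bar>Im \<xi>\<bar> \<le> (pi / 2 - \<delta>') * (\<bar>Im (z - \<xi> + q)\<bar> + \<bar>Im (z + q)\<bar>)"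
        using \<delta>' by (intro mult_left_mono) auto
      then show ?thesis using C1 by (intro mult_left_mono) (auto simp: k1_def algebra_simps)
    qed
    finally have 1: "norm (Gamma (z - \<xi> + q)) \<le> C1 * exp (k1 - (pi / 2 - \<delta>') * \<bar>Im \<xi>\<bar>)" .
    have "norm (rGamma (z + 1 - \<xi>)) \<le> C2 * exp ((pi / 2 + \<delta>') * \<bar>Im (z + 1 - \<xi>)\<bar>)"
      by (rule rb) (use \<xi> in auto)
    also have "\<dots> \<le> C2 * exp (k2 + (pi / 2 + \<delta>') * \<bar>Im \<xi>\<bar>)"
    proof -
      have "(pi / 2 + \<delta>') * \<bar>Im (z + 1 - \<xi>)\<bar> \<le> (pi / 2 + \<delta>') * (\<bar>Im z\<bar> + \<bar>Im \<xi>\<bar>)"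
        using \<delta>' by (intro mult_left_mono) auto
      then show ?thesis using C2 by (intro mult_left_mono) (auto simp: k2_def algebra_simps)
    qed
    finally have 2: "norm (rGamma (z + 1 - \<xi>)) \<le> C2 * exp (k2 + (pi / 2 + \<delta>') * \<bar>Im \<xi>\<bar>)" .
    have "norm (Gamma (z - \<xi> + q) * rGamma (z + 1 - \<xi>)) \<le>
        (C1 * exp (k1 - (pi / 2 - \<delta>') * \<bar>Im \<xi>\<bar>)) * (C2 * exp (k2 + (pi / 2 + \<delta>') * \<bar>Im \<xi>\<bar>))"
      unfolding norm_mult using 1 2 C1 by (intro mult_mono) auto
    also have "\<dots> = C1 * C2 * exp (k1 + k2) * exp (2 * \<delta>' * \<bar>Im \<xi>\<bar>)"
    proof -
      have "exp (k1 - (pi / 2 - \<delta>') * \<bar>Im \<xi>\<bar>) * exp (k2 + (pi / 2 + \<delta>') * \<bar>Im \<xi>\<bar>) =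
          exp (k1 + k2) * exp (2 * \<delta>' * \<bar>Im \<xi>\<bar>)"
        unfolding exp_add[symmetric] by (simp add: algebra_simps)
      then show ?thesis by (simp add: mult_ac)
    qed
    also have "\<dots> \<le> C1 * C2 * exp (k1 + k2) * exp (\<delta> * \<bar>Im \<xi>\<bar>)"
      using C1 C2 \<delta>' by (intro mult_left_mono) (auto intro!: mult_right_mono)
    finally show ?thesis .
  qed
  then show ?thesis using that[of "C1 * C2 * exp (k1 + k2)"] C1 C2 by auto
qed

text \<open>The small growth of the quotient is paid from the gap between \<beta>' and \<beta>, so
  \<beta> survives; the new right edge is the abscissa of the first pole of Gamma (z - \<xi> +
  q).\<close>

lemma mellin_class_mult_Gamma_ratio:
  assumes \<Phi>: "mellin_class \<infinity> \<beta> \<Phi>"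
  shows "mellin_class (ereal (Re z + Re q)) \<beta> (\<lambda>\<xi>. \<Phi> \<xi> * (Gamma (z - \<xi> + q) * rGamma (z + 1 - \<xi>)))"
  unfolding mellin_class_def
proof (intro conjI allI impI)
  let ?V = "vstrip (ereal (Re z + Re q))"
  have "\<Phi> holomorphic_on ?V"
    using \<Phi> by (auto simp: mellin_class_def vstrip_def elim!: holomorphic_on_subset)
  moreover have "(\<lambda>\<xi>. Gamma (z - \<xi> + q)) holomorphic_on ?V"
    by (intro holomorphic_intros) (auto simp: vstrip_def nonpos_Ints_def complex_eq_iff)
  ultimately show "(\<lambda>\<xi>. \<Phi> \<xi> * (Gamma (z - \<xi> + q) * rGamma (z + 1 - \<xi>))) holomorphic_on ?V"
    by (intro holomorphic_on_mult holomorphic_rGamma' holomorphic_on_diff holomorphic_on_const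
        holomorphic_on_ident)
  fix \<sigma>1 \<sigma>2 \<beta>' :: real
  assume s: "0 < \<sigma>1" "\<sigma>1 \<le> \<sigma>2" "ereal \<sigma>2 < ereal (Re z + Re q)" "0 \<le> \<beta>'" "\<beta>' < \<beta>"
  define \<beta>'' where "\<beta>'' = (\<beta>' + \<beta>) / 2"
  have b: "\<beta>' < \<beta>''" "\<beta>'' < \<beta>" "0 \<le> \<beta>''" using s by (auto simp: \<beta>''_def)
  obtain C1 where C1: "C1 \<ge> 0"
    "\<And>\<xi>. \<sigma>1 \<le> Re \<xi> \<Longrightarrow> Re \<xi> \<le> \<sigma>2 \<Longrightarrow> norm (\<Phi> \<xi>) \<le> C1 * exp (- \<beta>'' * \<bar>Im \<xi>\<bar>)"
    using mellin_classD[OF \<Phi> s(1,2) _ b(3,2)] by auto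
  obtain C2 where C2: "C2 \<ge> 0" "\<And>\<xi>. \<sigma>1 \<le> Re \<xi> \<Longrightarrow> Re \<xi> \<le> \<sigma>2 \<Longrightarrow>
    norm (Gamma (z - \<xi> + q) * rGamma (z + 1 - \<xi>)) \<le> C2 * exp ((\<beta>'' - \<beta>') * \<bar>Im \<xi>\<bar>)"
    using Gamma_ratio_bound[of "\<beta>'' - \<beta>'" \<sigma>1 \<sigma>2 z q] s b by auto
  have "norm (\<Phi> \<xi> * (Gamma (z - \<xi> + q) * rGamma (z + 1 - \<xi>))) \<le> (C1 * C2) * exp (- \<beta>' * \<bar>Im \<xi>\<bar>)"
    if "\<sigma>1 \<le> Re \<xi> \<and> Re \<xi> \<le> \<sigma>2" for \<xi>
  proof -
    have "norm (\<Phi> \<xi> * (Gamma (z - \<xi> + q) * rGamma (z + 1 - \<xi>))) \<le>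
        (C1 * exp (- \<beta>'' * \<bar>Im \<xi>\<bar>)) * (C2 * exp ((\<beta>'' - \<beta>') * \<bar>Im \<xi>\<bar>))"
      unfolding norm_mult[of "\<Phi> \<xi>"] using C1 C2 that by (intro mult_mono) auto
    also have "\<dots> = (C1 * C2) * (exp (- \<beta>'' * \<bar>Im \<xi>\<bar>) * exp ((\<beta>'' - \<beta>') * \<bar>Im \<xi>\<bar>))"
      by (simp add: mult_ac)
    also have "exp (- \<beta>'' * \<bar>Im \<xi>\<bar>) * exp ((\<beta>'' - \<beta>') * \<bar>Im \<xi>\<bar>) = exp (- \<beta>' * \<bar>Im \<xi>\<bar>)"
      unfolding exp_add[symmetric] by (simp add: algebra_simps)
    finally show ?thesis .
  qed
  then show "\<exists>C. \<forall>\<xi>. \<sigma>1 \<le> Re \<xi> \<and> Re \<xi> \<le> \<sigma>2 \<longrightarrow>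
      norm (\<Phi> \<xi> * (Gamma (z - \<xi> + q) * rGamma (z + 1 - \<xi>))) \<le> C * exp (- \<beta>' * \<bar>Im \<xi>\<bar>)" by blast
qed

text \<open>Division by \<open>Gamma\<close> is multiplication by the entire function
  \<open>rGamma\<close>, of growth rate at most pi / 2 + \<beta> / 4 on the line; against the decay
  rate \<beta> / 2 of the product this leaves pi / 2 - \<beta> / 4, which is below pi / 2.\<close>

lemma sum_admissible_if_mellin_class:
  assumes M: "mellin_class b \<beta> (\<lambda>\<xi>. Gamma \<xi> * \<psi> \<xi>)" and \<beta>: "0 < \<beta>" "\<beta> \<le> pi / 2"
  shows "sum_admissible b \<psi>"
proof -
  have eq: "\<psi> \<xi> = rGamma \<xi> * (Gamma \<xi> * \<psi> \<xi>)" if "Re \<xi> > 0" for \<xi>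
    using Gamma_rGamma_right_half_plane[OF that] by (simp flip: mult.assoc)
  show ?thesis
    unfolding sum_admissible_def
  proof (intro conjI allI impI)
    have "(\<lambda>\<xi>. rGamma \<xi> * (Gamma \<xi> * \<psi> \<xi>)) holomorphic_on vstrip b"
      using M unfolding mellin_class_def by (intro holomorphic_on_mult[OF holomorphic_rGamma]) auto
    then show "\<psi> holomorphic_on vstrip b"
      by (rule holomorphic_transform) (use eq in \<open>auto simp: vstrip_def\<close>)
    fix \<sigma> assume \<sigma>: "0 < \<sigma> \<and> ereal \<sigma> < b"
    obtain C1 where C1: "C1 \<ge> 0"
      "\<And>\<xi>. \<sigma> \<le> Re \<xi> \<Longrightarrow> Re \<xi> \<le> \<sigma> \<Longrightarrow> norm (Gamma \<xi> * \<psi> \<xi>) \<le> C1 * exp (- (\<beta> / 2) * \<bar>Im \<xi>\<bar>)"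
      using mellin_classD[OF M, of \<sigma> \<sigma> "\<beta> / 2"] \<sigma> \<beta> by auto
    obtain C2 where C2: "C2 \<ge> 0"
      "\<And>z. \<sigma> \<le> Re z \<Longrightarrow> Re z \<le> \<sigma> \<Longrightarrow> norm (rGamma z) \<le> C2 * exp ((pi / 2 + \<beta> / 4) * \<bar>Im z\<bar>)"
      using rGamma_bound[of "\<beta> / 4" \<sigma> \<sigma>] \<beta> by auto
    have "norm (\<psi> (Complex \<sigma> y)) \<le> (C2 * C1) * exp ((pi / 2 - \<beta> / 4) * \<bar>y\<bar>)" for y
    proof -
      have "norm (\<psi> (Complex \<sigma> y)) = norm (rGamma (Complex \<sigma> y)) * norm (Gamma (Complex \<sigma> y) * \<psi> (Complex \<sigma> y))"
        using eq[of "Complex \<sigma> y"] \<sigma> by (metis complex.sel(1) norm_mult)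
      also have "\<dots> \<le> (C2 * exp ((pi / 2 + \<beta> / 4) * \<bar>y\<bar>)) * (C1 * exp (- (\<beta> / 2) * \<bar>y\<bar>))"
        using C1(1) C1(2)[of "Complex \<sigma> y"] C2(1) C2(2)[of "Complex \<sigma> y"] by (intro mult_mono) auto
      also have "\<dots> = (C2 * C1) * (exp ((pi / 2 + \<beta> / 4) * \<bar>y\<bar>) * exp (- (\<beta> / 2) * \<bar>y\<bar>))"
        by (simp add: mult_ac)
      also have "exp ((pi / 2 + \<beta> / 4) * \<bar>y\<bar>) * exp (- (\<beta> / 2) * \<bar>y\<bar>) = exp ((pi / 2 - \<beta> / 4) * \<bar>y\<bar>)"
        unfolding exp_add[symmetric] by (simp add: algebra_simps)
      finally show ?thesis .
    qed
    then show "\<exists>\<alpha> C. \<alpha> < pi / 2 \<and> (\<forall>y. norm (\<psi> (Complex \<sigma> y)) \<le> C * exp (\<alpha> * \<bar>y\<bar>))"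
      using \<beta> by (intro exI[of _ "pi / 2 - \<beta> / 4"] exI[of _ "C2 * C1"]) auto
  qed
qed

section \<open>Fractional convolution operators\<close>

text \<open>For x = t / (1 + exp v) one has \<open>softplus v\<close> = ln (t / x) and
  \<open>softplus (- v)\<close> = ln (t / (t - x)), so one function describes both ends of the
  interval (0, t).\<close>

definition softplus :: "real \<Rightarrow> real" where
  "softplus v = ln (1 + exp v)"

lemma exp_softplus: "exp (softplus v) = 1 + exp v"
  unfolding softplus_def by (rule exp_ln) (simp add: add_pos_pos)

lemma softplus_diff: "softplus v - softplus (- v) = v"
proof -
  have "exp (softplus v - softplus (- v)) = exp v"
  proof -
    have "exp (softplus (- v)) = exp (softplus v) / exp v"
      by (simp add: exp_softplus exp_minus field_simps)
    then show ?thesis unfolding exp_diff by simp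
  qed
  then show ?thesis by simp
qed

text \<open>In these coordinates this is x / t + (t - x) / t = 1.\<close>

lemma exp_minus_softplus_sum: "exp (- softplus v) + exp (- softplus (- v)) = 1"
  unfolding exp_minus exp_softplus
  by (simp add: divide_simps add_pos_pos) (simp add: algebra_simps add_pos_pos order_less_imp_not_eq2)

lemma softplus_bounds:
  "0 \<le> softplus v" "v \<le> softplus v" "softplus v \<le> max v 0 + 1"
proof -
  show "0 \<le> softplus v" by (simp add: softplus_def)
  show "v \<le> softplus v"
  proof -
    have "exp v \<le> exp (softplus v)" unfolding exp_softplus by simp
    then show ?thesis by simp
  qed
  have "exp (softplus v) \<le> exp (max v 0 + 1)"
  proof -
    have "2 \<le> exp (1::real)" using exp_ge_add_one_self[of 1] by simp
    then have "2 * exp (max v 0) \<le> exp 1 * exp (max v 0)" by (intro mult_right_mono) auto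
    moreover have "1 + exp v \<le> 2 * exp (max v 0)" by (simp add: max_def)
    ultimately have "1 + exp v \<le> exp 1 * exp (max v 0)" by linarith
    then show ?thesis unfolding exp_softplus exp_add by (simp only: mult.commute)
  qed
  then show "softplus v \<le> max v 0 + 1" by simp
qed

lemma mult_softplus_le: "c * softplus v \<le> c * max v 0 + \<bar>c\<bar>"
proof (cases "c \<ge> 0")
  case True
  then show ?thesis using mult_left_mono[OF softplus_bounds(3)[of v] True] by (simp add: algebra_simps)
next
  case False
  then have "c * softplus v \<le> c * max v 0"
    using softplus_bounds[of v] by (intro mult_left_mono_neg) auto
  then show ?thesis by simp
qed

lemma softplus_measurable [measurable]: "softplus \<in> borel_measurable borel"
  unfolding softplus_def[abs_def] by measurable

text \<open>The map is x = t / (1 + exp v), from the real line onto (0, t). Its derivative has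
  modulus x (t - x) / t, which in logarithms is the weight in \<open>\<phi>'\<close>.\<close>

lemma sigmoid_substitution:
  fixes \<phi> :: "real \<Rightarrow> complex"
  assumes [measurable]: "\<phi> \<in> borel_measurable borel" and t: "t > 0"
  defines "\<phi>' \<equiv> (\<lambda>v. exp (ln t - softplus v - softplus (- v)) *\<^sub>R \<phi> (exp (ln t - softplus v)))"
  shows sigmoid_substitution_integrable_iff:
      "integrable lborel (\<lambda>x. indicator {0<..<t} x *\<^sub>R \<phi> x) \<longleftrightarrow> integrable lborel \<phi>'"
    and sigmoid_substitution_integral:
      "integrable lborel \<phi>' \<Longrightarrow> (LINT x|lborel. indicator {0<..<t} x *\<^sub>R \<phi> x) = (LINT v|lborel. \<phi>' v)"
proof -
  define g where "g = (\<lambda>v. exp (ln t - softplus v))"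
  define h where "h = (\<lambda>v. - exp (ln t - softplus v - softplus (- v)))"
  have g_eq: "g v = t / (1 + exp v)" for v
    using t by (simp add: g_def exp_diff exp_softplus)
  have pos: "1 + exp v > 0" for v :: real by (simp add: add_pos_pos)
  have deriv: "(g has_field_derivative h v) (at v)" for v
  proof -
    have "((\<lambda>v. t / (1 + exp v)) has_field_derivative - (t * exp v) / (1 + exp v)\<^sup>2) (at v)"
      using pos[of v] by (auto intro!: derivative_eq_intros simp: power2_eq_square)
    moreover have "- (t * exp v) / (1 + exp v)\<^sup>2 = h v"
    proof -
      have "exp (softplus (- v)) = exp (softplus v) / exp v"
        by (simp add: exp_softplus exp_minus field_simps)
      then show ?thesis
        using t unfolding h_def exp_diff exp_softplus by (simp add: power2_eq_square)
    qed
    ultimately show ?thesis unfolding g_eq[abs_def] by simp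
  qed
  have inj: "inj g"
  proof (rule injI)
    fix x y assume "g x = g y"
    then have "1 + exp x = 1 + exp y" using t pos[of x] pos[of y] by (simp add: g_eq field_simps)
    then show "x = y" by simp
  qed
  have range: "range g = {0<..<t}"
  proof (intro equalityI subsetI)
    fix x assume "x \<in> range g"
    then show "x \<in> {0<..<t}" using t pos by (auto simp: g_eq divide_less_eq)
  next
    fix x assume x: "x \<in> {0<..<t}"
    then have "exp (ln (t / x - 1)) = t / x - 1" by (intro exp_ln) (simp add: field_simps)
    then have "g (ln (t / x - 1)) = x" using x by (simp add: g_eq)
    then show "x \<in> range g" by (metis rangeI)
  qed
  have \<phi>'_eq: "\<phi>' = (\<lambda>v. \<bar>h v\<bar> *\<^sub>R \<phi> (g v))" by (auto simp: \<phi>'_def h_def g_def)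
  have *: "\<phi>' absolutely_integrable_on UNIV \<and> integral UNIV \<phi>' = b \<longleftrightarrow>
      \<phi> absolutely_integrable_on {0<..<t} \<and> integral {0<..<t} \<phi> = b" for b
    unfolding range[symmetric] \<phi>'_eq
    by (rule has_absolute_integral_change_of_variables_real)
       (use deriv inj in \<open>auto intro: has_field_derivative_at_within\<close>)
  have [measurable]: "\<phi>' \<in> borel_measurable borel" unfolding \<phi>'_def by measurable
  have 1: "\<phi>' absolutely_integrable_on UNIV \<longleftrightarrow> integrable lborel \<phi>'"
    by (simp add: set_integrable_def integrable_completion)
  have 2: "\<phi> absolutely_integrable_on {0<..<t} \<longleftrightarrow> integrable lborel (\<lambda>x. indicator {0<..<t} x *\<^sub>R \<phi> x)"
    by (simp add: set_integrable_def integrable_completion)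
  show iff: "integrable lborel (\<lambda>x. indicator {0<..<t} x *\<^sub>R \<phi> x) \<longleftrightarrow> integrable lborel \<phi>'"
    using * 1 2 by metis
  assume int: "integrable lborel \<phi>'"
  then have "integral {0<..<t} \<phi> = integral UNIV \<phi>'"
    using * 1 by metis
  moreover have "integral {0<..<t} \<phi> = (LINT x|lborel. indicator {0<..<t} x *\<^sub>R \<phi> x)"
    using set_lebesgue_integral_eq_integral(2)[of "{0<..<t}" \<phi>] int iff 2
    by (simp add: set_lebesgue_integral_def integral_completion)
  moreover have "integral UNIV \<phi>' = (LINT v|lborel. \<phi>' v)"
    using set_lebesgue_integral_eq_integral(2)[of UNIV \<phi>'] int 1
    by (simp add: set_lebesgue_integral_def integral_completion)
  ultimately show "(LINT x|lborel. indicator {0<..<t} x *\<^sub>R \<phi> x) = (LINT v|lborel. \<phi>' v)"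
    by simp
qed

text \<open>This is \<open>\<integral> (t - x) powr (q - 1) * exp (- (t - x)) * F (ln x) dx\<close> over \<open>0 < x < t\<close> for \<open>w = ln t\<close>,
  parametrised by \<open>x = t / (1 + exp v)\<close>, so that \<open>t - x = t / (1 + exp (- v))\<close>.\<close>

definition frac_op :: "complex \<Rightarrow> (complex \<Rightarrow> complex) \<Rightarrow> complex \<Rightarrow> complex" where
  "frac_op q F w = (LINT v|lborel.
     exp (q * (w - of_real (softplus (- v))) - of_real (softplus v) - exp (w - of_real (softplus (- v)))) *
     F (w - of_real (softplus v)))"

text \<open>With w = ln t, the factor exp (- (t - x)) is estimated by an arbitrary negative power of
  t - x and \<open>F\<close> by an arbitrary negative power of x. These two free exponents give
  decay in \<open>w\<close> at the prescribed \<sigma> and integrability in \<open>v\<close> at the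
  same time.\<close>

lemma frac_op_integrand_bound:
  assumes F: "sector_class \<infinity> \<beta> F" and \<beta>: "\<beta> \<le> pi / 2" and q: "Re q > 0"
    and \<sigma>: "\<sigma> > 0" and \<beta>': "0 \<le> \<beta>'" "\<beta>' < \<beta>"
  obtains C \<kappa> where "C \<ge> 0" "\<kappa> > 0" "\<And>w v. \<bar>Im w\<bar> \<le> \<beta>' \<Longrightarrow>
    norm (exp (q * (w - of_real (softplus (- v))) - of_real (softplus v) - exp (w - of_real (softplus (- v)))) *
      F (w - of_real (softplus v))) \<le> C * exp (- \<sigma> * Re w) * exp (- \<kappa> * \<bar>v\<bar>)"
proof -
  define p where "p = Re q"
  have p: "p > 0" using q by (simp add: p_def)
  define I where "I = (\<lambda>w v. exp (q * (w - of_real (softplus (- v))) - of_real (softplus v) -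
    exp (w - of_real (softplus (- v)))) * F (w - of_real (softplus v)))"
  have c: "cos \<beta>' > 0" using \<beta> \<beta>' by (intro cos_gt_zero_pi) auto
  have general: "\<exists>C\<ge>0. \<forall>w v. \<bar>Im w\<bar> \<le> \<beta>' \<longrightarrow>
      norm (I w v) \<le> C * exp ((p - \<tau> - s) * Re w + (\<tau> - p) * softplus (- v) + (s - 1) * softplus v)"
    if \<tau>: "\<tau> > 0" and s: "s > 0" for \<tau> s
  proof -
    obtain C where C: "C \<ge> 0" "\<And>w. \<bar>Im w\<bar> \<le> \<beta>' \<Longrightarrow> norm (F w) \<le> C * exp (- s * Re w)"
      using sector_classD[OF F s _ \<beta>'] by auto
    define D where "D = exp (\<tau> * ln (\<tau> / cos \<beta>'))"
    have "norm (I w v) \<le> (exp (\<bar>Im q\<bar> * \<beta>') * D * C) *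
        exp ((p - \<tau> - s) * Re w + (\<tau> - p) * softplus (- v) + (s - 1) * softplus v)"
      if w: "\<bar>Im w\<bar> \<le> \<beta>'" for w v
    proof -
      define w' where "w' = w - of_real (softplus (- v))"
      have "norm (exp (- exp w')) \<le> exp (- cos \<beta>' * exp (Re w'))"
        using w \<beta> \<beta>' by (intro norm_exp_minus_exp_le) (auto simp: w'_def)
      also have "\<dots> \<le> D * exp (- \<tau> * Re w')" unfolding D_def by (rule exp_minus_exp_le[OF \<tau> c])
      finally have 1: "norm (exp (- exp w')) \<le> D * exp (- \<tau> * Re w')" .
      have 2: "norm (F (w - of_real (softplus v))) \<le> C * exp (- s * (Re w - softplus v))"
        using C(2)[of "w - of_real (softplus v)"] w by simp
      have "- (Im q * Im w) \<le> \<bar>Im q\<bar> * \<beta>'"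
      proof -
        have "- (Im q * Im w) \<le> \<bar>Im q\<bar> * \<bar>Im w\<bar>" by (metis abs_ge_minus_self abs_mult)
        also have "\<dots> \<le> \<bar>Im q\<bar> * \<beta>'" using w by (intro mult_left_mono) auto
        finally show ?thesis .
      qed
      then have 3: "norm (exp (q * w' - of_real (softplus v))) \<le> exp (\<bar>Im q\<bar> * \<beta>' + p * Re w' - softplus v)"
        by (simp add: norm_exp_eq_Re w'_def p_def)
      have "norm (I w v) = norm (exp (q * w' - of_real (softplus v))) * norm (exp (- exp w')) *
          norm (F (w - of_real (softplus v)))"
        unfolding I_def w'_def[symmetric] norm_mult[symmetric] exp_add[symmetric] by simp
      also have "\<dots> \<le> exp (\<bar>Im q\<bar> * \<beta>' + p * Re w' - softplus v) * (D * exp (- \<tau> * Re w')) *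
          (C * exp (- s * (Re w - softplus v)))"
        using 1 2 3 by (intro mult_mono) (auto simp: D_def)
      also have "\<dots> = (D * C) * (exp (\<bar>Im q\<bar> * \<beta>' + p * Re w' - softplus v) * exp (- \<tau> * Re w') *
          exp (- s * (Re w - softplus v)))" by (simp add: mult_ac)
      also have "exp (\<bar>Im q\<bar> * \<beta>' + p * Re w' - softplus v) * exp (- \<tau> * Re w') * exp (- s * (Re w - softplus v))
          = exp (\<bar>Im q\<bar> * \<beta>') * exp ((p - \<tau> - s) * Re w + (\<tau> - p) * softplus (- v) + (s - 1) * softplus v)"
        unfolding exp_add[symmetric] by (simp add: w'_def algebra_simps)
      finally show ?thesis by (simp add: mult_ac)
    qed
    then show ?thesis using C(1) by (intro exI[of _ "exp (\<bar>Im q\<bar> * \<beta>') * D * C"]) (auto simp: D_def)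
  qed
  \<comment> \<open>The parameters have to satisfy \<open>p - \<tau> - s = - \<sigma>\<close>; integrability in \<open>v\<close> requires \<open>s < 1\<close> at \<open>+\<infinity>\<close>
    and \<open>\<tau> < p\<close> at \<open>-\<infinity>\<close>.\<close>
  define s1 where "s1 = min \<sigma> 1 / 2"
  have s1: "s1 > 0" "s1 \<le> 1 / 2" "s1 \<le> \<sigma>" using \<sigma> by (auto simp: s1_def min_def)
  obtain C1 where C1: "C1 \<ge> 0" "\<And>w v. \<bar>Im w\<bar> \<le> \<beta>' \<Longrightarrow>
      norm (I w v) \<le> C1 * exp ((p - (p + \<sigma> - s1) - s1) * Re w + ((p + \<sigma> - s1) - p) * softplus (- v) + (s1 - 1) * softplus v)"
    using general[of "p + \<sigma> - s1" s1] s1 p by auto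
  obtain C2 where C2: "C2 \<ge> 0" "\<And>w v. \<bar>Im w\<bar> \<le> \<beta>' \<Longrightarrow>
      norm (I w v) \<le> C2 * exp ((p - p / 2 - (\<sigma> + p / 2)) * Re w + (p / 2 - p) * softplus (- v) + ((\<sigma> + p / 2) - 1) * softplus v)"
    using general[of "p / 2" "\<sigma> + p / 2"] \<sigma> p by auto
  \<comment> \<open>\<open>K\<close> bounds the softplus term that stays bounded on the respective
    half line. \<open>\<kappa>\<close> is a rate valid on both: for v >= 0 the rate 1 - s1 is at
    least 1 / 2, for v < 0 it is p / 2.\<close>
  define K where "K = max \<sigma> \<bar>\<sigma> + p / 2 - 1\<bar>"
  define \<kappa> where "\<kappa> = min (1 / 2) (p / 2)"
  have \<kappa>: "\<kappa> > 0" using p by (simp add: \<kappa>_def)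
  have "norm (I w v) \<le> (max C1 C2 * exp K) * exp (- \<sigma> * Re w) * exp (- \<kappa> * \<bar>v\<bar>)" if w: "\<bar>Im w\<bar> \<le> \<beta>'" for w v
  proof (cases "v \<ge> 0")
    case True
    have "(\<sigma> - s1) * softplus (- v) \<le> (\<sigma> - s1) * 1"
      using softplus_bounds(3)[of "- v"] True s1 by (intro mult_left_mono) auto
    moreover have "(s1 - 1) * softplus v \<le> (s1 - 1) * v"
      using softplus_bounds(2)[of v] s1 by (intro mult_left_mono_neg) auto
    moreover have "(s1 - 1) * v \<le> - \<kappa> * v" using True s1 by (intro mult_right_mono) (auto simp: \<kappa>_def)
    ultimately
    have "(p - (p + \<sigma> - s1) - s1) * Re w + ((p + \<sigma> - s1) - p) * softplus (- v) + (s1 - 1) * softplus v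
        \<le> K + - \<sigma> * Re w + - \<kappa> * \<bar>v\<bar>"
    proof -
      have "(\<sigma> - s1) * softplus (- v) \<le> K"
        using \<open>(\<sigma> - s1) * softplus (- v) \<le> (\<sigma> - s1) * 1\<close> s1(1) by (simp add: K_def)
      moreover have "(s1 - 1) * softplus v \<le> - \<kappa> * \<bar>v\<bar>"
        using order_trans[OF \<open>(s1 - 1) * softplus v \<le> (s1 - 1) * v\<close> \<open>(s1 - 1) * v \<le> - \<kappa> * v\<close>] True
        by (simp only: abs_of_nonneg)
      ultimately have "- \<sigma> * Re w + ((\<sigma> - s1) * softplus (- v) + (s1 - 1) * softplus v) \<le>
          - \<sigma> * Re w + (K + - \<kappa> * \<bar>v\<bar>)"
        by (intro add_left_mono add_mono)
      then show ?thesis by (simp add: algebra_simps)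
    qed
    then have "norm (I w v) \<le> max C1 C2 * exp (K + - \<sigma> * Re w + - \<kappa> * \<bar>v\<bar>)"
      using C1 w by (intro order_trans[OF C1(2)[OF w]] mult_mono) auto
    then show ?thesis by (simp only: exp_add mult.assoc)
  next
    case False
    have "(p / 2 - p) * softplus (- v) \<le> (p / 2 - p) * (- v)"
      using softplus_bounds(2)[of "- v"] p by (intro mult_left_mono_neg) auto
    moreover have "(p / 2 - p) * (- v) \<le> - \<kappa> * \<bar>v\<bar>"
    proof -
      have "(p / 2) * v \<le> \<kappa> * v" using False by (intro mult_right_mono_neg) (auto simp: \<kappa>_def)
      then show ?thesis using False by simp
    qed
    moreover have "(\<sigma> + p / 2 - 1) * softplus v \<le> \<bar>\<sigma> + p / 2 - 1\<bar>"
      using mult_softplus_le[of "\<sigma> + p / 2 - 1" v] False by (simp add: max_def)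
    ultimately have "(p - p / 2 - (\<sigma> + p / 2)) * Re w + (p / 2 - p) * softplus (- v) + ((\<sigma> + p / 2) - 1) * softplus v
        \<le> K + - \<sigma> * Re w + - \<kappa> * \<bar>v\<bar>"
      by (simp add: K_def max_def)
    then have "norm (I w v) \<le> max C1 C2 * exp (K + - \<sigma> * Re w + - \<kappa> * \<bar>v\<bar>)"
      using C2 w by (intro order_trans[OF C2(2)[OF w]] mult_mono) auto
    then show ?thesis by (simp only: exp_add mult.assoc)
  qed
  then show ?thesis
    using that[of "max C1 C2 * exp K" \<kappa>] C1(1) \<kappa> unfolding I_def by auto
qed

lemma frac_op_integrand_measurable:
  assumes F: "sector_class b \<beta> F" and w: "\<bar>Im w\<bar> < \<beta>"
  shows "(\<lambda>v. exp (q * (w - of_real (softplus (- v))) - of_real (softplus v) - exp (w - of_real (softplus (- v)))) *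
    F (w - of_real (softplus v))) \<in> borel_measurable borel"
proof -
  have "w - of_real (softplus v) = Complex (Re w - softplus v) (Im w)" for v
    by (simp add: complex_eq_iff)
  moreover have "(\<lambda>u. F (Complex u (Im w))) \<in> borel_measurable borel"
    by (rule sector_class_line_measurable[OF F w])
  ultimately have "(\<lambda>v. F (w - of_real (softplus v))) \<in> borel_measurable borel" by simp
  then show ?thesis by measurable
qed

lemma frac_op_integrable:
  assumes F: "sector_class \<infinity> \<beta> F" and \<beta>: "\<beta> \<le> pi / 2" and q: "Re q > 0" and w: "\<bar>Im w\<bar> < \<beta>"
  shows "integrable lborel (\<lambda>v. exp (q * (w - of_real (softplus (- v))) - of_real (softplus v) -
    exp (w - of_real (softplus (- v)))) * F (w - of_real (softplus v)))"
proof -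
  obtain C \<kappa> where C: "C \<ge> 0" "\<kappa> > 0" "\<And>w' v. \<bar>Im w'\<bar> \<le> \<bar>Im w\<bar> \<Longrightarrow>
    norm (exp (q * (w' - of_real (softplus (- v))) - of_real (softplus v) - exp (w' - of_real (softplus (- v)))) *
      F (w' - of_real (softplus v))) \<le> C * exp (- 1 * Re w') * exp (- \<kappa> * \<bar>v\<bar>)"
    using frac_op_integrand_bound[OF F \<beta> q zero_less_one _ w] by auto
  have "integrable lborel (\<lambda>v. C * exp (- 1 * Re w) * exp (- \<kappa> * \<bar>v\<bar>))"
    by (rule integrable_mult_right) (rule integrable_exp_minus_abs[OF C(2)])
  then show ?thesis
    by (rule Bochner_Integration.integrable_bound)
       (use frac_op_integrand_measurable[OF F w] C(1) C(3)[of w] in \<open>auto intro!: AE_I2\<close>)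
qed

text \<open>The preceding bound holds for every \<sigma> > 0 and every \<beta>' < \<beta>, so
  nothing is lost: the operators map the class with the same \<beta> into itself and can be
  composed.\<close>

lemma sector_class_frac_op:
  assumes F: "sector_class \<infinity> \<beta> F" and \<beta>: "\<beta> \<le> pi / 2" and q: "Re q > 0"
  shows "sector_class \<infinity> \<beta> (frac_op q F)"
  unfolding sector_class_def
proof (intro conjI allI impI)
  define I where "I = (\<lambda>w v. exp (q * (w - of_real (softplus (- v))) - of_real (softplus v) -
    exp (w - of_real (softplus (- v)))) * F (w - of_real (softplus v)))"
  have op_eq: "frac_op q F = (\<lambda>w. LINT v|lborel. I w v)" by (simp add: fun_eq_iff frac_op_def I_def)
  show "frac_op q F holomorphic_on {w. \<bar>Im w\<bar> < \<beta>}"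
    unfolding op_eq
  proof (rule holomorphic_on_lebesgue_integral[OF open_horizontal_strip])
    show "I w \<in> borel_measurable lborel" if "w \<in> {w. \<bar>Im w\<bar> < \<beta>}" for w
      using frac_op_integrand_measurable[OF F, of w] that unfolding I_def by simp
    have "(F \<circ> (\<lambda>w. w - of_real (softplus v))) holomorphic_on {w. \<bar>Im w\<bar> < \<beta>}" for v
      by (rule holomorphic_on_compose_gen[where t = "{w. \<bar>Im w\<bar> < \<beta>}"])
         (use F in \<open>auto simp: sector_class_def intro!: holomorphic_intros\<close>)
    then show "(\<lambda>w. I w v) holomorphic_on {w. \<bar>Im w\<bar> < \<beta>}" for v
      unfolding I_def o_def by (intro holomorphic_intros)
    fix w0 assume w0: "w0 \<in> {w. \<bar>Im w\<bar> < \<beta>}"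
    define e where "e = (\<beta> - \<bar>Im w0\<bar>) / 2"
    have e: "e > 0" "\<bar>Im w0\<bar> + e < \<beta>" using w0 by (auto simp: e_def field_simps)
    obtain C \<kappa> where C: "C \<ge> 0" "\<kappa> > 0"
      and bd: "\<And>w v. \<bar>Im w\<bar> \<le> \<bar>Im w0\<bar> + e \<Longrightarrow> norm (I w v) \<le> C * exp (- 1 * Re w) * exp (- \<kappa> * \<bar>v\<bar>)"
      unfolding I_def
      by (rule frac_op_integrand_bound[OF F \<beta> q zero_less_one _ e(2)]) (use e in auto)
    define g where "g = (\<lambda>v. C * exp (\<bar>Re w0\<bar> + e) * exp (- \<kappa> * \<bar>v\<bar>))"
    have "integrable lborel g"
      unfolding g_def by (rule integrable_mult_right) (rule integrable_exp_minus_abs[OF C(2)])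
    moreover have "norm (I w v) \<le> g v" if "dist w0 w < e" for w v
    proof -
      have d: "\<bar>Im w - Im w0\<bar> < e" "\<bar>Re w - Re w0\<bar> < e"
        using that abs_Im_le_cmod[of "w - w0"] abs_Re_le_cmod[of "w - w0"]
        by (auto simp: dist_norm norm_minus_commute)
      have "norm (I w v) \<le> C * exp (- 1 * Re w) * exp (- \<kappa> * \<bar>v\<bar>)"
        using d by (intro bd) auto
      also have "\<dots> \<le> g v"
        unfolding g_def using d C by (intro mult_right_mono mult_left_mono) auto
      finally show ?thesis .
    qed
    ultimately show "\<exists>e>0. \<exists>g. integrable lborel g \<and> (\<forall>w\<in>{w. \<bar>Im w\<bar> < \<beta>}. dist w0 w < e \<longrightarrow>
        (\<forall>v\<in>space lborel. norm (I w v) \<le> g v))"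
      using e by blast
  qed
  fix \<sigma> \<beta>' :: real assume \<sigma>: "0 < \<sigma>" and \<beta>': "0 \<le> \<beta>'" "\<beta>' < \<beta>"
  obtain C \<kappa> where C: "C \<ge> 0" "\<kappa> > 0"
    and bd: "\<And>w v. \<bar>Im w\<bar> \<le> \<beta>' \<Longrightarrow> norm (I w v) \<le> C * exp (- \<sigma> * Re w) * exp (- \<kappa> * \<bar>v\<bar>)"
    unfolding I_def by (rule frac_op_integrand_bound[OF F \<beta> q \<sigma> \<beta>']) auto
  define J where "J = (LINT v|lborel. exp (- \<kappa> * \<bar>v\<bar>))"
  have "norm (frac_op q F w) \<le> (C * J) * exp (- \<sigma> * Re w)" if w: "\<bar>Im w\<bar> \<le> \<beta>'" for w
  proof -
    have "norm (LINT v|lborel. I w v) \<le> (LINT v|lborel. C * exp (- \<sigma> * Re w) * exp (- \<kappa> * \<bar>v\<bar>))"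
    proof (rule Bochner_Integration.integral_norm_bound_integral)
      show "integrable lborel (I w)"
        using frac_op_integrable[OF F \<beta> q, of w] w \<beta>' unfolding I_def by simp
      show "integrable lborel (\<lambda>v. C * exp (- \<sigma> * Re w) * exp (- \<kappa> * \<bar>v\<bar>))"
        by (rule integrable_mult_right) (rule integrable_exp_minus_abs[OF C(2)])
    qed (use bd[OF w] in auto)
    then show ?thesis by (simp add: frac_op_def I_def J_def mult_ac)
  qed
  then show "\<exists>C. \<forall>w. \<bar>Im w\<bar> \<le> \<beta>' \<longrightarrow> norm (frac_op q F w) \<le> C * exp (- \<sigma> * Re w)" by blast
qed

section \<open>Convolutions under the Mellin transform\<close>

text \<open>Euler's integral of x powr (c - 1) * exp (- x r) at x = exp u, r = exp v; translating u
  by v scales r away.\<close>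

lemma Gamma_line:
  assumes c: "Re c > 0"
  shows Gamma_line_integrable: "integrable lborel (\<lambda>u. exp (c * of_real u - of_real (exp (u + v))))"
    and Gamma_line_integral: "(LINT u|lborel. exp (c * of_real u - of_real (exp (u + v)))) = Gamma c * exp (- c * of_real v)"
proof -
  define g where "g = (\<lambda>u::real. exp (c * of_real u) * exp (- exp (of_real u :: complex)))"
  have g: "integrable lborel g"
    unfolding g_def using mellin_integrable[OF sector_class_exp_minus_exp _ c] by simp
  have eq: "exp (c * of_real u - of_real (exp (u + v))) = exp (- c * of_real v) * g (v + 1 * u)" for u
    unfolding g_def exp_of_real[symmetric] mult.assoc[symmetric] exp_add[symmetric] by (simp add: algebra_simps)
  have "integrable lborel (\<lambda>u. g (v + 1 * u))"
    by (rule lborel_integrable_real_affine[OF g]) simp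
  then show "integrable lborel (\<lambda>u. exp (c * of_real u - of_real (exp (u + v))))"
    unfolding eq by (rule integrable_mult_right)
  have "(LINT u|lborel. g u) = \<bar>1\<bar> *\<^sub>R (LINT u|lborel. g (v + 1 * u))"
    by (rule lborel_integral_real_affine) simp
  moreover have "(LINT u|lborel. g u) = Gamma c"
    using Gamma_eq_mellin[OF c] by (simp add: mellin_def g_def)
  ultimately show "(LINT u|lborel. exp (c * of_real u - of_real (exp (u + v)))) = Gamma c * exp (- c * of_real v)"
    unfolding eq by simp
qed

text \<open>The real version evaluates the integrals of norms that Fubini's theorem asks
  for.\<close>

lemma Gamma_line_real:
  fixes c v :: real
  assumes c: "c > 0"
  shows "integrable lborel (\<lambda>u. exp (c * u - exp (u + v)))"
    and "(LINT u|lborel. exp (c * u - exp (u + v))) = Gamma c * exp (- c * v)"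
proof -
  have eq: "complex_of_real (exp (c * u - exp (u + v))) =
      exp (of_real c * of_real u - of_real (exp (u + v)))" for u
    by (simp flip: exp_of_real)
  have i: "integrable lborel (\<lambda>u. complex_of_real (exp (c * u - exp (u + v))))"
    unfolding eq by (rule Gamma_line_integrable) (use c in simp)
  then show "integrable lborel (\<lambda>u. exp (c * u - exp (u + v)))" by (simp only: complex_of_real_integrable_eq)
  have "complex_of_real (LINT u|lborel. exp (c * u - exp (u + v))) =
      Gamma (of_real c) * exp (- of_real c * of_real v)"
    unfolding integral_complex_of_real[symmetric] eq by (rule Gamma_line_integral) (use c in simp)
  also have "\<dots> = of_real (Gamma c * exp (- c * v))"
    by (simp add: Gamma_complex_of_real flip: exp_of_real)
  finally show "(LINT u|lborel. exp (c * u - exp (u + v))) = Gamma c * exp (- c * v)"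
    by (simp only: of_real_eq_iff)
qed

text \<open>The integrand after the substitution \<open>t = x (1 + r)\<close>, with \<open>x = exp u\<close> and \<open>r = exp v\<close>.\<close>

definition shear_kernel :: "complex \<Rightarrow> complex \<Rightarrow> (complex \<Rightarrow> complex) \<Rightarrow> real \<Rightarrow> real \<Rightarrow> complex" where
  "shear_kernel q z F v u = exp (q * of_real v + (z - 1) * of_real (softplus v)) *
     (exp ((z + q) * of_real u - of_real (exp (u + v))) * F (of_real u))"

text \<open>The norm is integrated over u first, which requires exponents below Re z + Re q. A bound
  of \<open>F\<close> with exponent \<sigma> makes the result at most a multiple of exp ((\<sigma> -
  Re z) v) for v < 0 and of exp ((\<sigma> - 1) v) for v >= 0, whence \<sigma>2 > Re z and \<sigma>1
  < 1. Two single bounds are assumed so that functions on a finite strip are covered as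
  well.\<close>

lemma shear_kernel_integrable:
  assumes F[measurable]: "(\<lambda>u. F (of_real u)) \<in> borel_measurable borel"
    and b1: "\<And>u. norm (F (of_real u)) \<le> C1 * exp (- \<sigma>1 * u)"
    and b2: "\<And>u. norm (F (of_real u)) \<le> C2 * exp (- \<sigma>2 * u)"
    and \<sigma>1: "\<sigma>1 < 1" "\<sigma>1 < Re z + Re q" and \<sigma>2: "Re z < \<sigma>2" "\<sigma>2 < Re z + Re q"
  shows "integrable (lborel \<Otimes>\<^sub>M lborel) (\<lambda>(v, u). shear_kernel q z F v u)"
    and "integrable lborel (\<lambda>u. shear_kernel q z F v u)"
proof -
  define a where "a = Re z"
  define p where "p = Re q"
  define A where "A = (\<lambda>v. exp (p * v + (a - 1) * softplus v))"
  have nrm: "norm (shear_kernel q z F v u) = A v * (exp ((a + p) * u - exp (u + v)) * norm (F (of_real u)))" for v u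
    by (simp add: shear_kernel_def A_def norm_mult norm_exp_eq_Re a_def p_def)
  have bound: "norm (shear_kernel q z F v u) \<le> A v * C * exp ((a + p - \<sigma>) * u - exp (u + v))"
    if "norm (F (of_real u)) \<le> C * exp (- \<sigma> * u)" for C \<sigma> v u
  proof -
    have "norm (shear_kernel q z F v u) \<le> A v * (exp ((a + p) * u - exp (u + v)) * (C * exp (- \<sigma> * u)))"
      unfolding nrm using that by (intro mult_left_mono) (auto simp: A_def)
    also have "\<dots> = A v * C * (exp ((a + p) * u - exp (u + v)) * exp (- \<sigma> * u))" by (simp add: mult_ac)
    also have "exp ((a + p) * u - exp (u + v)) * exp (- \<sigma> * u) = exp ((a + p - \<sigma>) * u - exp (u + v))"
      unfolding exp_add[symmetric] by (simp add: algebra_simps)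
    finally show ?thesis .
  qed
  have C: "C1 \<ge> 0" "C2 \<ge> 0" using bound_constant_nonneg[OF b1] bound_constant_nonneg[OF b2] .
  have meas[measurable]: "(\<lambda>(v, u). shear_kernel q z F v u) \<in> borel_measurable (lborel \<Otimes>\<^sub>M lborel)"
    unfolding shear_kernel_def by measurable
  have int: "integrable lborel (\<lambda>u. shear_kernel q z F v u)" for v
  proof (rule Bochner_Integration.integrable_bound)
    show "integrable lborel (\<lambda>u. A v * C1 * exp ((a + p - \<sigma>1) * u - exp (u + v)))"
      by (rule integrable_mult_right) (rule Gamma_line_real, use \<sigma>1 in \<open>simp add: a_def p_def\<close>)
    show "AE u in lborel. norm (shear_kernel q z F v u) \<le> norm (A v * C1 * exp ((a + p - \<sigma>1) * u - exp (u + v)))"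
      using bound[OF b1, of v] C by (auto intro!: AE_I2 simp: A_def)
    show "(\<lambda>u. shear_kernel q z F v u) \<in> borel_measurable lborel"
      unfolding shear_kernel_def by measurable
  qed
  then show "integrable lborel (\<lambda>u. shear_kernel q z F v u)" .
  have inner: "(LINT u|lborel. norm (shear_kernel q z F v u)) \<le> A v * C * Gamma (a + p - \<sigma>) * exp (- (a + p - \<sigma>) * v)"
    if b: "\<And>u. norm (F (of_real u)) \<le> C * exp (- \<sigma> * u)" and \<sigma>: "\<sigma> < a + p" for C \<sigma> v
  proof -
    have "(LINT u|lborel. norm (shear_kernel q z F v u)) \<le> (LINT u|lborel. A v * C * exp ((a + p - \<sigma>) * u - exp (u + v)))"
      using int bound[OF b] \<sigma> by (intro integral_mono integrable_mult_right Gamma_line_real) auto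
    also have "\<dots> = A v * C * (LINT u|lborel. exp ((a + p - \<sigma>) * u - exp (u + v)))" by simp
    also have "\<dots> = A v * C * (Gamma (a + p - \<sigma>) * exp (- (a + p - \<sigma>) * v))"
      by (subst Gamma_line_real(2)) (use \<sigma> in auto)
    finally show ?thesis by (simp add: mult_ac)
  qed
  define \<kappa> where "\<kappa> = min (1 - \<sigma>1) (\<sigma>2 - a)"
  have \<kappa>: "\<kappa> > 0" using \<sigma>1 \<sigma>2 by (simp add: \<kappa>_def a_def)
  define K where "K = max (C1 * Gamma (a + p - \<sigma>1)) (C2 * Gamma (a + p - \<sigma>2)) * exp \<bar>a - 1\<bar>"
  have outer: "(LINT u|lborel. norm (shear_kernel q z F v u)) \<le> K * exp (- \<kappa> * \<bar>v\<bar>)" for v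
  proof -
    have *: "(LINT u|lborel. norm (shear_kernel q z F v u)) \<le> K * exp (- \<kappa> * \<bar>v\<bar>)"
      if b: "\<And>u. norm (F (of_real u)) \<le> C * exp (- \<sigma> * u)" and \<sigma>: "\<sigma> < a + p"
        and G: "C * Gamma (a + p - \<sigma>) \<le> max (C1 * Gamma (a + p - \<sigma>1)) (C2 * Gamma (a + p - \<sigma>2))"
        and ex: "(\<sigma> - a) * v + (a - 1) * max v 0 \<le> - \<kappa> * \<bar>v\<bar>" for C \<sigma>
    proof -
      have C0: "C \<ge> 0" by (rule bound_constant_nonneg[OF b])
      have "(LINT u|lborel. norm (shear_kernel q z F v u)) \<le>
          C * Gamma (a + p - \<sigma>) * (A v * exp (- (a + p - \<sigma>) * v))"
        using inner[OF b \<sigma>, of v] by (simp add: mult_ac)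
      also have "A v * exp (- (a + p - \<sigma>) * v) \<le> exp \<bar>a - 1\<bar> * exp (- \<kappa> * \<bar>v\<bar>)"
        unfolding A_def exp_add[symmetric]
        using mult_softplus_le[of "a - 1" v] ex by (simp add: algebra_simps)
      also have "C * Gamma (a + p - \<sigma>) * (exp \<bar>a - 1\<bar> * exp (- \<kappa> * \<bar>v\<bar>)) \<le> K * exp (- \<kappa> * \<bar>v\<bar>)"
        using mult_right_mono[OF G, of "exp \<bar>a - 1\<bar> * exp (- \<kappa> * \<bar>v\<bar>)"] by (simp add: K_def mult_ac)
      finally show ?thesis
        using C0 \<sigma> Gamma_real_pos[of "a + p - \<sigma>"] by (simp add: mult_left_mono)
    qed
    show ?thesis
    proof (cases "v \<ge> 0")
      case True
      have "(\<sigma>1 - 1) * v \<le> - \<kappa> * v" using True by (intro mult_right_mono) (auto simp: \<kappa>_def)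
      then show ?thesis
        using True \<sigma>1 by (intro *[OF b1]) (auto simp: a_def p_def algebra_simps max_def)
    next
      case False
      have "(\<sigma>2 - a) * v \<le> \<kappa> * v" using False by (intro mult_right_mono_neg) (auto simp: \<kappa>_def)
      then show ?thesis
        using False \<sigma>2 by (intro *[OF b2]) (auto simp: a_def p_def max_def)
    qed
  qed
  show "integrable (lborel \<Otimes>\<^sub>M lborel) (\<lambda>(v, u). shear_kernel q z F v u)"
  proof (rule lborel_pair.Fubini_integrable)
    show "integrable lborel (\<lambda>v. LINT u|lborel. norm (case (v, u) of (v, u) \<Rightarrow> shear_kernel q z F v u))"
    proof (rule Bochner_Integration.integrable_bound)
      show "integrable lborel (\<lambda>v. K * exp (- \<kappa> * \<bar>v\<bar>))"
        by (rule integrable_mult_right) (rule integrable_exp_minus_abs[OF \<kappa>])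
      show "AE v in lborel. norm (LINT u|lborel. norm (case (v, u) of (v, u) \<Rightarrow> shear_kernel q z F v u))
          \<le> norm (K * exp (- \<kappa> * \<bar>v\<bar>))"
        using outer by (auto intro!: AE_I2 order_trans[OF _ abs_ge_self] simp: abs_of_nonneg integral_nonneg_AE)
    qed measurable
  qed (use int in auto)
qed

text \<open>In \<open>frac_op\<close> the variable v is ln ((t - x) / x), the same v as in
  \<open>shear_kernel\<close>. For fixed v the two integrands differ by the translation ln x = ln t
  - softplus v, and Fubini exchanges the order.\<close>

lemma frac_op_mellin:
  assumes F[measurable]: "(\<lambda>u. F (of_real u)) \<in> borel_measurable borel"
    and b1: "\<And>u. norm (F (of_real u)) \<le> C1 * exp (- \<sigma>1 * u)"
    and b2: "\<And>u. norm (F (of_real u)) \<le> C2 * exp (- \<sigma>2 * u)"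
    and \<sigma>1: "\<sigma>1 < 1" "\<sigma>1 < Re z + Re q" and \<sigma>2: "Re z < \<sigma>2" "\<sigma>2 < Re z + Re q"
  shows "integrable lborel (\<lambda>w. exp (z * of_real w) * frac_op q F (of_real w))"
    and "mellin (frac_op q F) z = (LINT v|lborel. LINT u|lborel. shear_kernel q z F v u)"
proof -
  note int = shear_kernel_integrable[OF F b1 b2 \<sigma>1 \<sigma>2]
  define E where "E = (\<lambda>v w. shear_kernel q z F v (- softplus v + 1 * w))"
  have E_eq: "E v w = exp (z * of_real w) *
      (exp (q * (of_real w - of_real (softplus (- v))) - of_real (softplus v) - exp (of_real w - of_real (softplus (- v)))) *
      F (of_real w - of_real (softplus v)))" for v w
  proof -
    have v: "softplus (- v) = softplus v - v" using softplus_diff[of v] by simp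
    have "q * of_real v + (z - 1) * of_real (softplus v) + ((z + q) * of_real (- softplus v + 1 * w) -
        of_real (exp (- softplus v + 1 * w + v))) =
        z * of_real w + (q * (of_real w - of_real (softplus (- v))) - of_real (softplus v) -
          exp (of_real w - of_real (softplus (- v))))"
      unfolding v exp_of_real[symmetric] by (simp add: algebra_simps)
    then show ?thesis
      unfolding E_def shear_kernel_def mult.assoc[symmetric] exp_add[symmetric] by simp
  qed
  have E_int: "integrable (lborel \<Otimes>\<^sub>M lborel) (case_prod E)"
  proof (rule lborel_pair.Fubini_integrable)
    show "case_prod E \<in> borel_measurable (lborel \<Otimes>\<^sub>M lborel)"
      unfolding E_def shear_kernel_def by measurable
    have "(LINT w|lborel. norm (E v w)) = (LINT u|lborel. norm (shear_kernel q z F v u))" for v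
      using lborel_integral_real_affine[of 1 "\<lambda>u. norm (shear_kernel q z F v u)" "- softplus v"]
      by (simp add: E_def)
    moreover have "integrable lborel (\<lambda>v. LINT u|lborel. norm (shear_kernel q z F v u))"
      using lborel_pair.integrable_fst'[OF integrable_norm[OF int(1)]] by simp
    ultimately show "integrable lborel (\<lambda>v. LINT w|lborel. norm (case (v, w) of (v, w) \<Rightarrow> E v w))" by simp
    show "AE v in lborel. integrable lborel (\<lambda>w. case (v, w) of (v, w) \<Rightarrow> E v w)"
      unfolding E_def prod.case
      by (rule AE_I2) (rule lborel_integrable_real_affine[OF int(2)], simp)
  qed
  have op: "(LINT v|lborel. E v w) = exp (z * of_real w) * frac_op q F (of_real w)" for w
    unfolding E_eq frac_op_def by simp
  show "integrable lborel (\<lambda>w. exp (z * of_real w) * frac_op q F (of_real w))"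
    using lborel_pair.integrable_snd[OF E_int] unfolding op .
  have "mellin (frac_op q F) z = (LINT w|lborel. LINT v|lborel. E v w)"
    unfolding mellin_def op ..
  also have "\<dots> = (LINT v|lborel. LINT w|lborel. E v w)"
    by (rule lborel_pair.Fubini_integral[OF E_int])
  also have "\<dots> = (LINT v|lborel. LINT u|lborel. shear_kernel q z F v u)"
  proof (rule Bochner_Integration.integral_cong[OF refl])
    fix v
    show "(LINT w|lborel. E v w) = (LINT u|lborel. shear_kernel q z F v u)"
      using lborel_integral_real_affine[of 1 "shear_kernel q z F v" "- softplus v"] by (simp add: E_def)
  qed
  finally show "mellin (frac_op q F) z = (LINT v|lborel. LINT u|lborel. shear_kernel q z F v u)" .
qed

section \<open>Beta integral and semigroup law\<close>

text \<open>The Beta integral over \<open>(0, 1)\<close> at \<open>x = 1 / (1 + exp v)\<close>.\<close>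

definition Beta_line :: "complex \<Rightarrow> complex \<Rightarrow> complex" where
  "Beta_line a b = (LINT v|lborel. exp (- a * of_real (softplus (- v)) - b * of_real (softplus v)))"

lemma Beta_line_integrable:
  assumes "Re a > 0" "Re b > 0"
  shows "integrable lborel (\<lambda>v. exp (- a * of_real (softplus (- v)) - b * of_real (softplus v)))"
proof (rule Bochner_Integration.integrable_bound)
  define \<kappa> where "\<kappa> = min (Re a) (Re b)"
  have \<kappa>: "\<kappa> > 0" using assms by (simp add: \<kappa>_def)
  then show "integrable lborel (\<lambda>v. exp (- \<kappa> * \<bar>v\<bar>))" by (rule integrable_exp_minus_abs)
  have "\<kappa> * \<bar>v\<bar> \<le> Re a * softplus (- v) + Re b * softplus v" for v
  proof (cases "v \<ge> 0")
    case True
    have "\<kappa> * v \<le> Re b * softplus v" using True assms softplus_bounds(2)[of v]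
      by (intro mult_mono) (auto simp: \<kappa>_def)
    moreover have "0 \<le> Re a * softplus (- v)" using assms softplus_bounds(1)[of "- v"] by simp
    ultimately show ?thesis using True by simp
  next
    case False
    have "\<kappa> * (- v) \<le> Re a * softplus (- v)" using False assms softplus_bounds(2)[of "- v"]
      by (intro mult_mono) (auto simp: \<kappa>_def)
    moreover have "0 \<le> Re b * softplus v" using assms softplus_bounds(1)[of v] by simp
    ultimately show ?thesis using False by simp
  qed
  note le = this
  have "- (Re a * softplus (- v)) - Re b * softplus v \<le> - (\<kappa> * \<bar>v\<bar>)" for v using le[of v] by linarith
  then show "AE v in lborel. norm (exp (- a * of_real (softplus (- v)) - b * of_real (softplus v)))
      \<le> norm (exp (- \<kappa> * \<bar>v\<bar>))"
    by (intro AE_I2) (simp add: norm_exp_eq_Re)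
qed measurable

text \<open>Both sides are the double integral of x powr (a + b) * r powr a * exp (- x (1 + r)) in
  logarithmic coordinates: integrating over x first yields Gamma (a + b) times the Beta integral,
  over r first the product of two Gamma integrals.\<close>

lemma Gamma_mult_Beta_line:
  assumes a: "Re a > 0" and b: "Re b > 0"
  shows "Gamma (a + b) * Beta_line a b = Gamma a * Gamma b"
proof -
  define E where "E = (\<lambda>v u. exp (a * of_real v) * exp ((a + b) * of_real u - of_real (exp (u + softplus v))))"
  have split: "exp (u + softplus v) = exp u + exp (u + v)" for u v
    by (simp add: exp_add exp_softplus algebra_simps)
  have Eu: "E v u = exp ((a + b) * of_real u - of_real (exp (u + 0))) * exp (a * of_real v - of_real (exp (v + u)))" for u v
    unfolding E_def exp_add[symmetric] split by (simp add: algebra_simps)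
  have norm_E: "norm (E v u) = exp (Re a * v) * exp (Re (a + b) * u - exp (u + softplus v))" for v u
    by (simp add: E_def norm_mult norm_exp_eq_Re)
  have ker: "exp (a * of_real v) * exp (- (a + b) * of_real (softplus v)) =
      exp (- a * of_real (softplus (- v)) - b * of_real (softplus v))" for a b :: complex and v
  proof -
    have v: "softplus (- v) = softplus v - v" using softplus_diff[of v] by simp
    show ?thesis unfolding v exp_add[symmetric] by (simp add: algebra_simps)
  qed
  have ker_norm: "exp (Re a * v) * (Gamma (Re (a + b)) * exp (- Re (a + b) * softplus v)) =
      Gamma (Re (a + b)) * norm (exp (- a * of_real (softplus (- v)) - b * of_real (softplus v)))" for v
    unfolding ker[symmetric] by (simp add: norm_mult norm_exp_eq_Re)
  have E_int: "integrable (lborel \<Otimes>\<^sub>M lborel) (case_prod E)"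
  proof (rule lborel_pair.Fubini_integrable)
    show "case_prod E \<in> borel_measurable (lborel \<Otimes>\<^sub>M lborel)" unfolding E_def by measurable
    have "(LINT u|lborel. norm (E v u)) =
        Gamma (Re (a + b)) * norm (exp (- a * of_real (softplus (- v)) - b * of_real (softplus v)))" for v
    proof -
      have "(LINT u|lborel. norm (E v u)) = exp (Re a * v) * (LINT u|lborel. exp (Re (a + b) * u - exp (u + softplus v)))"
        unfolding norm_E by simp
      also have "\<dots> = exp (Re a * v) * (Gamma (Re (a + b)) * exp (- Re (a + b) * softplus v))"
        by (subst Gamma_line_real(2)) (use a b in auto)
      finally show ?thesis unfolding ker_norm .
    qed
    then show "integrable lborel (\<lambda>v. LINT u|lborel. norm (case (v, u) of (v, u) \<Rightarrow> E v u))"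
      using integrable_norm[OF Beta_line_integrable[OF a b]] by simp
    show "AE v in lborel. integrable lborel (\<lambda>u. case (v, u) of (v, u) \<Rightarrow> E v u)"
      unfolding E_def using a b by (auto intro!: AE_I2 integrable_mult_right Gamma_line_integrable)
  qed
  have "Gamma (a + b) * Beta_line a b = (LINT v|lborel. LINT u|lborel. E v u)"
  proof -
    have "(LINT u|lborel. E v u) = Gamma (a + b) * exp (- a * of_real (softplus (- v)) - b * of_real (softplus v))" for v
    proof -
      have "(LINT u|lborel. E v u) = exp (a * of_real v) *
          (LINT u|lborel. exp ((a + b) * of_real u - of_real (exp (u + softplus v))))"
        unfolding E_def by simp
      also have "\<dots> = Gamma (a + b) * (exp (a * of_real v) * exp (- (a + b) * of_real (softplus v)))"
        by (subst Gamma_line_integral) (use a b in auto)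
      finally show ?thesis unfolding ker .
    qed
    then show ?thesis by (simp add: Beta_line_def)
  qed
  also have "\<dots> = (LINT u|lborel. LINT v|lborel. E v u)"
    by (rule lborel_pair.Fubini_integral[OF E_int, symmetric])
  also have "\<dots> = (LINT u|lborel. Gamma a * exp (b * of_real u - of_real (exp (u + 0))))"
  proof (intro Bochner_Integration.integral_cong refl)
    fix u :: real
    have "(LINT v|lborel. E v u) = exp ((a + b) * of_real u - of_real (exp (u + 0))) * (Gamma a * exp (- a * of_real u))"
      unfolding Eu by (subst integral_mult_right_zero, subst Gamma_line_integral) (use a in auto)
    also have "\<dots> = Gamma a * (exp ((a + b) * of_real u - of_real (exp (u + 0))) * exp (- a * of_real u))"
      by (simp only: mult_ac)
    also have "exp ((a + b) * of_real u - of_real (exp (u + 0))) * exp (- a * of_real u) =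
        exp (b * of_real u - of_real (exp (u + 0)))"
      unfolding exp_add[symmetric] by (simp add: algebra_simps)
    finally show "(LINT v|lborel. E v u) = Gamma a * exp (b * of_real u - of_real (exp (u + 0)))" .
  qed
  also have "\<dots> = Gamma a * Gamma b"
    by (subst integral_mult_right_zero, subst Gamma_line_integral) (use b in auto)
  finally show ?thesis .
qed

text \<open>Vanishing for \<open>x \<le> 0\<close>, so that convolutions need no integration bounds.\<close>

definition ppow :: "real \<Rightarrow> complex \<Rightarrow> complex" where
  "ppow x c = (if x > 0 then exp (c * of_real (ln x)) else 0)"

lemma ppow_measurable [measurable]: "(\<lambda>x. ppow x c) \<in> borel_measurable borel"
  unfolding ppow_def by measurable

lemma norm_ppow: "complex_of_real (norm (ppow x c)) = ppow x (of_real (Re c))"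
  by (simp add: ppow_def norm_exp_eq_Re flip: exp_of_real)

definition on_half_line :: "(complex \<Rightarrow> complex) \<Rightarrow> real \<Rightarrow> complex" where
  "on_half_line F x = (if x > 0 then F (of_real (ln x)) else 0)"

lemma on_half_line_measurable:
  assumes [measurable]: "(\<lambda>u. F (of_real u)) \<in> borel_measurable borel"
  shows "on_half_line F \<in> borel_measurable borel"
  unfolding on_half_line_def[abs_def] by measurable

text \<open>The Jacobian x (t - x) / t raises the exponent q - 1 of t - x to q and leaves x / t =
  exp (- softplus v). Integrability is a hypothesis so that the lemma serves both F and the function
  H on a finite strip.\<close>

lemma frac_op_convolution:
  assumes F: "(\<lambda>u. F (of_real u)) \<in> borel_measurable borel" and t: "t > 0"
    and int: "integrable lborel (\<lambda>v. exp (q * (of_real (ln t) - of_real (softplus (- v))) - of_real (softplus v) -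
      exp (of_real (ln t) - of_real (softplus (- v)))) * F (of_real (ln t) - of_real (softplus v)))"
  shows "integrable lborel (\<lambda>x. ppow (t - x) (q - 1) * exp (- of_real (t - x)) * on_half_line F x)"
    and "frac_op q F (of_real (ln t)) =
      (LINT x|lborel. ppow (t - x) (q - 1) * exp (- of_real (t - x)) * on_half_line F x)"
proof -
  note [measurable] = on_half_line_measurable[OF F]
  define \<phi> where "\<phi> = (\<lambda>x. ppow (t - x) (q - 1) * exp (- of_real (t - x)) * on_half_line F x)"
  have [measurable]: "\<phi> \<in> borel_measurable borel" unfolding \<phi>_def by measurable
  have ind: "indicator {0<..<t} x *\<^sub>R \<phi> x = \<phi> x" for x
    by (auto simp: \<phi>_def ppow_def on_half_line_def indicator_def)
  have sub: "exp (ln t - softplus v - softplus (- v)) *\<^sub>R \<phi> (exp (ln t - softplus v)) =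
      exp (q * (of_real (ln t) - of_real (softplus (- v))) - of_real (softplus v) -
      exp (of_real (ln t) - of_real (softplus (- v)))) * F (of_real (ln t) - of_real (softplus v))" for v
  proof -
    have "t - exp (ln t - softplus v) = t * (1 - exp (- softplus v))"
      using t by (simp add: exp_diff exp_minus field_simps)
    also have "\<dots> = exp (ln t - softplus (- v))"
      using t exp_minus_softplus_sum[of v] by (simp add: exp_diff exp_minus divide_inverse)
    finally have d: "t - exp (ln t - softplus v) = exp (ln t - softplus (- v))" .
    have "exp (ln t - softplus v - softplus (- v)) *\<^sub>R \<phi> (exp (ln t - softplus v)) =
      exp (of_real (ln t - softplus v - softplus (- v))) * exp ((q - 1) * of_real (ln t - softplus (- v))) *
      exp (- exp (of_real (ln t - softplus (- v)))) * F (of_real (ln t - softplus v))"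
      unfolding \<phi>_def d by (simp add: ppow_def on_half_line_def scaleR_conv_of_real mult.assoc flip: exp_of_real)
    also have "exp (of_real (ln t - softplus v - softplus (- v))) * exp ((q - 1) * of_real (ln t - softplus (- v))) *
      exp (- exp (of_real (ln t - softplus (- v)))) =
      exp (q * (of_real (ln t) - of_real (softplus (- v))) - of_real (softplus v) -
        exp (of_real (ln t) - of_real (softplus (- v))))"
      unfolding exp_add[symmetric] by (simp add: algebra_simps)
    finally show ?thesis by simp
  qed
  show "integrable lborel (\<lambda>x. ppow (t - x) (q - 1) * exp (- of_real (t - x)) * on_half_line F x)"
    using sigmoid_substitution_integrable_iff[of \<phi> t] t int unfolding sub ind by (simp add: \<phi>_def)
  show "frac_op q F (of_real (ln t)) =
      (LINT x|lborel. ppow (t - x) (q - 1) * exp (- of_real (t - x)) * on_half_line F x)"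
    using sigmoid_substitution_integral[of \<phi> t] t int unfolding sub ind by (simp add: \<phi>_def frac_op_def)
qed

text \<open>Translation reduces to the interval (0, D) with D = t - x; scaling splits off the power
  of D and leaves a Beta integral. For D <= 0 the supports of the two powers do not meet.\<close>

lemma ppow_convolution:
  assumes a: "Re a > 0" and b: "Re b > 0"
  shows "integrable lborel (\<lambda>s. ppow (t - s) (a - 1) * ppow (s - x) (b - 1))"
    and "(LINT s|lborel. ppow (t - s) (a - 1) * ppow (s - x) (b - 1)) = ppow (t - x) (a + b - 1) * Beta_line a b"
proof -
  define D where "D = t - x"
  define \<phi> where "\<phi> = (\<lambda>s. ppow (D - s) (a - 1) * ppow s (b - 1))"
  have [measurable]: "\<phi> \<in> borel_measurable borel" unfolding \<phi>_def by measurable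
  have shift: "ppow (t - s) (a - 1) * ppow (s - x) (b - 1) = \<phi> (- x + 1 * s)" for s
    by (simp add: \<phi>_def D_def algebra_simps)
  have main: "integrable lborel \<phi> \<and> (LINT s|lborel. \<phi> s) = ppow D (a + b - 1) * Beta_line a b"
  proof (cases "D > 0")
    case False
    then have "\<phi> = (\<lambda>s. 0)" by (auto simp: \<phi>_def ppow_def fun_eq_iff)
    then show ?thesis using False by (simp add: ppow_def)
  next
    case D: True
    have ind: "indicator {0<..<D} s *\<^sub>R \<phi> s = \<phi> s" for s
      by (auto simp: \<phi>_def ppow_def indicator_def)
    have sub: "exp (ln D - softplus v - softplus (- v)) *\<^sub>R \<phi> (exp (ln D - softplus v)) =
        ppow D (a + b - 1) * exp (- a * of_real (softplus (- v)) - b * of_real (softplus v))" for v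
    proof -
      have "D - exp (ln D - softplus v) = D * (1 - exp (- softplus v))"
        using D by (simp add: exp_diff exp_minus field_simps)
      also have "\<dots> = exp (ln D - softplus (- v))"
        using D exp_minus_softplus_sum[of v] by (simp add: exp_diff exp_minus divide_inverse)
      finally have d: "D - exp (ln D - softplus v) = exp (ln D - softplus (- v))" .
      have "exp (ln D - softplus v - softplus (- v)) *\<^sub>R \<phi> (exp (ln D - softplus v)) =
        exp (of_real (ln D - softplus v - softplus (- v))) * exp ((a - 1) * of_real (ln D - softplus (- v))) *
        exp ((b - 1) * of_real (ln D - softplus v))"
        unfolding \<phi>_def d by (simp add: ppow_def scaleR_conv_of_real mult.assoc flip: exp_of_real)
      also have "\<dots> = ppow D (a + b - 1) * exp (- a * of_real (softplus (- v)) - b * of_real (softplus v))"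
        using D unfolding ppow_def exp_add[symmetric] by (simp add: exp_add[symmetric] algebra_simps)
      finally show ?thesis .
    qed
    have int: "integrable lborel (\<lambda>v. ppow D (a + b - 1) * exp (- a * of_real (softplus (- v)) - b * of_real (softplus v)))"
      by (rule integrable_mult_right) (rule Beta_line_integrable[OF a b])
    then show ?thesis
      using sigmoid_substitution_integrable_iff[of \<phi> D] sigmoid_substitution_integral[of \<phi> D] D
      unfolding sub ind by (simp add: Beta_line_def)
  qed
  show "integrable lborel (\<lambda>s. ppow (t - s) (a - 1) * ppow (s - x) (b - 1))"
    unfolding shift by (rule lborel_integrable_real_affine) (use main in auto)
  show "(LINT s|lborel. ppow (t - s) (a - 1) * ppow (s - x) (b - 1)) = ppow (t - x) (a + b - 1) * Beta_line a b"
    using lborel_integral_real_affine[of 1 \<phi> "- x"] main unfolding shift by (simp add: D_def)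
qed

text \<open>The exponentials exp (- (t - s)) and exp (- (s - x)) multiply to exp (- (t - x)), free
  of s, so the inner integral is a convolution of pure powers. As \<open>frac_op\<close> carries no
  factor 1 / Gamma q, the Beta value appears.\<close>

lemma frac_op_semigroup:
  assumes F: "sector_class \<infinity> \<beta> F" and \<beta>: "0 < \<beta>" "\<beta> \<le> pi / 2"
    and q1: "Re q1 > 0" and q2: "Re q2 > 0"
  shows "frac_op q1 (frac_op q2 F) (of_real w) = Beta_line q1 q2 * frac_op (q1 + q2) F (of_real w)"
proof -
  define t where "t = exp w"
  have t: "t > 0" "ln t = w" by (auto simp: t_def)
  have meas: "(\<lambda>u. F (of_real u)) \<in> borel_measurable borel" if "sector_class \<infinity> \<beta> F" for F
    using sector_class_line_measurable(1)[OF that, of 0] \<beta> by (simp add: complex_of_real_def)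
  have conv: "integrable lborel (\<lambda>x. ppow (t - x) (q - 1) * exp (- of_real (t - x)) * on_half_line F x) \<and>
      frac_op q F (of_real (ln t)) = (LINT x|lborel. ppow (t - x) (q - 1) * exp (- of_real (t - x)) * on_half_line F x)"
    if F: "sector_class \<infinity> \<beta> F" and q: "Re q > 0" and t: "t > 0" for F q t
    using frac_op_convolution[OF meas[OF F] t frac_op_integrable[OF F \<beta>(2) q, of "of_real (ln t)"]] \<beta> by simp
  note G = sector_class_frac_op[OF F \<beta>(2) q2]
  note [measurable] = on_half_line_measurable[OF meas[OF F]]
  have half: "on_half_line (frac_op q2 F) s =
      (LINT x|lborel. ppow (s - x) (q2 - 1) * exp (- of_real (s - x)) * on_half_line F x)" for s
  proof (cases "s > 0")
    case True
    then show ?thesis using conv[OF F q2 True] by (simp add: on_half_line_def)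
  next
    case False
    then have "ppow (s - x) (q2 - 1) * exp (- of_real (s - x)) * on_half_line F x = 0" for x
      by (auto simp: ppow_def on_half_line_def)
    then show ?thesis using False by (simp only:) (simp add: on_half_line_def)
  qed
  define c where "c = (\<lambda>x. exp (- of_real (t - x)) * on_half_line F x)"
  have [measurable]: "c \<in> borel_measurable borel" unfolding c_def by measurable
  define P where "P = (\<lambda>x s. c x * (ppow (t - s) (q1 - 1) * ppow (s - x) (q2 - 1)))"
  have P_eq: "ppow (t - s) (q1 - 1) * exp (- of_real (t - s)) *
      (ppow (s - x) (q2 - 1) * exp (- of_real (s - x)) * on_half_line F x) = P x s" for s x
  proof -
    have e: "exp (- of_real (t - s)) * exp (- of_real (s - x)) = exp (- complex_of_real (t - x))"
      unfolding exp_add[symmetric] by simp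
    have "ppow (t - s) (q1 - 1) * exp (- of_real (t - s)) *
        (ppow (s - x) (q2 - 1) * exp (- of_real (s - x)) * on_half_line F x) =
        (exp (- of_real (t - s)) * exp (- of_real (s - x))) *
        (on_half_line F x * (ppow (t - s) (q1 - 1) * ppow (s - x) (q2 - 1)))"
      by (simp only: mult_ac)
    then show ?thesis unfolding e P_def c_def by (simp only: mult.assoc)
  qed
  have P_int: "integrable (lborel \<Otimes>\<^sub>M lborel) (case_prod P)"
  proof (rule lborel_pair.Fubini_integrable)
    show "case_prod P \<in> borel_measurable (lborel \<Otimes>\<^sub>M lborel)"
      unfolding P_def ppow_def by measurable
    show "AE x in lborel. integrable lborel (\<lambda>s. case (x, s) of (x, s) \<Rightarrow> P x s)"
      unfolding P_def by (auto intro!: AE_I2 integrable_mult_right ppow_convolution q1 q2)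
    \<comment> \<open>The norm of a power sees only the real part of the exponent
      (\<open>norm_ppow\<close>), so the integral of norms is again a
      \<open>ppow_convolution\<close>, at the real parts of q1 and q2.\<close>
    define p where "p = complex_of_real (Re q1) + of_real (Re q2)"
    have "(LINT s|lborel. norm (P x s)) = norm (ppow (t - x) (p - 1) * exp (- of_real (t - x)) * on_half_line F x) *
        norm (Beta_line (of_real (Re q1)) (of_real (Re q2)))" for x
    proof -
      have "complex_of_real (LINT s|lborel. norm (P x s)) =
          (LINT s|lborel. of_real (norm (c x)) * (ppow (t - s) (of_real (Re q1) - 1) * ppow (s - x) (of_real (Re q2) - 1)))"
        unfolding integral_complex_of_real[symmetric]
        by (intro Bochner_Integration.integral_cong refl) (simp add: P_def norm_mult norm_ppow)
      also have "\<dots> = of_real (norm (c x)) * (ppow (t - x) (p - 1) * Beta_line (of_real (Re q1)) (of_real (Re q2)))"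
        using q1 q2 by (subst integral_mult_right_zero, subst ppow_convolution) (auto simp: p_def)
      finally have "norm (complex_of_real (LINT s|lborel. norm (P x s))) =
          norm (of_real (norm (c x)) * (ppow (t - x) (p - 1) * Beta_line (of_real (Re q1)) (of_real (Re q2))))"
        by (rule arg_cong)
      moreover have "(LINT s|lborel. norm (P x s)) \<ge> 0" by (simp add: integral_nonneg_AE)
      ultimately show ?thesis by (simp add: norm_mult c_def mult_ac)
    qed
    moreover have "integrable lborel (\<lambda>x. norm (ppow (t - x) (p - 1) * exp (- of_real (t - x)) * on_half_line F x) *
        norm (Beta_line (of_real (Re q1)) (of_real (Re q2))))"
      using conv[OF F, of p t] t q1 q2 by (intro integrable_mult_left integrable_norm) (auto simp: p_def)
    ultimately show "integrable lborel (\<lambda>x. LINT s|lborel. norm (case (x, s) of (x, s) \<Rightarrow> P x s))" by simp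
  qed
  have "frac_op q1 (frac_op q2 F) (of_real w) =
      (LINT s|lborel. ppow (t - s) (q1 - 1) * exp (- of_real (t - s)) * on_half_line (frac_op q2 F) s)"
    using conv[OF G q1 t(1)] t by simp
  also have "\<dots> = (LINT s|lborel. LINT x|lborel. P x s)"
    unfolding half P_eq[symmetric] by simp
  also have "\<dots> = (LINT x|lborel. LINT s|lborel. P x s)"
    by (rule lborel_pair.Fubini_integral[OF P_int])
  also have "\<dots> = (LINT x|lborel. Beta_line q1 q2 * (ppow (t - x) (q1 + q2 - 1) * exp (- of_real (t - x)) * on_half_line F x))"
  proof (intro Bochner_Integration.integral_cong refl)
    fix x
    have "(LINT s|lborel. P x s) = c x * (ppow (t - x) (q1 + q2 - 1) * Beta_line q1 q2)"
      unfolding P_def by (subst integral_mult_right_zero, subst ppow_convolution) (use q1 q2 in auto)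
    then show "(LINT s|lborel. P x s) =
        Beta_line q1 q2 * (ppow (t - x) (q1 + q2 - 1) * exp (- of_real (t - x)) * on_half_line F x)"
      by (simp add: c_def mult_ac)
  qed
  also have "\<dots> = Beta_line q1 q2 * frac_op (q1 + q2) F (of_real w)"
    using conv[OF F, of "q1 + q2" t] t q1 q2 by simp
  finally show ?thesis .
qed

section \<open>Fractional sums as Mellin transforms\<close>

lemma sector_class_real_bound:
  assumes F: "sector_class b \<beta> F" and \<beta>: "0 < \<beta>" and \<sigma>: "0 < \<sigma>" "ereal \<sigma> < b"
  obtains C where "\<And>u. norm (F (of_real u)) \<le> C * exp (- \<sigma> * u)"
proof -
  obtain C where C: "\<And>w. \<bar>Im w\<bar> \<le> 0 \<Longrightarrow> norm (F w) \<le> C * exp (- \<sigma> * Re w)"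
    using sector_classD[OF F \<sigma> order_refl \<beta>] by blast
  show ?thesis using that[of C] C[of "of_real _"] by simp
qed

lemma sector_class_real_measurable:
  assumes F: "sector_class b \<beta> F" and \<beta>: "0 < \<beta>"
  shows "(\<lambda>u. F (of_real u)) \<in> borel_measurable borel"
  using sector_class_line_measurable(1)[OF F, of 0] \<beta> by (simp add: complex_of_real_def)

text \<open>\<open>frac_op_integrable\<close> concerns functions with bounds of all orders. At order
  1 a single bound with \<sigma> < 1 suffices: exp (- (t - x)) is estimated by 1, and a Beta
  integrand with parameters 1 and 1 - \<sigma> remains.\<close>

lemma frac_op_one_integrable:
  fixes F :: "complex \<Rightarrow> complex"
  assumes F[measurable]: "(\<lambda>u. F (of_real u)) \<in> borel_measurable borel"
    and b: "\<And>u. norm (F (of_real u)) \<le> C * exp (- \<sigma> * u)" and \<sigma>: "\<sigma> < 1"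
  shows "integrable lborel (\<lambda>v. exp (1 * (of_real w - of_real (softplus (- v))) - of_real (softplus v) -
    exp (of_real w - of_real (softplus (- v)))) * F (of_real w - of_real (softplus v)))"
proof (rule Bochner_Integration.integrable_bound)
  show "integrable lborel (\<lambda>v. (C * exp ((1 - \<sigma>) * w)) *
      norm (exp (- 1 * of_real (softplus (- v)) - of_real (1 - \<sigma>) * of_real (softplus v) :: complex)))"
    by (intro integrable_mult_right integrable_norm Beta_line_integrable) (use \<sigma> in auto)
  have eq: "of_real w - of_real (softplus v) = (of_real (w - softplus v) :: complex)" for v by simp
  show "(\<lambda>v. exp (1 * (of_real w - of_real (softplus (- v))) - of_real (softplus v) -
    exp (of_real w - of_real (softplus (- v)))) * F (of_real w - of_real (softplus v))) \<in> borel_measurable lborel"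
    unfolding eq by measurable
  show "AE v in lborel. norm (exp (1 * (of_real w - of_real (softplus (- v))) - of_real (softplus v) -
    exp (of_real w - of_real (softplus (- v)))) * F (of_real w - of_real (softplus v))) \<le>
    norm ((C * exp ((1 - \<sigma>) * w)) *
      norm (exp (- 1 * of_real (softplus (- v)) - of_real (1 - \<sigma>) * of_real (softplus v) :: complex)))"
  proof (rule AE_I2)
    fix v
    have C: "C \<ge> 0" by (rule bound_constant_nonneg[OF b])
    have "norm (exp (1 * (of_real w - of_real (softplus (- v))) - of_real (softplus v) -
      exp (of_real w - of_real (softplus (- v)))) * F (of_real w - of_real (softplus v))) =
      exp (w - softplus (- v) - softplus v - exp (w - softplus (- v))) * norm (F (of_real (w - softplus v)))"
      by (simp add: norm_mult norm_exp_eq_Re Re_exp)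
    also have "\<dots> \<le> exp (w - softplus (- v) - softplus v) * (C * exp (- \<sigma> * (w - softplus v)))"
      by (intro mult_mono b) auto
    also have "\<dots> = C * (exp (w - softplus (- v) - softplus v) * exp (- \<sigma> * (w - softplus v)))"
      by (simp add: mult_ac)
    also have "exp (w - softplus (- v) - softplus v) * exp (- \<sigma> * (w - softplus v)) =
        exp ((1 - \<sigma>) * w) * exp (- softplus (- v) - (1 - \<sigma>) * softplus v)"
      unfolding exp_add[symmetric] by (simp add: algebra_simps)
    finally show "norm (exp (1 * (of_real w - of_real (softplus (- v))) - of_real (softplus v) -
      exp (of_real w - of_real (softplus (- v)))) * F (of_real w - of_real (softplus v))) \<le>
      norm ((C * exp ((1 - \<sigma>) * w)) *
        norm (exp (- 1 * of_real (softplus (- v)) - of_real (1 - \<sigma>) * of_real (softplus v) :: complex)))"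
      using C by (simp add: norm_exp_eq_Re mult_ac)
  qed
qed

text \<open>\<open>Re w\<close> itself is an admissible abscissa, so the quantifier over \<sigma> is
  not vacuous and the formula fixes the value.\<close>

lemma has_indef_sum_unique:
  assumes "has_indef_sum b \<psi> w v" "has_indef_sum b \<psi> w v'"
  shows "v = v'"
proof -
  have "0 < Re w" "ereal (Re w) < b" using assms by (auto simp: has_indef_sum_def vstrip_def)
  then show ?thesis using assms unfolding has_indef_sum_def by metis
qed

lemma indef_sum_eqI: "has_indef_sum b \<psi> w v \<Longrightarrow> indef_sum b \<psi> w = v"
  unfolding indef_sum_def using has_indef_sum_unique by blast

text \<open>From the inside out: the line integral gives H (ln x), the factor exp x turns the
  integral over (0, t) into exp t times the convolution \<open>frac_op 1 H\<close>, and the outer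
  exp (- t) cancels exp t, which leaves a Mellin transform.\<close>

lemma has_indef_sum_mellin:
  assumes M: "mellin_class b \<beta> (\<lambda>\<xi>. Gamma \<xi> * \<psi> \<xi>)" and \<beta>: "0 < \<beta>" "\<beta> \<le> pi / 2"
    and z: "z \<in> vstrip b" and \<sigma>0: "0 < \<sigma>0" "ereal \<sigma>0 < b"
  defines "H \<equiv> inv_mellin \<sigma>0 (\<lambda>\<xi>. Gamma \<xi> * \<psi> \<xi>)"
  shows "has_indef_sum b \<psi> z (mellin (frac_op 1 H) z / Gamma z)"
proof -
  have H: "sector_class b \<beta> H" unfolding H_def by (rule sector_class_inv_mellin[OF M \<sigma>0])
  note Hm = sector_class_real_measurable[OF H \<beta>(1)]
  have "ereal (Re z) < b" "Re z > 0" using z by (auto simp: vstrip_def)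
  \<comment> \<open>An exponent below 1 makes \<open>on_half_line H\<close> integrable at x = 0;
    \<open>b\<close> may itself be below 1.\<close>
  obtain \<sigma>1 where \<sigma>1: "0 < \<sigma>1" "\<sigma>1 < 1" "ereal \<sigma>1 < b"
  proof -
    have "(0::ereal) < min 1 b" using \<open>ereal (Re z) < b\<close> \<open>Re z > 0\<close> less_trans[of 0 "ereal (Re z)" b] by simp
    then show ?thesis using ereal_dense2[of 0 "min 1 b"] that by auto
  qed
  \<comment> \<open>An exponent above Re z controls large x; the cap Re z + 1 is the condition of
    \<open>frac_op_mellin\<close> at order 1.\<close>
  obtain \<sigma>2 where \<sigma>2: "Re z < \<sigma>2" "\<sigma>2 < Re z + 1" "ereal \<sigma>2 < b"
    using ereal_dense2[of "ereal (Re z)" "min (ereal (Re z + 1)) b"] \<open>ereal (Re z) < b\<close> by auto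
  obtain C1 where C1: "\<And>u. norm (H (of_real u)) \<le> C1 * exp (- \<sigma>1 * u)"
    using sector_class_real_bound[OF H \<beta>(1) \<sigma>1(1,3)] by blast
  obtain C2 where C2: "\<And>u. norm (H (of_real u)) \<le> C2 * exp (- \<sigma>2 * u)"
    using sector_class_real_bound[OF H \<beta>(1), of \<sigma>2] \<sigma>2 \<open>Re z > 0\<close> by auto
  have conv: "integrable lborel (\<lambda>x. ppow (t - x) (1 - 1) * exp (- of_real (t - x)) * on_half_line H x)"
    "frac_op 1 H (of_real (ln t)) = (LINT x|lborel. ppow (t - x) (1 - 1) * exp (- of_real (t - x)) * on_half_line H x)"
    if "t > 0" for t
    using frac_op_convolution[OF Hm that frac_op_one_integrable[OF Hm C1 \<sigma>1(2)]] by auto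
  have mel: "integrable lborel (\<lambda>w. exp (z * of_real w) * frac_op 1 H (of_real w))"
    using frac_op_mellin(1)[OF Hm C1 C2, of z 1] \<sigma>1 \<sigma>2 \<open>Re z > 0\<close> by simp
  \<comment> \<open>Measurability is recovered from the integrable product by dividing out the
    nowhere vanishing exponential.\<close>
  have op_meas: "(\<lambda>w. frac_op 1 H (of_real w)) \<in> borel_measurable borel"
  proof -
    have "(\<lambda>w. exp (- (z * of_real w)) * (exp (z * of_real w) * frac_op 1 H (of_real w))) \<in> borel_measurable borel"
      using borel_measurable_integrable[OF mel] by measurable
    then show ?thesis by (simp add: mult.assoc[symmetric] exp_add[symmetric])
  qed
  define \<phi> where "\<phi> = (\<lambda>t::real. exp ((z - 1) * of_real (ln t)) * frac_op 1 H (of_real (ln t)))"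
  have \<phi>_meas: "\<phi> \<in> borel_measurable borel"
    unfolding \<phi>_def using measurable_compose[OF borel_measurable_ln[OF measurable_ident_sets[OF refl]] op_meas]
    by measurable
  have \<phi>_eq: "exp u *\<^sub>R \<phi> (exp u) = exp (z * of_real u) * frac_op 1 H (of_real u)" for u
    by (simp add: \<phi>_def scaleR_conv_of_real exp_of_real[symmetric] mult.assoc[symmetric] exp_add[symmetric] algebra_simps)
  have \<phi>_int: "integrable lborel (\<lambda>t. indicator {0<..} t *\<^sub>R \<phi> t)"
    using mel unfolding exp_substitution_integrable_iff[OF \<phi>_meas] \<phi>_eq .
  have \<phi>_val: "(LINT t|lborel. indicator {0<..} t *\<^sub>R \<phi> t) = mellin (frac_op 1 H) z"
    using exp_substitution_integral[OF \<phi>_meas] mel unfolding \<phi>_eq mellin_def by simp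
  have "(\<forall>x>0. integrable lborel (line_integrand \<sigma> \<psi> x)) \<and>
        (\<forall>t>0. set_integrable lborel {0<..<t} (mid_integrand \<sigma> \<psi>)) \<and>
        set_integrable lborel {0<..} (outer_integrand \<sigma> \<psi> z) \<and>
        mellin (frac_op 1 H) z / Gamma z = 1 / Gamma z * (LINT t:{0<..}|lborel. outer_integrand \<sigma> \<psi> z t)"
    if \<sigma>: "0 < \<sigma>" "ereal \<sigma> < b" for \<sigma>
  proof -
    have line: "line_integrand \<sigma> \<psi> x =
        (\<lambda>y. \<i> * ((Gamma (Complex \<sigma> y) * \<psi> (Complex \<sigma> y)) * exp (- Complex \<sigma> y * of_real (ln x))))" if "x > 0" for x
      using that by (auto simp: fun_eq_iff line_integrand_def Let_def powr_def Ln_of_real mult_ac)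
    have 1: "integrable lborel (line_integrand \<sigma> \<psi> x)" if "x > 0" for x
      unfolding line[OF that] using inv_mellin_integrable[OF M _ \<sigma>, of "of_real (ln x)"] \<beta>
      by (intro integrable_mult_right) auto
    have mid: "mid_integrand \<sigma> \<psi> x = exp (of_real x) * on_half_line H x" if x: "x > 0" for x
    proof -
      have "mid_integrand \<sigma> \<psi> x = exp (of_real x) * inv_mellin \<sigma> (\<lambda>\<xi>. Gamma \<xi> * \<psi> \<xi>) (of_real (ln x))"
        unfolding mid_integrand_def line[OF x] integral_mult_right_zero
        by (simp add: inv_mellin_def exp_of_real)
      also have "inv_mellin \<sigma> (\<lambda>\<xi>. Gamma \<xi> * \<psi> \<xi>) (of_real (ln x)) = H (of_real (ln x))"
        unfolding H_def by (rule inv_mellin_indep[OF M _ \<sigma> \<sigma>0]) (use \<beta> in simp)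
      finally show ?thesis using x by (simp add: on_half_line_def)
    qed
    \<comment> \<open>At exponent 1 - 1 = 0 the factor \<open>ppow (t - x)\<close> is the indicator
      of x < t, and \<open>on_half_line\<close> supplies x > 0.\<close>
    have mid_ind: "indicator {0<..<t} x *\<^sub>R mid_integrand \<sigma> \<psi> x =
        exp (of_real t) * (ppow (t - x) (1 - 1) * exp (- of_real (t - x)) * on_half_line H x)" for t x
    proof (cases "0 < x \<and> x < t")
      case True
      then show ?thesis
        by (simp add: mid ppow_def mult.assoc[symmetric] exp_add[symmetric])
    next
      case False
      then show ?thesis by (auto simp: ppow_def on_half_line_def indicator_def)
    qed
    have 2: "set_integrable lborel {0<..<t} (mid_integrand \<sigma> \<psi>)" if "t > 0" for t
      unfolding set_integrable_def mid_ind using conv(1)[OF that] by (intro integrable_mult_right)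
    have outer: "indicator {0<..} t *\<^sub>R outer_integrand \<sigma> \<psi> z t = indicator {0<..} t *\<^sub>R \<phi> t" for t
    proof (cases "t > 0")
      case t: True
      have "(LINT x:{0<..<t}|lborel. mid_integrand \<sigma> \<psi> x) = exp (of_real t) * frac_op 1 H (of_real (ln t))"
        unfolding set_lebesgue_integral_def mid_ind conv(2)[OF t] by simp
      then have "outer_integrand \<sigma> \<psi> z t = exp (- of_real t) * exp ((z - 1) * of_real (ln t)) *
          (exp (of_real t) * frac_op 1 H (of_real (ln t)))"
        using t by (simp add: outer_integrand_def powr_def Ln_of_real flip: exp_of_real)
      also have "\<dots> = (exp (- of_real t) * exp (of_real t)) * \<phi> t" by (simp add: \<phi>_def mult_ac)
      also have "\<dots> = \<phi> t" by (simp add: exp_add[symmetric])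
      finally show ?thesis by simp
    qed simp
    have 3: "set_integrable lborel {0<..} (outer_integrand \<sigma> \<psi> z)"
      unfolding set_integrable_def outer by (rule \<phi>_int)
    have 4: "(LINT t:{0<..}|lborel. outer_integrand \<sigma> \<psi> z t) = mellin (frac_op 1 H) z"
      unfolding set_lebesgue_integral_def outer by (rule \<phi>_val)
    show ?thesis using 1 2 3 4 by simp
  qed
  then show ?thesis
    unfolding has_indef_sum_def using sum_admissible_if_mellin_class[OF M \<beta>] z by blast
qed

text \<open>Inserting the inverse transform and exchanging the integrals leaves Euler's integral in
  u with exponent c - \<xi>, convergent because Re \<xi> = \<sigma> < Re c.\<close>

lemma inv_mellin_parseval:
  assumes \<Phi>: "mellin_class b \<beta> \<Phi>" and \<beta>: "0 < \<beta>" and \<sigma>: "0 < \<sigma>" "ereal \<sigma> < b" and c: "\<sigma> < Re c"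
  shows "(LINT u|lborel. exp (c * of_real u - of_real (exp (u + v))) * inv_mellin \<sigma> \<Phi> (of_real u)) =
    (LINT y|lborel. \<Phi> (Complex \<sigma> y) * Gamma (c - Complex \<sigma> y) * exp (- (c - Complex \<sigma> y) * of_real v)) / (2 * pi)"
proof -
  note [measurable] = mellin_class_line_measurable[OF \<Phi> \<sigma>]
  define E where "E = (\<lambda>u y. exp (c * of_real u - of_real (exp (u + v))) *
    (\<Phi> (Complex \<sigma> y) * exp (- Complex \<sigma> y * of_real u)))"
  have E_eq: "E u y = \<Phi> (Complex \<sigma> y) * exp ((c - Complex \<sigma> y) * of_real u - of_real (exp (u + v)))" for u y
  proof -
    have "exp (c * of_real u - of_real (exp (u + v))) * exp (- Complex \<sigma> y * of_real u) =
        exp ((c - Complex \<sigma> y) * of_real u - of_real (exp (u + v)))"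
      unfolding exp_add[symmetric] by (simp add: algebra_simps)
    then show ?thesis unfolding E_def by (metis mult.left_commute)
  qed
  have \<Phi>_int: "integrable lborel (\<lambda>y. \<Phi> (Complex \<sigma> y))"
    using inv_mellin_integrable[OF \<Phi> _ \<sigma>, of 0] \<beta> by simp
  have E_int: "integrable (lborel \<Otimes>\<^sub>M lborel) (case_prod E)"
  proof (rule integrable_pair_product_bound)
    show "case_prod E \<in> borel_measurable (lborel \<Otimes>\<^sub>M lborel)" unfolding E_def by measurable
    show "integrable lborel (\<lambda>u. exp ((Re c - \<sigma>) * u - exp (u + v)))"
      by (rule Gamma_line_real) (use c in simp)
    show "integrable lborel (\<lambda>y. norm (\<Phi> (Complex \<sigma> y)))" using \<Phi>_int by simp
    show "norm (E u y) \<le> exp ((Re c - \<sigma>) * u - exp (u + v)) * norm (\<Phi> (Complex \<sigma> y))" for u y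
      unfolding E_eq by (simp add: norm_mult norm_exp_eq_Re)
  qed
  have "(LINT u|lborel. exp (c * of_real u - of_real (exp (u + v))) * inv_mellin \<sigma> \<Phi> (of_real u)) =
      (LINT u|lborel. LINT y|lborel. E u y) / (2 * pi)"
    by (simp add: inv_mellin_def E_def)
  also have "(LINT u|lborel. LINT y|lborel. E u y) = (LINT y|lborel. LINT u|lborel. E u y)"
    by (rule lborel_pair.Fubini_integral[OF E_int, symmetric])
  also have "\<dots> = (LINT y|lborel. \<Phi> (Complex \<sigma> y) * Gamma (c - Complex \<sigma> y) * exp (- (c - Complex \<sigma> y) * of_real v))"
  proof (rule Bochner_Integration.integral_cong[OF refl])
    fix y
    show "(LINT u|lborel. E u y) = \<Phi> (Complex \<sigma> y) * Gamma (c - Complex \<sigma> y) * exp (- (c - Complex \<sigma> y) * of_real v)"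
      unfolding E_eq by (subst integral_mult_right_zero, subst Gamma_line_integral) (use c in auto)
  qed
  finally show ?thesis .
qed

lemma mellin_frac_op_eq:
  assumes F: "sector_class \<infinity> \<beta> F" and \<beta>: "0 < \<beta>" and q: "Re q > 0" and z: "Re z > 0"
  shows "mellin (frac_op q F) z = (LINT v|lborel. LINT u|lborel. shear_kernel q z F v u)"
    and "integrable (lborel \<Otimes>\<^sub>M lborel) (\<lambda>(v, u). shear_kernel q z F v u)"
proof -
  note Fm = sector_class_real_measurable[OF F \<beta>]
  \<comment> \<open>The pair of exponents that Fubini demands: this one below 1, the other, Re z +
    Re q / 2, strictly between Re z and Re z + Re q.\<close>
  define \<sigma>1 where "\<sigma>1 = min (1 / 2) (Re z / 2)"
  have \<sigma>1: "0 < \<sigma>1" "\<sigma>1 < 1" "\<sigma>1 < Re z + Re q" using z q by (auto simp: \<sigma>1_def min_def)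
  obtain C1 where C1: "\<And>u. norm (F (of_real u)) \<le> C1 * exp (- \<sigma>1 * u)"
    using sector_class_real_bound[OF F \<beta> \<sigma>1(1)] by auto
  obtain C2 where C2: "\<And>u. norm (F (of_real u)) \<le> C2 * exp (- (Re z + Re q / 2) * u)"
    using sector_class_real_bound[OF F \<beta>, of "Re z + Re q / 2"] z q by auto
  show "mellin (frac_op q F) z = (LINT v|lborel. LINT u|lborel. shear_kernel q z F v u)"
    by (rule frac_op_mellin(2)[OF Fm C1 C2]) (use z q \<sigma>1 in auto)
  show "integrable (lborel \<Otimes>\<^sub>M lborel) (\<lambda>(v, u). shear_kernel q z F v u)"
    by (rule shear_kernel_integrable(1)[OF Fm C1 C2]) (use z q \<sigma>1 in auto)
qed

text \<open>At order 1 \<open>inv_mellin_parseval\<close> multiplies the transform of H by Gamma (z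
  + 1 - \<xi>), which cancels its denominator; at order q it multiplies \<Phi> \<xi> by Gamma (z + q
  - \<xi>). The results coincide, so the double integrals agree already for each fixed v.\<close>

lemma has_indef_sum_frac_kernel:
  assumes M: "mellin_class \<infinity> \<beta> (\<lambda>\<xi>. Gamma \<xi> * f \<xi>)" and \<beta>: "0 < \<beta>" "\<beta> \<le> pi / 2"
    and q: "Re q > 0" and z: "Re z > 0"
  defines "F \<equiv> inv_mellin 1 (\<lambda>\<xi>. Gamma \<xi> * f \<xi>)"
  shows "has_indef_sum (ereal (Re z + Re q)) (frac_kernel q f z) z (mellin (frac_op q F) z / Gamma z)"
proof -
  define b where "b = ereal (Re z + Re q)"
  define \<Phi> where "\<Phi> = (\<lambda>\<xi>. Gamma \<xi> * f \<xi>)"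
  define \<Phi>q where "\<Phi>q = (\<lambda>\<xi>. Gamma \<xi> * frac_kernel q f z \<xi>)"
  have \<Phi>: "mellin_class \<infinity> \<beta> \<Phi>" using M by (simp add: \<Phi>_def)
  have \<Phi>q_eq: "\<Phi>q \<xi> = \<Phi> \<xi> * (Gamma (z - \<xi> + q) * rGamma (z + 1 - \<xi>))" for \<xi>
  proof -
    have "z + 1 - \<xi> + (q - 1) = z - \<xi> + q" by simp
    then show ?thesis
      unfolding \<Phi>q_def \<Phi>_def frac_kernel_def rising_def rGamma_inverse_Gamma divide_inverse
      by (simp only: mult.assoc)
  qed
  have \<Phi>q: "mellin_class b \<beta> \<Phi>q"
    using mellin_class_mult_Gamma_ratio[OF \<Phi>, of z q] unfolding b_def \<Phi>q_eq[symmetric] .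
  \<comment> \<open>On this line Re (z + 1 - \<xi>) > 0, so the cancelled \<open>Gamma\<close> value
    is not at a pole, and the line lies in the strips of both transforms.\<close>
  define \<sigma> where "\<sigma> = Re z / 2"
  have \<sigma>: "0 < \<sigma>" "ereal \<sigma> < b" "\<sigma> < Re z" using z q by (auto simp: \<sigma>_def b_def)
  define H where "H = inv_mellin \<sigma> \<Phi>q"
  have sum: "has_indef_sum b (frac_kernel q f z) z (mellin (frac_op 1 H) z / Gamma z)"
    unfolding H_def \<Phi>q_def
    by (rule has_indef_sum_mellin[OF _ \<beta> _ \<sigma>(1,2)]) (use \<Phi>q z q in \<open>auto simp: \<Phi>q_def vstrip_def b_def\<close>)
  have H: "sector_class b \<beta> H" unfolding H_def by (rule sector_class_inv_mellin[OF \<Phi>q \<sigma>(1,2)])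
  have F: "sector_class \<infinity> \<beta> F" unfolding F_def by (rule sector_class_inv_mellin[OF M]) auto
  note Hm = sector_class_real_measurable[OF H \<beta>(1)]
  define \<sigma>1 where "\<sigma>1 = min (1 / 2) (Re z / 2)"
  \<comment> \<open>Half of \<open>min 1 (Re q)\<close> keeps the exponent below Re z + 1, as order
    1 requires, and below the edge Re z + Re q of the strip of H.\<close>
  define \<sigma>2 where "\<sigma>2 = Re z + min 1 (Re q) / 2"
  have \<sigma>1: "0 < \<sigma>1" "ereal \<sigma>1 < b" "\<sigma>1 < 1" "\<sigma>1 < Re z + 1" using z q by (auto simp: \<sigma>1_def b_def min_def)
  have \<sigma>2: "0 < \<sigma>2" "ereal \<sigma>2 < b" "Re z < \<sigma>2" "\<sigma>2 < Re z + 1" using z q by (auto simp: \<sigma>2_def b_def min_def)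
  obtain C1 where C1: "\<And>u. norm (H (of_real u)) \<le> C1 * exp (- \<sigma>1 * u)"
    using sector_class_real_bound[OF H \<beta>(1) \<sigma>1(1,2)] by blast
  obtain C2 where C2: "\<And>u. norm (H (of_real u)) \<le> C2 * exp (- \<sigma>2 * u)"
    using sector_class_real_bound[OF H \<beta>(1) \<sigma>2(1,2)] by blast
  have "mellin (frac_op 1 H) z = (LINT v|lborel. LINT u|lborel. shear_kernel 1 z H v u)"
    by (rule frac_op_mellin(2)[OF Hm C1 C2]) (use \<sigma>1 \<sigma>2 in auto)
  also have "\<dots> = (LINT v|lborel. LINT u|lborel. shear_kernel q z F v u)"
  proof (rule Bochner_Integration.integral_cong[OF refl])
    fix v
    define B where "B = (LINT y|lborel. \<Phi> (Complex \<sigma> y) * Gamma (z + q - Complex \<sigma> y) *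
      exp (- (z - Complex \<sigma> y) * of_real v))"
    \<comment> \<open>Used twice: (s, G, \<Psi>) is first (1, H, \<Phi>q) and then (q, F,
      \<Phi>).\<close>
    have cmp: "(LINT u|lborel. shear_kernel s z G v u) = exp ((z - 1) * of_real (softplus v)) * B / (2 * pi)"
      if G: "\<And>u. G (of_real u) = inv_mellin \<sigma> \<Psi> (of_real u)" and \<Psi>: "mellin_class b' \<beta> \<Psi>" "ereal \<sigma> < b'"
        and s: "\<sigma> < Re (z + s)"
        and eq: "\<And>y. \<Psi> (Complex \<sigma> y) * Gamma (z + s - Complex \<sigma> y) = \<Phi> (Complex \<sigma> y) * Gamma (z + q - Complex \<sigma> y)"
      for s G b' \<Psi>
    proof -
      have "(LINT u|lborel. shear_kernel s z G v u) = exp (s * of_real v + (z - 1) * of_real (softplus v)) *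
          (LINT u|lborel. exp ((z + s) * of_real u - of_real (exp (u + v))) * inv_mellin \<sigma> \<Psi> (of_real u))"
        unfolding shear_kernel_def G by simp
      also have "\<dots> = exp ((z - 1) * of_real (softplus v)) * (exp (s * of_real v) * (LINT y|lborel. \<Phi> (Complex \<sigma> y) *
          Gamma (z + q - Complex \<sigma> y) * exp (- (z + s - Complex \<sigma> y) * of_real v))) / (2 * pi)"
        unfolding inv_mellin_parseval[OF \<Psi>(1) \<beta>(1) \<sigma>(1) \<Psi>(2) s] eq by (simp add: exp_add mult_ac)
      also have "exp (s * of_real v) * (LINT y|lborel. \<Phi> (Complex \<sigma> y) *
          Gamma (z + q - Complex \<sigma> y) * exp (- (z + s - Complex \<sigma> y) * of_real v)) = B"
        unfolding B_def integral_mult_right_zero[symmetric]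
      proof (rule Bochner_Integration.integral_cong[OF refl])
        fix y
        have "exp (s * of_real v) * exp (- (z + s - Complex \<sigma> y) * of_real v) = exp (- (z - Complex \<sigma> y) * of_real v)"
          unfolding exp_add[symmetric] by (simp add: algebra_simps)
        then show "exp (s * of_real v) * (\<Phi> (Complex \<sigma> y) *
          Gamma (z + q - Complex \<sigma> y) * exp (- (z + s - Complex \<sigma> y) * of_real v)) =
          \<Phi> (Complex \<sigma> y) * Gamma (z + q - Complex \<sigma> y) * exp (- (z - Complex \<sigma> y) * of_real v)"
          by (metis mult.left_commute)
      qed
      finally show ?thesis .
    qed
    have "(LINT u|lborel. shear_kernel 1 z H v u) = exp ((z - 1) * of_real (softplus v)) * B / (2 * pi)"
    proof (rule cmp[OF _ \<Phi>q \<sigma>(2)])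
      fix y
      have "rGamma (z + 1 - Complex \<sigma> y) * Gamma (z + 1 - Complex \<sigma> y) = 1"
        by (rule Gamma_rGamma_right_half_plane) (use \<sigma> in simp)
      moreover have "z - Complex \<sigma> y + q = z + q - Complex \<sigma> y" by simp
      ultimately show "\<Phi>q (Complex \<sigma> y) * Gamma (z + 1 - Complex \<sigma> y) = \<Phi> (Complex \<sigma> y) * Gamma (z + q - Complex \<sigma> y)"
        by (simp only: \<Phi>q_eq mult.assoc mult_1_right)
    qed (use \<sigma> H_def in auto)
    moreover have "(LINT u|lborel. shear_kernel q z F v u) = exp ((z - 1) * of_real (softplus v)) * B / (2 * pi)"
    proof (rule cmp[OF _ \<Phi>])
      show "F (of_real u) = inv_mellin \<sigma> \<Phi> (of_real u)" for u
        unfolding F_def \<Phi>_def by (rule inv_mellin_indep[OF M]) (use \<sigma> \<beta> in auto)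
    qed (use \<sigma> q in auto)
    ultimately show "(LINT u|lborel. shear_kernel 1 z H v u) = (LINT u|lborel. shear_kernel q z F v u)"
      by simp
  qed
  also have "\<dots> = mellin (frac_op q F) z"
    by (rule mellin_frac_op_eq(1)[OF F \<beta>(1) q z, symmetric])
  finally show ?thesis using sum by (simp add: b_def)
qed

section \<open>Fractional sums: iteration, semigroup law, holomorphy\<close>

lemma frac_sum_eq_mellin:
  assumes M: "mellin_class \<infinity> \<beta> (\<lambda>\<xi>. Gamma \<xi> * f \<xi>)" and \<beta>: "0 < \<beta>" "\<beta> \<le> pi / 2"
    and q: "Re q > 0" and z: "Re z > 0"
  shows "frac_summable q f z"
    and "frac_sum q f z = mellin (frac_op q (inv_mellin 1 (\<lambda>\<xi>. Gamma \<xi> * f \<xi>))) z / (Gamma z * Gamma q)"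
  using has_indef_sum_frac_kernel[OF assms] indef_sum_eqI[OF has_indef_sum_frac_kernel[OF assms]]
  by (auto simp: frac_summable_def indef_summable_def frac_sum_def)

lemma Gamma_nonzero_right_half_plane: "Re z > 0 \<Longrightarrow> Gamma z \<noteq> 0"
  using Gamma_rGamma_right_half_plane[of z] by auto

lemma mellin_class_mult_const:
  assumes M: "mellin_class b \<beta> \<Phi>"
  shows "mellin_class b \<beta> (\<lambda>\<xi>. c * \<Phi> \<xi>)"
  unfolding mellin_class_def
proof (intro conjI allI impI)
  show "(\<lambda>\<xi>. c * \<Phi> \<xi>) holomorphic_on vstrip b"
    using M by (intro holomorphic_intros) (simp add: mellin_class_def)
  fix \<sigma>1 \<sigma>2 \<beta>' assume s: "0 < \<sigma>1" "\<sigma>1 \<le> \<sigma>2" "ereal \<sigma>2 < b" "0 \<le> \<beta>'" "\<beta>' < \<beta>"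
  obtain C where C: "\<And>\<xi>. \<sigma>1 \<le> Re \<xi> \<Longrightarrow> Re \<xi> \<le> \<sigma>2 \<Longrightarrow> norm (\<Phi> \<xi>) \<le> C * exp (- \<beta>' * \<bar>Im \<xi>\<bar>)"
    using mellin_classD[OF M s] by blast
  have "norm (c * \<Phi> \<xi>) \<le> (norm c * C) * exp (- \<beta>' * \<bar>Im \<xi>\<bar>)" if "\<sigma>1 \<le> Re \<xi>" "Re \<xi> \<le> \<sigma>2" for \<xi>
    using mult_left_mono[OF C[OF that], of "norm c"] by (simp add: norm_mult mult.assoc)
  then show "\<exists>C. \<forall>\<xi>. \<sigma>1 \<le> Re \<xi> \<and> Re \<xi> \<le> \<sigma>2 \<longrightarrow> norm (c * \<Phi> \<xi>) \<le> C * exp (- \<beta>' * \<bar>Im \<xi>\<bar>)" by blast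
qed

text \<open>By Mellin inversion a fractional sum again satisfies the hypothesis made on f, with the
  same \<beta>, and its inverse transform is the convolved F. The results above therefore apply to
  sums of fractional sums.\<close>

lemma mellin_class_frac_sum:
  assumes M: "mellin_class \<infinity> \<beta> (\<lambda>\<xi>. Gamma \<xi> * f \<xi>)" and \<beta>: "0 < \<beta>" "\<beta> \<le> pi / 2" and q: "Re q > 0"
  defines "F \<equiv> inv_mellin 1 (\<lambda>\<xi>. Gamma \<xi> * f \<xi>)"
  shows "mellin_class \<infinity> \<beta> (\<lambda>\<xi>. Gamma \<xi> * frac_sum q f \<xi>)"
    and "inv_mellin 1 (\<lambda>\<xi>. Gamma \<xi> * frac_sum q f \<xi>) (of_real x) = frac_op q F (of_real x) / Gamma q"
proof -
  have F: "sector_class \<infinity> \<beta> F" unfolding F_def by (rule sector_class_inv_mellin[OF M]) auto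
  note G = sector_class_frac_op[OF F \<beta>(2) q]
  have eq: "Gamma \<xi> * frac_sum q f \<xi> = 1 / Gamma q * mellin (frac_op q F) \<xi>" if "Re \<xi> > 0" for \<xi>
    using Gamma_nonzero_right_half_plane[OF that] frac_sum_eq_mellin(2)[OF M \<beta> q that] by (simp add: F_def)
  show "mellin_class \<infinity> \<beta> (\<lambda>\<xi>. Gamma \<xi> * frac_sum q f \<xi>)"
    by (rule mellin_class_cong[OF mellin_class_mult_const[OF mellin_class_mellin[OF G \<beta>(1)], of "1 / Gamma q"]])
       (simp add: eq vstrip_def)
  have "inv_mellin 1 (\<lambda>\<xi>. Gamma \<xi> * frac_sum q f \<xi>) (of_real x) = inv_mellin 1 (mellin (frac_op q F)) (of_real x) / Gamma q"
    by (simp add: inv_mellin_def eq)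
  also have "inv_mellin 1 (mellin (frac_op q F)) (of_real x) = frac_op q F (of_real x)"
    by (rule inv_mellin_mellin[OF G \<beta>(1)]) simp
  finally show "inv_mellin 1 (\<lambda>\<xi>. Gamma \<xi> * frac_sum q f \<xi>) (of_real x) = frac_op q F (of_real x) / Gamma q" .
qed

text \<open>Mellin inversion identifies functions on the real axis only; at real points
  \<open>frac_op\<close> samples its argument only there.\<close>

lemma frac_op_cong_real:
  assumes "\<And>x. F (of_real x) = G (of_real x)"
  shows "frac_op q F (of_real w) = frac_op q G (of_real w)"
proof -
  have "F (of_real w - of_real s) = G (of_real w - of_real s)" for s
    using assms[of "w - s"] by simp
  then show ?thesis by (simp add: frac_op_def)
qed

text \<open>The Beta value of \<open>frac_op_semigroup\<close> is Gamma q1 * Gamma q2 / Gamma (q1 +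
  q2), which converts the normalisations 1 / Gamma q1 and 1 / Gamma q2 into 1 / Gamma (q1 +
  q2).\<close>

lemma frac_sum_semigroup:
  assumes M: "mellin_class \<infinity> \<beta> (\<lambda>\<xi>. Gamma \<xi> * f \<xi>)" and \<beta>: "0 < \<beta>" "\<beta> \<le> pi / 2"
    and q1: "Re q1 > 0" and q2: "Re q2 > 0" and z: "Re z > 0"
  shows "frac_sum q1 (frac_sum q2 f) z = frac_sum (q1 + q2) f z"
proof -
  define F where "F = inv_mellin 1 (\<lambda>\<xi>. Gamma \<xi> * f \<xi>)"
  define F2 where "F2 = inv_mellin 1 (\<lambda>\<xi>. Gamma \<xi> * frac_sum q2 f \<xi>)"
  have F: "sector_class \<infinity> \<beta> F" unfolding F_def by (rule sector_class_inv_mellin[OF M]) auto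
  have F2: "F2 (of_real x) = frac_op q2 F (of_real x) / Gamma q2" for x
    unfolding F_def F2_def by (rule mellin_class_frac_sum(2)[OF M \<beta> q2])
  have op: "frac_op q1 F2 (of_real w) = Beta_line q1 q2 / Gamma q2 * frac_op (q1 + q2) F (of_real w)" for w
  proof -
    have "frac_op q1 F2 (of_real w) = frac_op q1 (\<lambda>x. frac_op q2 F x / Gamma q2) (of_real w)"
      by (rule frac_op_cong_real) (rule F2)
    also have "\<dots> = frac_op q1 (frac_op q2 F) (of_real w) / Gamma q2"
      unfolding frac_op_def[of q1] by simp
    also have "\<dots> = Beta_line q1 q2 / Gamma q2 * frac_op (q1 + q2) F (of_real w)"
      by (simp add: frac_op_semigroup[OF F \<beta> q1 q2])
    finally show ?thesis .
  qed
  have q12: "Re (q1 + q2) > 0" using q1 q2 by simp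
  have B: "Gamma (q1 + q2) * Beta_line q1 q2 = Gamma q1 * Gamma q2"
    by (rule Gamma_mult_Beta_line[OF q1 q2])
  note nz = Gamma_nonzero_right_half_plane[OF q1] Gamma_nonzero_right_half_plane[OF q2]
    Gamma_nonzero_right_half_plane[OF q12]
  have "frac_sum q1 (frac_sum q2 f) z = mellin (frac_op q1 F2) z / (Gamma z * Gamma q1)"
    unfolding F2_def by (rule frac_sum_eq_mellin(2)[OF mellin_class_frac_sum(1)[OF M \<beta> q2] \<beta> q1 z])
  also have "mellin (frac_op q1 F2) z = Beta_line q1 q2 / Gamma q2 * mellin (frac_op (q1 + q2) F) z"
    unfolding mellin_def op integral_mult_right_zero[symmetric] by (simp only: mult_ac)
  also have "Beta_line q1 q2 = Gamma q1 * Gamma q2 / Gamma (q1 + q2)"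
    using B nz by (simp add: field_simps)
  finally have "frac_sum q1 (frac_sum q2 f) z = mellin (frac_op (q1 + q2) F) z / (Gamma z * Gamma (q1 + q2))"
    using nz by simp
  also have "\<dots> = frac_sum (q1 + q2) f z"
    unfolding F_def by (rule frac_sum_eq_mellin(2)[OF M \<beta> q12 z, symmetric])
  finally show ?thesis .
qed

text \<open>Functions are total, but the iterated sums are identified only for Re z > 0; the values
  there determine the fractional sum, since F is computed on the line Re \<xi> = 1.\<close>

lemma frac_sum_cong:
  assumes M: "mellin_class \<infinity> \<beta> (\<lambda>\<xi>. Gamma \<xi> * f \<xi>)" and \<beta>: "0 < \<beta>" "\<beta> \<le> pi / 2"
    and eq: "\<And>z. Re z > 0 \<Longrightarrow> g z = f z" and q: "Re q > 0" and z: "Re z > 0"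
  shows "frac_sum q g z = frac_sum q f z"
proof -
  have M': "mellin_class \<infinity> \<beta> (\<lambda>\<xi>. Gamma \<xi> * g \<xi>)"
    by (rule mellin_class_cong[OF M]) (simp add: eq vstrip_def)
  have "inv_mellin 1 (\<lambda>\<xi>. Gamma \<xi> * g \<xi>) = inv_mellin 1 (\<lambda>\<xi>. Gamma \<xi> * f \<xi>)"
    by (simp add: fun_eq_iff inv_mellin_def eq)
  then show "frac_sum q g z = frac_sum q f z"
    using frac_sum_eq_mellin(2)[OF M \<beta> q z] frac_sum_eq_mellin(2)[OF M' \<beta> q z] by simp
qed

text \<open>The indefinite sum is taken over the half-plane here, whereas \<open>frac_sum 1\<close>
  uses the strip up to Re z + 1; both are the same Mellin transform divided by
  \<open>Gamma z\<close>.\<close>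

lemma has_indef_sum_frac_sum_one:
  assumes M: "mellin_class \<infinity> \<beta> (\<lambda>\<xi>. Gamma \<xi> * f \<xi>)" and \<beta>: "0 < \<beta>" "\<beta> \<le> pi / 2" and z: "Re z > 0"
  shows "has_indef_sum \<infinity> f z (frac_sum 1 f z)"
  using has_indef_sum_mellin[OF M \<beta>, of z 1] frac_sum_eq_mellin(2)[OF M \<beta>, of 1 z] z
  by (simp add: vstrip_def)

text \<open>Membership in the Mellin class is carried through the induction because it makes the
  next indefinite sum exist.\<close>

lemma indef_sum_iterate:
  assumes M: "mellin_class \<infinity> \<beta> (\<lambda>\<xi>. Gamma \<xi> * f \<xi>)" and \<beta>: "0 < \<beta>" "\<beta> \<le> pi / 2"
  shows "mellin_class \<infinity> \<beta> (\<lambda>\<xi>. Gamma \<xi> * (indef_sum \<infinity> ^^ n) f \<xi>) \<and>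
    (n > 0 \<longrightarrow> (\<forall>z. Re z > 0 \<longrightarrow> (indef_sum \<infinity> ^^ n) f z = frac_sum (of_nat n) f z))"
proof (induction n)
  case 0
  then show ?case using M by simp
next
  case (Suc n)
  have IH: "mellin_class \<infinity> \<beta> (\<lambda>\<xi>. Gamma \<xi> * (indef_sum \<infinity> ^^ n) f \<xi>)" using Suc by blast
  have step: "(indef_sum \<infinity> ^^ Suc n) f z = frac_sum (of_nat (Suc n)) f z" if z: "Re z > 0" for z
  proof -
    have s: "(indef_sum \<infinity> ^^ Suc n) f z = frac_sum 1 ((indef_sum \<infinity> ^^ n) f) z"
      using indef_sum_eqI[OF has_indef_sum_frac_sum_one[OF IH \<beta> z]] by simp
    show ?thesis
    \<comment> \<open>The semigroup law asks for positive real parts, so the first summation, whose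
      inner order would be 0, is treated apart.\<close>
    proof (cases "n = 0")
      case True
      then show ?thesis using s by simp
    next
      case False
      then have n: "Re (of_nat n) > 0" by simp
      have "frac_sum 1 ((indef_sum \<infinity> ^^ n) f) z = frac_sum 1 (frac_sum (of_nat n) f) z"
        using False Suc z by (intro frac_sum_cong[OF mellin_class_frac_sum(1)[OF M \<beta> n] \<beta>]) auto
      also have "\<dots> = frac_sum (1 + of_nat n) f z"
        by (rule frac_sum_semigroup[OF M \<beta> _ n z]) simp
      finally show ?thesis using s by simp
    qed
  qed
  have "Re (of_nat (Suc n)) > 0" by simp
  then have "mellin_class \<infinity> \<beta> (\<lambda>\<xi>. Gamma \<xi> * (indef_sum \<infinity> ^^ Suc n) f \<xi>)"
    by (intro mellin_class_cong[OF mellin_class_frac_sum(1)[OF M \<beta>]]) (use step in \<open>auto simp: vstrip_def\<close>)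
  then show ?case using step by blast
qed

text \<open>The exponent enters \<open>shear_kernel\<close> only through exp (q (u + v)). For Re q
  between two reals its modulus is at most the sum of the moduli at these reals, whatever the sign
  of u + v, so two integrable kernels dominate near q0.\<close>

lemma frac_sum_holomorphic_exponent:
  assumes M: "mellin_class \<infinity> \<beta> (\<lambda>\<xi>. Gamma \<xi> * f \<xi>)" and \<beta>: "0 < \<beta>" "\<beta> \<le> pi / 2" and z: "Re z > 0"
  shows "(\<lambda>q. frac_sum q f z) holomorphic_on {q. Re q > 0}"
proof -
  define F where "F = inv_mellin 1 (\<lambda>\<xi>. Gamma \<xi> * f \<xi>)"
  have F: "sector_class \<infinity> \<beta> F" unfolding F_def by (rule sector_class_inv_mellin[OF M]) auto
  note int = mellin_frac_op_eq(2)[OF F \<beta>(1) _ z]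
  have S: "open {q. Re q > 0}" by (rule open_halfspace_Re_gt)
  define k where "k = (\<lambda>q x. shear_kernel q z F (fst x) (snd x))"
  have k_int: "integrable (lborel \<Otimes>\<^sub>M lborel) (k q)" if "Re q > 0" for q
    using int[OF that] by (simp add: k_def case_prod_beta')
  \<comment> \<open>\<open>k 0\<close> serves only as the factor free of q; integrability is claimed
    for Re q > 0.\<close>
  have k_eq: "k q x = exp (q * of_real (fst x + snd x)) * k 0 x" for q x
    unfolding k_def shear_kernel_def mult.assoc[symmetric] exp_add[symmetric] by (simp add: algebra_simps)
  have k_norm: "norm (k q x) = exp (Re q * (fst x + snd x)) * norm (k 0 x)" for q x
    using k_eq[of q x] by (simp add: norm_mult norm_exp_eq_Re)
  have "(\<lambda>q. LINT x|(lborel \<Otimes>\<^sub>M lborel). k q x) holomorphic_on {q. Re q > 0}"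
  proof (rule holomorphic_on_lebesgue_integral[OF S])
    show "k q \<in> borel_measurable (lborel \<Otimes>\<^sub>M lborel)" if "q \<in> {q. Re q > 0}" for q
      using k_int that by auto
    show "(\<lambda>q. k q x) holomorphic_on {q. Re q > 0}" for x
    proof (rule holomorphic_transform)
      show "(\<lambda>q. exp (q * of_real (fst x + snd x)) * k 0 x) holomorphic_on {q. Re q > 0}"
        by (intro holomorphic_intros)
    qed (rule k_eq[symmetric])
    fix q0 assume "q0 \<in> {q. Re q > 0}"
    then have q0: "Re q0 > 0" by simp
    define g where "g = (\<lambda>x. norm (k (of_real (Re q0 / 2)) x) + norm (k (of_real (2 * Re q0)) x))"
    have "integrable (lborel \<Otimes>\<^sub>M lborel) g"
      unfolding g_def by (intro Bochner_Integration.integrable_add integrable_norm k_int) (use q0 in auto)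
    moreover have "norm (k q x) \<le> g x" if d: "dist q0 q < Re q0 / 2" for q x
    proof -
      have "\<bar>Re q - Re q0\<bar> < Re q0 / 2"
        using d abs_Re_le_cmod[of "q - q0"] by (auto simp: dist_norm norm_minus_commute)
      then have q: "Re q0 / 2 \<le> Re q" "Re q \<le> 2 * Re q0" by linarith+
      have "exp (Re q * r) \<le> exp (Re q0 / 2 * r) + exp (2 * Re q0 * r)" for r
      proof (cases "r \<ge> 0")
        case True
        then have "exp (Re q * r) \<le> exp (2 * Re q0 * r)" using q by (simp add: mult_right_mono)
        then show ?thesis by (simp add: add_increasing)
      next
        case False
        then have "exp (Re q * r) \<le> exp (Re q0 / 2 * r)"
          using mult_right_mono_neg[OF q(1), of r] by simp
        then show ?thesis by (simp add: add_increasing2)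
      qed
      from mult_right_mono[OF this norm_ge_zero[of "k 0 x"], of "fst x + snd x"] show ?thesis
        unfolding g_def k_norm[of q] k_norm[of "of_real (Re q0 / 2)"] k_norm[of "of_real (2 * Re q0)"]
        by (simp add: algebra_simps)
    qed
    ultimately show "\<exists>e>0. \<exists>g. integrable (lborel \<Otimes>\<^sub>M lborel) g \<and> (\<forall>q\<in>{q. Re q > 0}. dist q0 q < e \<longrightarrow>
        (\<forall>x\<in>space (lborel \<Otimes>\<^sub>M lborel). norm (k q x) \<le> g x))"
      using q0 by (intro exI[of _ "Re q0 / 2"]) auto
  qed
  \<comment> \<open>With the normalisation written through the entire function
    \<open>rGamma\<close>, its holomorphy in q is immediate.\<close>
  then have "(\<lambda>q. (LINT x|(lborel \<Otimes>\<^sub>M lborel). k q x) * (rGamma z * rGamma q)) holomorphic_on {q. Re q > 0}"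
    by (intro holomorphic_intros)
  then show ?thesis
  proof (rule holomorphic_transform)
    fix q assume "q \<in> {q. Re q > 0}"
    then have q: "Re q > 0" by simp
    have "(LINT x|(lborel \<Otimes>\<^sub>M lborel). k q x) = mellin (frac_op q F) z"
      unfolding mellin_frac_op_eq(1)[OF F \<beta>(1) q z]
      using lborel_pair.integral_fst'[OF k_int[OF q]] by (simp add: k_def)
    then show "(LINT x|(lborel \<Otimes>\<^sub>M lborel). k q x) * (rGamma z * rGamma q) = frac_sum q f z"
      unfolding frac_sum_eq_mellin(2)[OF M \<beta> q z] F_def[symmetric]
      by (simp add: rGamma_inverse_Gamma divide_inverse)
  qed
qed

text \<open>\<open>Gamma\<close> spends the rate \<alpha> on the growth of f and keeps any \<beta>'
  with \<beta>' + \<alpha> < pi / 2; the factor exp (\<rho> Re \<xi>) is bounded on vertical strips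
  of finite width.\<close>

lemma mellin_class_exp_class:
  assumes f: "f \<in> exp_class"
  obtains \<beta> where "0 < \<beta>" "\<beta> \<le> pi / 2" "mellin_class \<infinity> \<beta> (\<lambda>\<xi>. Gamma \<xi> * f \<xi>)"
proof -
  obtain \<alpha> \<rho> C where a: "0 \<le> \<alpha>" "\<alpha> < pi / 2" "\<rho> \<ge> 0" "C > 0"
    and fb: "\<And>z. Re z > 0 \<Longrightarrow> norm (f z) < C * exp (\<alpha> * \<bar>Im z\<bar> + \<rho> * \<bar>Re z\<bar>)"
    using f unfolding exp_class_def by blast
  have V: "vstrip \<infinity> = {z. Re z > 0}" by (auto simp: vstrip_def)
  have "mellin_class \<infinity> (pi / 2 - \<alpha>) (\<lambda>\<xi>. Gamma \<xi> * f \<xi>)"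
    unfolding mellin_class_def
  proof (intro conjI allI impI)
    show "(\<lambda>\<xi>. Gamma \<xi> * f \<xi>) holomorphic_on vstrip \<infinity>"
      using mellin_class_Gamma f unfolding mellin_class_def exp_class_def V
      by (intro holomorphic_on_mult) auto
    fix \<sigma>1 \<sigma>2 \<beta>' :: real assume s: "0 < \<sigma>1" "\<sigma>1 \<le> \<sigma>2" "0 \<le> \<beta>'" "\<beta>' < pi / 2 - \<alpha>"
    obtain C1 where C1: "C1 \<ge> 0"
      "\<And>\<xi>. \<sigma>1 \<le> Re \<xi> \<Longrightarrow> Re \<xi> \<le> \<sigma>2 \<Longrightarrow> norm (Gamma \<xi>) \<le> C1 * exp (- (\<beta>' + \<alpha>) * \<bar>Im \<xi>\<bar>)"
      using mellin_classD[OF mellin_class_Gamma s(1,2), of "\<beta>' + \<alpha>"] s a by auto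
    have "norm (Gamma \<xi> * f \<xi>) \<le> (C1 * C * exp (\<rho> * \<sigma>2)) * exp (- \<beta>' * \<bar>Im \<xi>\<bar>)"
      if \<xi>: "\<sigma>1 \<le> Re \<xi>" "Re \<xi> \<le> \<sigma>2" for \<xi>
    proof -
      have "norm (f \<xi>) \<le> C * exp (\<alpha> * \<bar>Im \<xi>\<bar> + \<rho> * \<bar>Re \<xi>\<bar>)" using fb[of \<xi>] \<xi> s by simp
      also have "\<dots> \<le> C * exp (\<alpha> * \<bar>Im \<xi>\<bar> + \<rho> * \<sigma>2)"
        using a \<xi> s by (intro mult_left_mono) (auto intro!: mult_left_mono)
      finally have "norm (Gamma \<xi> * f \<xi>) \<le> (C1 * exp (- (\<beta>' + \<alpha>) * \<bar>Im \<xi>\<bar>)) * (C * exp (\<alpha> * \<bar>Im \<xi>\<bar> + \<rho> * \<sigma>2))"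
        unfolding norm_mult using C1 \<xi> by (intro mult_mono) auto
      also have "\<dots> = C1 * C * (exp (- (\<beta>' + \<alpha>) * \<bar>Im \<xi>\<bar>) * exp (\<alpha> * \<bar>Im \<xi>\<bar> + \<rho> * \<sigma>2))" by (simp add: mult_ac)
      also have "exp (- (\<beta>' + \<alpha>) * \<bar>Im \<xi>\<bar>) * exp (\<alpha> * \<bar>Im \<xi>\<bar> + \<rho> * \<sigma>2) = exp (\<rho> * \<sigma>2) * exp (- \<beta>' * \<bar>Im \<xi>\<bar>)"
        unfolding exp_add[symmetric] by (simp add: algebra_simps)
      finally show ?thesis by (simp add: mult_ac)
    qed
    then show "\<exists>C. \<forall>\<xi>. \<sigma>1 \<le> Re \<xi> \<and> Re \<xi> \<le> \<sigma>2 \<longrightarrow> norm (Gamma \<xi> * f \<xi>) \<le> C * exp (- \<beta>' * \<bar>Im \<xi>\<bar>)" by blast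
  qed
  then show ?thesis using that[of "pi / 2 - \<alpha>"] a by auto
qed

theorem theorem4p2:
  fixes f :: "complex \<Rightarrow> complex"
  assumes "f \<in> exp_class"
  shows "(\<forall>q z. Re q > 0 \<longrightarrow> Re z > 0 \<longrightarrow> frac_summable q f z) \<and>
    (\<forall>q1 q2 z. Re q1 > 0 \<longrightarrow> Re q2 > 0 \<longrightarrow> Re z > 0 \<longrightarrow> frac_summable q1 (frac_sum q2 f) z) \<and>
    is_differsum \<infinity> {s. Re s < 0} (\<lambda>s. frac_sum (- s)) f"
proof -
  obtain \<beta> where \<beta>: "0 < \<beta>" "\<beta> \<le> pi / 2" and M: "mellin_class \<infinity> \<beta> (\<lambda>\<xi>. Gamma \<xi> * f \<xi>)"
    using mellin_class_exp_class[OF assms] by blast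
  have V: "vstrip \<infinity> = {z. Re z > 0}" by (auto simp: vstrip_def)
  have "is_differsum \<infinity> {s. Re s < 0} (\<lambda>s. frac_sum (- s)) f"
    unfolding is_differsum_def V
  proof (intro conjI ballI allI impI)
    show "open {s. Re s < 0}" by (rule open_halfspace_Re_lt)
    show "f holomorphic_on {z. Re z > 0}" using assms by (simp add: exp_class_def)
  next
    fix z assume "z \<in> {z. Re z > 0}"
    then have z: "Re z > 0" by simp
    have "((\<lambda>q. frac_sum q f z) \<circ> uminus) holomorphic_on {s. Re s < 0}"
      by (rule holomorphic_on_compose_gen[OF _ frac_sum_holomorphic_exponent[OF M \<beta> z]])
         (auto intro!: holomorphic_intros)
    then show "(\<lambda>s. frac_sum (- s) f z) holomorphic_on {s. Re s < 0}" by (simp add: o_def)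
  next
    fix s assume "s \<in> {s. Re s < 0}"
    then have q: "Re (- s) > 0" by simp
    \<comment> \<open>Holomorphy in z: \<open>Gamma z\<close> times the fractional sum is in the
      Mellin class, and admissibility includes holomorphy after division by
      \<open>Gamma\<close>.\<close>
    from sum_admissible_if_mellin_class[OF mellin_class_frac_sum(1)[OF M \<beta> q] \<beta>]
    show "frac_sum (- s) f holomorphic_on {z. Re z > 0}" by (simp add: sum_admissible_def V)
  next
    fix n :: nat and z
    assume "of_nat n \<in> {s. Re s < 0}"
    then show "frac_sum (- of_nat n) f z = (backward_diff ^^ n) f z" by simp
  next
    fix n k :: nat and z assume "z \<in> {z. Re z > 0}"
    then show "indef_summable \<infinity> ((indef_sum \<infinity> ^^ k) f) z"
      using has_indef_sum_frac_sum_one[OF conjunct1[OF indef_sum_iterate[OF M \<beta>, of k]] \<beta>]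
      by (auto simp: indef_summable_def)
  next
    fix n :: nat and z assume "- of_nat n \<in> {s. Re s < 0}" "z \<in> {z. Re z > 0}"
    then show "frac_sum (- (- of_nat n)) f z = (indef_sum \<infinity> ^^ n) f z"
      using indef_sum_iterate[OF M \<beta>, of n] by simp
  next
    fix s0 s1 z assume "s0 \<in> {s. Re s < 0}" "s1 \<in> {s. Re s < 0}" "z \<in> {z. Re z > 0}"
    then show "frac_sum (- s0) (frac_sum (- s1) f) z = frac_sum (- (s0 + s1)) f z"
      using frac_sum_semigroup[OF M \<beta>, of "- s0" "- s1" z] by (simp add: algebra_simps)
  qed
  \<comment> \<open>Convergence is asserted separately because \<open>indef_sum\<close> is a
    definite description: the identities then concern genuine values, also for sums of
    \<open>frac_sum q2 f\<close>.\<close>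
  then show ?thesis
    using frac_sum_eq_mellin(1)[OF M \<beta>] frac_sum_eq_mellin(1)[OF mellin_class_frac_sum(1)[OF M \<beta>] \<beta>] by blast
qed

end
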